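(* There is an absolute constant $c>0$ such that the following holds. Fix positive integers $n\le\ell$ and a degree sequence $\mathrm d=(d_1,\dots,d_\ell)$ of the form $(d_1,\dots,d_n,2,\dots,2)$ with $d_v\ge3$ for all $v\in[n]$ (and $d_v=2$ for $n<v\le\ell$), and such that $\mathcal G^-_{\mathrm d}$ is nonempty. Let $\mathbf C$ be a uniformly random element of $\mathcal G^-_{\mathrm d}$ and let $\mathbf K=K(\mathbf C)$. Write $2m=\sum_{v\in[n]}d_v$ (so that $K(C)$ has $m$ edges for every $C\in\mathcal G^-_{\mathrm d}$). Then $$\mathbb P\left\{\operatorname{diam}^+(\mathbf K)\ge31\log m\right\}\le\frac{c}{m}.$$
   Context: A degree sequence is a sequence of positive integers with even sum; $[n]=\{1,\dots,n\}$. $\mathcal G^-_{\mathrm d}$ is the set of all (not necessarily connected) simple graphs $G$ with vertex set $[\ell]$, with $\deg_G(v)=d_v$ for all $v\in[\ell]$, and with no connected component that is a cycle. For a graph $C$ with minimum degree at least $2$ and no cycle components, the kernel $K(C)$ is the multigraph (loops and multiple edges allowed) with vertex set $\{v\in V(C):\deg_C(v)\ge3\}$ obtained from $C$ by replacing each maximal path all of whose internal vertices have degree $2$ by a single edge (such a path may be closed, in which case it yields a loop). $\operatorname{diam}^+(K)=\max_{u,v\in V(K)}\operatorname{dist}_K(u,v)$, where $\operatorname{dist}_K$ is the graph distance, so $\operatorname{diam}^+(K)=\infty$ if $K$ is not connected. *)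

theory Defs
  imports "HOL-Probability.Probability"
begin

section \<open>Simple graphs\<close>

record 'a ugraph =
  verts :: "'a set"
  edges :: "'a set set"

definition simple_graph :: "'a ugraph \<Rightarrow> bool" where
  "simple_graph G \<longleftrightarrow> (\<forall>e \<in> edges G. e \<subseteq> verts G \<and> card e = 2)"

definition deg :: "'a ugraph \<Rightarrow> 'a \<Rightarrow> nat" where
  "deg G v = card {e \<in> edges G. v \<in> e}"

definition adj :: "'a ugraph \<Rightarrow> ('a \<times> 'a) set" where
  "adj G = {(u, v). {u, v} \<in> edges G}"

definition component_of :: "'a ugraph \<Rightarrow> 'a \<Rightarrow> 'a ugraph" where
  "component_of G v =
     (let S = (adj G)\<^sup>* `` {v} in \<lparr>verts = S, edges = {e \<in> edges G. e \<subseteq> S}\<rparr>)"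

definition graph_components :: "'a ugraph \<Rightarrow> 'a ugraph set" where
  "graph_components G = component_of G ` verts G"

definition is_cycle :: "'a ugraph \<Rightarrow> bool" where
  "is_cycle G \<longleftrightarrow> (\<exists>vs. distinct vs \<and> 3 \<le> length vs \<and> verts G = set vs \<and>
     edges G = {{vs ! i, vs ! (Suc i mod length vs)} |i. i < length vs})"

section \<open>Multigraphs\<close>

text \<open>Each edge has a set of one (for a loop) or two endpoints.\<close>

record ('a, 'e) multigraph =
  mverts :: "'a set"
  medges :: "'e set"
  mends :: "'e \<Rightarrow> 'a set"

definition madj :: "('a, 'e) multigraph \<Rightarrow> ('a \<times> 'a) set" where
  "madj K = {(u, v). \<exists>e \<in> medges K. mends K e = {u, v}}"

text \<open>The least length of a walk from \<open>u\<close> to \<open>v\<close>; it is \<open>\<infinity>\<close> if there is none.\<close>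

definition mdist :: "('a, 'e) multigraph \<Rightarrow> 'a \<Rightarrow> 'a \<Rightarrow> enat" where
  "mdist K u v = (INF k \<in> {k. (u, v) \<in> madj K ^^ k}. enat k)"

definition diam_plus :: "('a, 'e) multigraph \<Rightarrow> enat" where
  "diam_plus K = (SUP u \<in> mverts K. SUP v \<in> mverts K. mdist K u v)"

section \<open>The kernel\<close>

definition path_edges :: "'a list \<Rightarrow> 'a set set" where
  "path_edges p = {{p ! i, p ! Suc i} |i. Suc i < length p}"

text \<open>A path of positive length, given by its list of vertices. It may be closed, in
  which case the base point is both the first and the last entry; the length condition
  then excludes running back and forth along a single edge.\<close>

definition graph_path :: "'a ugraph \<Rightarrow> 'a list \<Rightarrow> bool" where
  "graph_path G p \<longleftrightarrow> 2 \<le> length p \<and> set p \<subseteq> verts G \<and> path_edges p \<subseteq> edges G \<and>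
     distinct (butlast p) \<and> distinct (tl p) \<and> (hd p = last p \<longrightarrow> 4 \<le> length p)"

definition internal_verts :: "'a list \<Rightarrow> 'a set" where
  "internal_verts p = set (butlast (tl p))"

definition deg2_path :: "'a ugraph \<Rightarrow> 'a list \<Rightarrow> bool" where
  "deg2_path G p \<longleftrightarrow> graph_path G p \<and> (\<forall>v \<in> internal_verts p. deg G v = 2)"

definition maximal_deg2_path :: "'a ugraph \<Rightarrow> 'a list \<Rightarrow> bool" where
  "maximal_deg2_path G p \<longleftrightarrow>
     deg2_path G p \<and> \<not> (\<exists>q. deg2_path G q \<and> path_edges p \<subset> path_edges q)"

text \<open>An edge of the kernel is a pair consisting of the set of endpoints and the edge set
  of a maximal path. The edge set makes parallel edges distinct, while a path and its
  reversal give the same kernel edge.\<close>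

definition graph_kernel :: "'a ugraph \<Rightarrow> ('a, 'a set \<times> 'a set set) multigraph" where
  "graph_kernel G =
     \<lparr>mverts = {v \<in> verts G. 3 \<le> deg G v},
      medges = {({hd p, last p}, path_edges p) |p. maximal_deg2_path G p},
      mends = fst\<rparr>"

section \<open>Graphs with a given degree sequence\<close>

definition degree_sequence :: "nat \<Rightarrow> (nat \<Rightarrow> nat) \<Rightarrow> bool" where
  "degree_sequence l d \<longleftrightarrow> (\<forall>v \<in> {1..l}. 0 < d v) \<and> even (\<Sum>v = 1..l. d v)"

definition graphs_minus :: "nat \<Rightarrow> (nat \<Rightarrow> nat) \<Rightarrow> nat ugraph set" where
  "graphs_minus l d =
     {G. simple_graph G \<and> verts G = {1..l} \<and> (\<forall>v \<in> {1..l}. deg G v = d v) \<and>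
         (\<forall>H \<in> graph_components G. \<not> is_cycle H)}"

lemma finite_graphs_minus: "finite (graphs_minus l d)"
proof -
  have "graphs_minus l d \<subseteq>
      (\<lambda>E. \<lparr>verts = {1..l}, edges = E\<rparr>) ` Pow (Pow {1..l})"
  proof
    fix G assume "G \<in> graphs_minus l d"
    then have "G = \<lparr>verts = {1..l}, edges = edges G\<rparr>" "edges G \<subseteq> Pow {1..l}"
      by (auto simp: graphs_minus_def simple_graph_def)
    then show "G \<in> (\<lambda>E. \<lparr>verts = {1..l}, edges = E\<rparr>) ` Pow (Pow {1..l})"
      by blast
  qed
  then show ?thesis
    by (rule finite_subset) simp
qed

end

theory Submission
  imports Defs "HOL-Combinatorics.Transposition" "HOL-Real_Asymp.Real_Asymp"
begin

text \<open>
The proof compares sets of graphs by switchings. Label the ends of the \<open>m\<close> kernel edges by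
\<open>2 m\<close> darts, so that each graph of the class carries the same number of labellings and a
uniform labelled graph projects to the uniform graph. A labelled graph determines a fixed point
free involution on the darts (the two ends of a kernel edge), and exchanging two darts \<open>h\<close>
and \<open>g\<close> conjugates this involution by the transposition of \<open>h\<close> and \<open>g\<close>: the
two kernel edges, with the vertices of degree two on them, exchange one end each. The result is
again a graph of the class unless a double edge or a loop without interior vertices arises.

Explore the kernel from a vertex \<open>u\<close> in layers and let the volume of a set of vertices be the
sum of its degrees. While the explored volume is at most \<open>m\<close>, at least \<open>m / 2\<close> kernel edges
avoid the explored part and its neighbours. Exchanging ends of \<open>t\<close> edges of the
explored part that are not in its breadth-first tree with ends of such far edges can therefore be
done in many ways, and none of these exchanges creates a multiple edge with an old edge. To undo
the exchanges one only has to find the new edges, and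
these leave the explored part, where few edges do (\<open>switching_bound\<close>). Hence graphs with many
non-tree edges are rare: \<open>two_inner_bound\<close> and \<open>many_inner_bound\<close> are crude and serve
while the volume is small, \<open>inside_bound\<close> and \<open>collisions_bound\<close> distinguish edges
inside a layer from superfluous edges to the next layer and serve for
all larger volumes. The smallest case decides the error term: two non-tree edges near \<open>u\<close> have
probability of order \<open>1 / m\<^sup>2\<close>, and one such edge does not stop the exploration.

As all kernel degrees are at least three, few non-tree edges force the volume to grow by the
factor \<open>17 / 15\<close> with each layer until it is a constant proportion of \<open>m\<close>, and then to
grow by a constant proportion of \<open>m\<close> (locale \<open>growth\<close>). So with probability
\<open>1 - O(1 / m\<^sup>2)\<close> the ball of radius \<open>15 ln m\<close> around \<open>u\<close> has volume greater
than \<open>m\<close> (\<open>slow_exploration_rare\<close>), and by a union bound this holds for all of the at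
most \<open>m\<close> kernel vertices with probability \<open>1 - O(1 / m)\<close>. Two balls of volume greater
than \<open>m\<close> meet since the total volume is \<open>2 m\<close>, so all distances are at most
\<open>30 ln m\<close>.
\<close>

section \<open>Lists chosen one entry at a time\<close>

text \<open>The newest entry is at the head of the list, and the set of its possible values may depend on the
entries chosen before. Sequences of switchings and guesses of the darts moved by them are both
of this form.\<close>

primrec choices :: "('a list \<Rightarrow> 'a set) \<Rightarrow> nat \<Rightarrow> 'a list set" where
  "choices S 0 = {[]}"
| "choices S (Suc n) = (\<Union>xs \<in> choices S n. (\<lambda>x. x # xs) ` S xs)"

lemma length_choices: "xs \<in> choices S n \<Longrightarrow> length xs = n"
  by (induction n arbitrary: xs) auto

lemma finite_choices: "(\<And>xs. finite (S xs)) \<Longrightarrow> finite (choices S n)"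
  by (induction n) auto

lemma card_choices_Suc:
  assumes "\<And>xs. finite (S xs)"
  shows "card (choices S (Suc n)) = (\<Sum>xs \<in> choices S n. card (S xs))"
proof -
  have "card (choices S (Suc n)) = (\<Sum>xs \<in> choices S n. card ((\<lambda>x. x # xs) ` S xs))"
    unfolding choices.simps
    by (rule card_UN_disjoint) (auto simp: assms finite_choices)
  also have "\<dots> = (\<Sum>xs \<in> choices S n. card (S xs))"
    by (intro sum.cong refl card_image) (auto simp: inj_on_def)
  finally show ?thesis .
qed

lemma card_choices_ge:
  assumes "\<And>xs. finite (S xs)"
    and "\<And>n xs. n < t \<Longrightarrow> xs \<in> choices S n \<Longrightarrow> b \<le> card (S xs)"
  shows "b ^ t \<le> card (choices S t)"
  using assms(2)
proof (induction t)
  case (Suc t)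
  have "b ^ t \<le> card (choices S t)"
    by (rule Suc.IH) (use Suc.prems less_SucI in blast)
  then have "b ^ Suc t \<le> card (choices S t) * b"
    by (simp add: mult.commute)
  also have "\<dots> = (\<Sum>xs \<in> choices S t. b)"
    by simp
  also have "\<dots> \<le> (\<Sum>xs \<in> choices S t. card (S xs))"
    by (rule sum_mono) (use Suc.prems in auto)
  finally show ?case
    using card_choices_Suc[OF assms(1)] by simp
qed simp

lemma card_choices_le:
  assumes "\<And>xs. finite (S xs)" and "\<And>xs. card (S xs) \<le> b"
  shows "card (choices S t) \<le> b ^ t"
proof (induction t)
  case (Suc t)
  have "card (choices S (Suc t)) \<le> (\<Sum>xs \<in> choices S t. b)"
    unfolding card_choices_Suc[OF assms(1)] by (rule sum_mono) (use assms in auto)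
  also have "\<dots> \<le> b ^ Suc t"
    using Suc by (simp add: mult.commute)
  finally show ?case .
qed simp

section \<open>Dart systems and switchings\<close>

text \<open>In a state \<open>s\<close>, the involution \<open>sg s\<close> joins each dart to the other end of its edge, and
\<open>dr s h\<close> says that the edge at \<open>h\<close> is direct, that is, has no interior vertices. Only
direct edges are restricted by simplicity of the underlying graph: loops and parallel edges of the
kernel are allowed as soon as they are subdivided.\<close>

locale dart_system =
  fixes H :: "'h::linorder set" and V :: "'v set" and base :: "'h \<Rightarrow> 'v" and Om :: "'s set"
    and sg :: "'s \<Rightarrow> 'h \<Rightarrow> 'h" and dr :: "'s \<Rightarrow> 'h \<Rightarrow> bool"
  assumes finH: "finite H" and finV: "finite V" and finOm: "finite Om"
    and base_V: "h \<in> H \<Longrightarrow> base h \<in> V"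
    and deg3: "v \<in> V \<Longrightarrow> 3 \<le> card {h \<in> H. base h = v}"
    and sg_in: "s \<in> Om \<Longrightarrow> h \<in> H \<Longrightarrow> sg s h \<in> H"
    and sg_sg: "s \<in> Om \<Longrightarrow> h \<in> H \<Longrightarrow> sg s (sg s h) = h"
    and sg_neq: "s \<in> Om \<Longrightarrow> h \<in> H \<Longrightarrow> sg s h \<noteq> h"
    and dr_sg: "s \<in> Om \<Longrightarrow> h \<in> H \<Longrightarrow> dr s (sg s h) = dr s h"
    and dr_loop: "s \<in> Om \<Longrightarrow> h \<in> H \<Longrightarrow> dr s h \<Longrightarrow> base (sg s h) \<noteq> base h"
    and dr_par: "s \<in> Om \<Longrightarrow> h \<in> H \<Longrightarrow> d \<in> H \<Longrightarrow> dr s h \<Longrightarrow> dr s d \<Longrightarrow> base d = base h \<Longrightarrow>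
      base (sg s d) = base (sg s h) \<Longrightarrow> d = h"
begin

text \<open>After the exchange the edge of \<open>g\<close>, with its interior, joins the other end of \<open>g\<close> to the
base of \<open>h\<close>. The last two conditions say that this edge, if direct, has no direct parallel
before the exchange, and symmetrically for the edge of \<open>h\<close>.\<close>

definition swappable :: "'s \<Rightarrow> 'h \<Rightarrow> 'h \<Rightarrow> bool" where
  "swappable s h g \<longleftrightarrow> h \<in> H \<and> g \<in> H \<and> base h \<noteq> base g \<and> base (sg s h) \<noteq> base g \<and>
     base (sg s g) \<noteq> base h \<and>
     \<not> (dr s g \<and> (\<exists>d \<in> H. dr s d \<and> base d = base h \<and> base (sg s d) = base (sg s g))) \<and>
     \<not> (dr s h \<and> (\<exists>d \<in> H. dr s d \<and> base d = base g \<and> base (sg s d) = base (sg s h)))"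

end

locale switch_system = dart_system H V base Om sg dr
  for H :: "'h::linorder set" and V :: "'v set" and base :: "'h \<Rightarrow> 'v" and Om :: "'s set"
    and sg :: "'s \<Rightarrow> 'h \<Rightarrow> 'h" and dr :: "'s \<Rightarrow> 'h \<Rightarrow> bool" +
  fixes sw :: "'h \<Rightarrow> 'h \<Rightarrow> 's \<Rightarrow> 's"
  assumes sw_in: "s \<in> Om \<Longrightarrow> swappable s h g \<Longrightarrow> sw h g s \<in> Om"
    and sg_sw: "s \<in> Om \<Longrightarrow> swappable s h g \<Longrightarrow> d \<in> H \<Longrightarrow>
      sg (sw h g s) d = Transposition.transpose h g (sg s (Transposition.transpose h g d))"
    and dr_sw: "s \<in> Om \<Longrightarrow> swappable s h g \<Longrightarrow> d \<in> H \<Longrightarrow>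
      dr (sw h g s) d = dr s (Transposition.transpose h g d)"
    and sw_inj: "s \<in> Om \<Longrightarrow> s' \<in> Om \<Longrightarrow> swappable s h g \<Longrightarrow> swappable s' h g \<Longrightarrow>
      sw h g s = sw h g s' \<Longrightarrow> s = s'"
begin

definition touched :: "'s \<Rightarrow> ('h \<times> 'h) list \<Rightarrow> 'h set" where
  "touched s ms = (\<Union>(h, g) \<in> set ms. {h, sg s h, g, sg s g})"

primrec run :: "('h \<times> 'h) list \<Rightarrow> 's \<Rightarrow> 's" where
  "run [] s = s"
| "run (x # ms) s = sw (fst x) (snd x) (run ms s)"

text \<open>An edge is given by one dart in \<open>P i\<close> (for step \<open>i\<close>) or in \<open>Q\<close>, but either of its
ends may be exchanged. No edge is used twice.\<close>

definition moves :: "'s \<Rightarrow> (nat \<Rightarrow> 'h set) \<Rightarrow> 'h set \<Rightarrow> ('h \<times> 'h) list \<Rightarrow> ('h \<times> 'h) set" where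
  "moves s P Q ms = {(h, g). h \<in> H \<and> g \<in> H \<and> h \<notin> touched s ms \<and> g \<notin> touched s ms \<and>
     (h \<in> P (length ms) \<or> sg s h \<in> P (length ms)) \<and> (g \<in> Q \<or> sg s g \<in> Q) \<and>
     swappable (run ms s) h g}"

lemma finite_moves: "finite (moves s P Q ms)"
  by (rule finite_subset[of _ "H \<times> H"]) (auto simp: moves_def finH)

text \<open>The edges at \<open>P\<close> live on \<open>X\<close>, those at \<open>Q\<close> on \<open>Y\<close>, and no edge joins
\<open>X\<close> to \<open>Y\<close>. Hence a new edge, which joins \<open>X\<close> to \<open>Y\<close>, can only be parallel
to another new edge.\<close>

definition apart :: "'s \<Rightarrow> (nat \<Rightarrow> 'h set) \<Rightarrow> 'h set \<Rightarrow> 'v set \<Rightarrow> 'v set \<Rightarrow> bool" where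
  "apart s P Q X Y \<longleftrightarrow> X \<inter> Y = {} \<and> (\<forall>d \<in> H. base d \<in> X \<longrightarrow> base (sg s d) \<notin> Y) \<and>
     (\<forall>i. \<forall>h \<in> P i. h \<in> H \<and> base h \<in> X \<and> base (sg s h) \<in> X) \<and>
     (\<forall>g \<in> Q. g \<in> H \<and> base g \<in> Y \<and> base (sg s g) \<in> Y)"

lemma touched_sg: 
  assumes "s \<in> Om" "set ms \<subseteq> H \<times> H" "d \<in> touched s ms"
  shows "sg s d \<in> touched s ms"
proof -
  obtain h g where hg: "(h, g) \<in> set ms" "d \<in> {h, sg s h, g, sg s g}"
    using assms(3) by (auto simp: touched_def)
  then have "sg s (sg s h) = h" "sg s (sg s g) = g" using sg_sg[OF assms(1)] assms(2) by auto
  then have "sg s d \<in> {h, sg s h, g, sg s g}" using hg(2) by auto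
  then show ?thesis unfolding touched_def by (intro UN_I[OF hg(1)]) simp
qed

lemma run_invariant:
  assumes s: "s \<in> Om" and ap: "apart s P Q X Y"
  shows "ms \<in> choices (moves s P Q) n \<Longrightarrow>
    run ms s \<in> Om \<and>
    (\<forall>d \<in> H - touched s ms. sg (run ms s) d = sg s d \<and> dr (run ms s) d = dr s d) \<and>
    (\<forall>(h, g) \<in> set ms. h \<in> H \<and> g \<in> H \<and> base h \<in> X \<and> base (sg s h) \<in> X \<and> base g \<in> Y \<and>
       base (sg s g) \<in> Y \<and> sg (run ms s) h = sg s g \<and> sg (run ms s) (sg s h) = g)"
proof (induction n arbitrary: ms)
  case 0
  then show ?case using s by (simp add: touched_def)
next
  case (Suc n)
  then obtain h g ms' where ms: "ms = (h, g) # ms'" and ms': "ms' \<in> choices (moves s P Q) n"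
    and mv: "(h, g) \<in> moves s P Q ms'"
    by auto
  note IH = Suc.IH[OF ms']
  define s1 where "s1 = run ms' s"
  have s1: "s1 \<in> Om" using IH s1_def by simp
  have hg: "h \<in> H" "g \<in> H" "h \<notin> touched s ms'" "g \<notin> touched s ms'" "swappable s1 h g"
    and hP: "h \<in> P (length ms') \<or> sg s h \<in> P (length ms')" and gQ: "g \<in> Q \<or> sg s g \<in> Q"
    using mv by (auto simp: moves_def s1_def)
  have X: "base h \<in> X" "base (sg s h) \<in> X"
    using hP ap hg(1) sg_sg[OF s] by (fastforce simp: apart_def)+
  have Y: "base g \<in> Y" "base (sg s g) \<in> Y"
    using gQ ap hg(2) sg_sg[OF s] by (fastforce simp: apart_def)+
  have XY: "X \<inter> Y = {}" using ap by (simp add: apart_def)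
  have run: "run ms s = sw h g s1" by (simp add: ms s1_def)
  have sub: "set ms' \<subseteq> H \<times> H" using IH by auto
  have nt: "sg s h \<notin> touched s ms'" "sg s g \<notin> touched s ms'"
    using touched_sg[OF s sub] sg_sg[OF s] hg by metis+
  have sgs: "sg s h \<in> H" "sg s g \<in> H" using sg_in s hg by auto
  have one: "sg s1 d = sg s d" "dr s1 d = dr s d" if "d \<in> H" "d \<notin> touched s ms'" for d
    using IH that by (auto simp: s1_def)
  have sgr: "sg (run ms s) d = Transposition.transpose h g (sg s1 (Transposition.transpose h g d))"
     "dr (run ms s) d = dr s1 (Transposition.transpose h g d)" if "d \<in> H" for d
    using sg_sw[OF s1 hg(5) that] dr_sw[OF s1 hg(5) that] run by auto
  have A: "sg (run ms s) d = sg s d \<and> dr (run ms s) d = dr s d" if d: "d \<in> H" "d \<notin> touched s ms" for d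
  proof -
    have d': "d \<notin> touched s ms'" "d \<noteq> h" "d \<noteq> g" "d \<noteq> sg s h" "d \<noteq> sg s g"
      using d by (auto simp: touched_def ms)
    have "sg s d \<noteq> h" "sg s d \<noteq> g" using d' sg_sg[OF s d(1)] by auto
    then show ?thesis using sgr[OF d(1)] one[OF d(1) d'(1)] d'
      by (simp add: Transposition.transpose_def)
  qed
  have B: "sg (run ms s) h' = sg s g' \<and> sg (run ms s) (sg s h') = g'" if "(h', g') \<in> set ms'" for h' g'
  proof -
    have t: "h' \<in> touched s ms'" "sg s h' \<in> touched s ms'" "g' \<in> touched s ms'" "sg s g' \<in> touched s ms'"
      using that by (auto simp: touched_def)
    have ne: "h' \<noteq> h" "h' \<noteq> g" "sg s h' \<noteq> h" "sg s h' \<noteq> g" "g' \<noteq> h" "g' \<noteq> g" "sg s g' \<noteq> h" "sg s g' \<noteq> g"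
      using t hg by metis+
    have "h' \<in> H" "sg s h' \<in> H" "sg s1 h' = sg s g'" "sg s1 (sg s h') = g'"
      using IH that sg_in[OF s] by (auto simp: s1_def)
    then show ?thesis using sgr ne by (simp add: Transposition.transpose_def)
  qed
  have C: "sg (run ms s) h = sg s g \<and> sg (run ms s) (sg s h) = g"
  proof -
    have "h \<noteq> g" "sg s g \<noteq> h" "sg s h \<noteq> g" using X Y XY by auto
    moreover have "sg s g \<noteq> g" "sg s h \<noteq> h" using sg_neq[OF s] hg by auto
    moreover have "sg s1 g = sg s g" "sg s1 (sg s h) = h"
      using one hg sgs nt sg_sg[OF s] by auto
    ultimately show ?thesis using sgr hg sgs by (simp add: Transposition.transpose_def)
  qed
  have "run ms s \<in> Om" using run sw_in[OF s1 hg(5)] by simp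
  then show ?case using A B C X Y hg IH by (auto simp: ms)
qed

lemma run_pairs:
  assumes "s \<in> Om" "apart s P Q X Y" "ms \<in> choices (moves s P Q) n" "(h, g) \<in> set ms"
  shows "h \<in> H" "g \<in> H" "base h \<in> X" "base (sg s h) \<in> X" "base g \<in> Y" "base (sg s g) \<in> Y"
    "sg (run ms s) h = sg s g" "sg (run ms s) (sg s h) = g"
  using run_invariant[OF assms(1-3)] assms(4) by auto

lemma run_in_Om:
  assumes "s \<in> Om" "apart s P Q X Y" "ms \<in> choices (moves s P Q) n"
  shows "run ms s \<in> Om"
  using run_invariant[OF assms] by simp

lemma run_same:
  assumes "s \<in> Om" "apart s P Q X Y" "ms \<in> choices (moves s P Q) n" "d \<in> H" "d \<notin> touched s ms"
  shows "sg (run ms s) d = sg s d"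
  using run_invariant[OF assms(1-3)] assms(4,5) by simp

text \<open>Each exchange can be undone, so the list of exchanges and the final state determine the initial
state.\<close>

lemma run_inj:
  assumes "s \<in> Om" "s' \<in> Om" "apart s P Q X Y" "apart s' P' Q' X' Y'"
    and "ms \<in> choices (moves s P Q) n" "ms \<in> choices (moves s' P' Q') n" "run ms s = run ms s'"
  shows "s = s'"
  using assms(5-)
proof (induction n arbitrary: ms)
  case (Suc n)
  then obtain x ms' where ms: "ms = x # ms'" "ms' \<in> choices (moves s P Q) n" 
    "ms' \<in> choices (moves s' P' Q') n" "x \<in> moves s P Q ms'" "x \<in> moves s' P' Q' ms'"
    by auto
  have "run ms' s \<in> Om" "run ms' s' \<in> Om"
    using run_invariant[OF assms(1,3) ms(2)] run_invariant[OF assms(2,4) ms(3)] by auto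
  moreover have "swappable (run ms' s) (fst x) (snd x)" "swappable (run ms' s') (fst x) (snd x)"
    using ms by (auto simp: moves_def)
  ultimately have "run ms' s = run ms' s'"
    using sw_inj Suc.prems(3) ms(1) by simp
  then show ?case using Suc.IH ms by blast
qed simp

definition ends1 :: "'s \<Rightarrow> ('h \<times> 'h) list \<Rightarrow> 'v set" where
  "ends1 s ms = (\<Union>(h, g) \<in> set ms. {base h, base (sg s h)})"

definition ends2 :: "'s \<Rightarrow> ('h \<times> 'h) list \<Rightarrow> 'v set" where
  "ends2 s ms = (\<Union>(h, g) \<in> set ms. {base g, base (sg s g)})"

lemma card_UN_pair_le: "card (\<Union>x \<in> set xs. {f x, f' x}) \<le> 2 * length xs \<and> finite (\<Union>x \<in> set xs. {f x, f' x})"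
proof (induction xs)
  case (Cons x xs)
  have "(\<Union>y \<in> set (x # xs). {f y, f' y}) = insert (f x) (insert (f' x) (\<Union>y \<in> set xs. {f y, f' y}))"
    by auto
  moreover have "card (insert (f x) (insert (f' x) A)) \<le> card A + 2" for A
    using card_insert_le_m1[of "card A + 2" "insert (f' x) A"] card_insert_le_m1[of "card A + 1" A]
    by simp
  from this[of "\<Union>y \<in> set xs. {f y, f' y}"]
  have "card (insert (f x) (insert (f' x) (\<Union>y \<in> set xs. {f y, f' y}))) \<le> 2 * length (x # xs)"
    using Cons by simp
  ultimately show ?case using Cons by simp
qed simp

lemma ends_card: "card (ends1 s ms) \<le> 2 * length ms" "card (ends2 s ms) \<le> 2 * length ms"
  "finite (ends1 s ms)" "finite (ends2 s ms)"
  using card_UN_pair_le[of "\<lambda>(h, g). base h" "\<lambda>(h, g). base (sg s h)" ms]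
    card_UN_pair_le[of "\<lambda>(h, g). base g" "\<lambda>(h, g). base (sg s g)" ms]
  by (auto simp: ends1_def ends2_def case_prod_unfold)

text \<open>Let the two edges have the ends \<open>x, y\<close> in \<open>X\<close> and \<open>a, b\<close> in \<open>Y\<close>. One of
the four ways to exchange an end of the first with an end of the second is admissible: if all four
failed, direct edges made by earlier exchanges would join one end of one of the two edges to both
ends of the other one, which is direct. The last assumptions on \<open>h\<close> and \<open>g\<close>
exclude this. Choosing the right ends is necessary, since a vertex of very large degree may be
adjacent to almost everything.\<close>

lemma some_swap:
  assumes s: "s \<in> Om" and ap: "apart s P Q X Y" and ms: "ms \<in> choices (moves s P Q) n"
    and h: "h \<in> H" "base h \<in> X" "base (sg s h) \<in> X" "h \<notin> touched s ms"
      "\<not> (dr s h \<and> base h \<in> ends1 s ms \<and> base (sg s h) \<in> ends1 s ms)"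
    and g: "g \<in> H" "base g \<in> Y" "base (sg s g) \<in> Y" "g \<notin> touched s ms"
      "\<not> (dr s g \<and> base g \<in> ends2 s ms \<and> base (sg s g) \<in> ends2 s ms)"
  shows "\<exists>h' \<in> {h, sg s h}. \<exists>g' \<in> {g, sg s g}. swappable (run ms s) h' g'"
proof -
  define s1 where "s1 = run ms s"
  note inv = run_invariant[OF s ap ms]
  have s1: "s1 \<in> Om" using inv s1_def by simp
  have XY: "X \<inter> Y = {}" using ap by (simp add: apart_def)
  have sub: "set ms \<subseteq> H \<times> H" using inv by auto
  have nt: "sg s h \<notin> touched s ms" "sg s g \<notin> touched s ms"
    using touched_sg[OF s sub] sg_sg[OF s] h g by metis+
  have sgs: "sg s h \<in> H" "sg s g \<in> H" using sg_in s h g by auto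
  have e: "sg s1 h = sg s h" "sg s1 g = sg s g" "sg s1 (sg s h) = h" "sg s1 (sg s g) = g"
    "dr s1 h = dr s h" "dr s1 g = dr s g" "dr s1 (sg s h) = dr s h" "dr s1 (sg s g) = dr s g"
    using inv h g sgs nt sg_sg[OF s] dr_sg[OF s] by (auto simp: s1_def)
  \<comment> \<open>\<open>J x y\<close>: a direct edge joins \<open>x\<close> and \<open>y\<close> in the current state.\<close>
  define J where "J x y \<longleftrightarrow> (\<exists>d \<in> H. dr s1 d \<and> base d = x \<and> base (sg s1 d) = y)" for x y
  have Jsym: "J x y \<longleftrightarrow> J y x" for x y
    unfolding J_def using s1 sg_in sg_sg dr_sg by metis
  have J: "x \<in> ends1 s ms \<and> y \<in> ends2 s ms" if xy: "J x y" "x \<in> X" "y \<in> Y" for x y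
  proof -
    obtain d where d: "d \<in> H" "base d = x" "base (sg s1 d) = y" using xy(1) unfolding J_def by blast
    have "d \<in> touched s ms"
    proof (rule ccontr)
      assume "d \<notin> touched s ms"
      then have "sg s1 d = sg s d" using inv d by (auto simp: s1_def)
      then show False using ap d xy by (auto simp: apart_def)
    qed
    then obtain h' g' where hg: "(h', g') \<in> set ms" "d \<in> {h', sg s h', g', sg s g'}"
      by (auto simp: touched_def)
    have "base g' \<in> Y" "base (sg s g') \<in> Y" "sg s1 h' = sg s g'" "sg s1 (sg s h') = g'"
      using inv hg(1) by (auto simp: s1_def)
    then have "d \<in> {h', sg s h'} \<and> sg s1 d \<in> {g', sg s g'}" using hg(2) d xy XY by auto
    then have "x \<in> {base h', base (sg s h')}" "y \<in> {base g', base (sg s g')}" using d by auto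
    then show ?thesis unfolding ends1_def ends2_def by (intro conjI UN_I[OF hg(1)]) auto
  qed
  have ne: "base h \<noteq> base g" "base h \<noteq> base (sg s g)" "base (sg s h) \<noteq> base g" "base (sg s h) \<noteq> base (sg s g)"
    using XY h g by auto
  have sw: "(dr s1 g' \<and> J (base h') (base (sg s1 g'))) \<or> (dr s1 h' \<and> J (base (sg s1 h')) (base g'))"
    if "\<not> swappable s1 h' g'" "h' \<in> H" "g' \<in> H" "base h' \<noteq> base g'" "base (sg s1 h') \<noteq> base g'"
      "base h' \<noteq> base (sg s1 g')" for h' g'
  proof -
    have "J (base (sg s1 h')) (base g') \<longleftrightarrow> J (base g') (base (sg s1 h'))" by (rule Jsym)
    then show ?thesis using that(1,4-) unfolding swappable_def J_def using that(2,3) by auto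
  qed
  show ?thesis
  proof (rule ccontr)
    assume *: "\<not> ?thesis"
    then have "\<not> swappable s1 h g" "\<not> swappable s1 h (sg s g)" "\<not> swappable s1 (sg s h) g" "\<not> swappable s1 (sg s h) (sg s g)"
      by (auto simp: s1_def)
    then have "(dr s g \<and> J (base h) (base (sg s g))) \<or> (dr s h \<and> J (base (sg s h)) (base g))"
      "(dr s g \<and> J (base h) (base g)) \<or> (dr s h \<and> J (base (sg s h)) (base (sg s g)))"
      "(dr s g \<and> J (base (sg s h)) (base (sg s g))) \<or> (dr s h \<and> J (base h) (base g))"
      "(dr s g \<and> J (base (sg s h)) (base g)) \<or> (dr s h \<and> J (base h) (base (sg s g)))"
      using sw[of h g] sw[of h "sg s g"] sw[of "sg s h" g] sw[of "sg s h" "sg s g"] ne[symmetric] ne h(1) g(1) sgs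
      unfolding e by blast+
    then show False using h g J by blast
  qed
qed

lemma card_moves_ge:
  assumes s: "s \<in> Om" and ap: "apart s P Q X Y" and ms: "ms \<in> choices (moves s P Q) n"
    and P: "P n \<inter> sg s ` P n = {}" and Q: "Q \<inter> sg s ` Q = {}"
    and P': "P' \<subseteq> P n" "\<And>h. h \<in> P' \<Longrightarrow> h \<notin> touched s ms \<and> \<not> (dr s h \<and> base h \<in> ends1 s ms \<and> base (sg s h) \<in> ends1 s ms)"
    and Q': "Q' \<subseteq> Q" "\<And>h. h \<in> Q' \<Longrightarrow> h \<notin> touched s ms \<and> \<not> (dr s h \<and> base h \<in> ends2 s ms \<and> base (sg s h) \<in> ends2 s ms)"
  shows "card P' * card Q' \<le> card (moves s P Q ms)"
proof -
  define f where "f = (\<lambda>(h, g). (if h \<in> P n then h else sg s h, if g \<in> Q then g else sg s g))"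
  have sub: "set ms \<subseteq> H \<times> H" using run_invariant[OF s ap ms] by auto
  have "P' \<times> Q' \<subseteq> f ` moves s P Q ms"
  proof clarify
    fix h g assume hg: "h \<in> P'" "g \<in> Q'"
    then have in1: "h \<in> P n" "g \<in> Q" using P' Q' by auto
    have h: "h \<in> H" "base h \<in> X" "base (sg s h) \<in> X" and g: "g \<in> H" "base g \<in> Y" "base (sg s g) \<in> Y"
      using in1 ap by (auto simp: apart_def)
    obtain h' g' where hg': "h' \<in> {h, sg s h}" "g' \<in> {g, sg s g}" "swappable (run ms s) h' g'"
      using some_swap[OF s ap ms h] g P'(2)[OF hg(1)] Q'(2)[OF hg(2)] by blast
    have nt: "sg s h \<notin> touched s ms" "sg s g \<notin> touched s ms"
      using touched_sg[OF s sub] sg_sg[OF s] h(1) g(1) P'(2)[OF hg(1)] Q'(2)[OF hg(2)] by metis+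
    have "sg s h \<notin> P n" "sg s g \<notin> Q" using P Q in1 by auto
    then have "f (h', g') = (h, g)" using hg' in1 sg_sg[OF s] h g by (auto simp: f_def)
    moreover have "(h', g') \<in> moves s P Q ms"
      using hg' nt in1 h g sg_in[OF s] sg_sg[OF s] P'(2)[OF hg(1)] Q'(2)[OF hg(2)] length_choices[OF ms]
      by (auto simp: moves_def)
    ultimately show "(h, g) \<in> f ` moves s P Q ms" by (metis imageI)
  qed
  then have "card (P' \<times> Q') \<le> card (f ` moves s P Q ms)"
    by (intro card_mono finite_imageI finite_moves)
  also have "\<dots> \<le> card (moves s P Q ms)" by (rule card_image_le[OF finite_moves])
  finally show ?thesis by (simp add: card_cartesian_product)
qed

text \<open>After \<open>k\<close> exchanges at most \<open>k\<close> edges are used up, and the at most \<open>2 k\<close> vertices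
involved span at most \<open>(2 k)\<^sup>2\<close> direct darts because direct edges are not parallel. This is at
most \<open>5 k\<^sup>2\<close> in total.\<close>

lemma card_undisturbed_ge:
  assumes s: "s \<in> Om" and A: "A \<subseteq> H" "A \<inter> sg s ` A = {}"
    and tm: "A \<inter> T \<subseteq> (\<Union>x \<in> set xs. {f x, sg s (f x)})" and f: "f ` set xs \<subseteq> H" 
    and Z: "finite Z" "card Z \<le> 2 * length xs"
  shows "card A - 5 * (length xs)\<^sup>2 \<le> card {h \<in> A. h \<notin> T \<and> \<not> (dr s h \<and> base h \<in> Z \<and> base (sg s h) \<in> Z)}"
proof -
  have finA: "finite A" using A finH finite_subset by auto
  have "A \<inter> T \<subseteq> (\<lambda>x. if f x \<in> A then f x else sg s (f x)) ` set xs"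
  proof
    fix h assume h: "h \<in> A \<inter> T"
    then obtain x where "x \<in> set xs" "h = f x \<or> h = sg s (f x)" using tm by blast
    then show "h \<in> (\<lambda>x. if f x \<in> A then f x else sg s (f x)) ` set xs"
      using h A by (intro image_eqI[of _ _ x]) auto
  qed
  then have "card (A \<inter> T) \<le> card (set xs)"
    by (meson List.finite_set card_image_le card_mono finite_imageI le_trans)
  then have c1: "card (A \<inter> T) \<le> length xs" using card_length le_trans by blast
  define D where "D = {h \<in> A. dr s h \<and> base h \<in> Z \<and> base (sg s h) \<in> Z}"
  have "card D \<le> card (Z \<times> Z)"
  proof (rule card_inj_on_le[of "\<lambda>h. (base h, base (sg s h))"])
    show "inj_on (\<lambda>h. (base h, base (sg s h))) D"
      using A by (auto simp: inj_on_def D_def intro!: dr_par[OF s])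
  qed (auto simp: D_def Z)
  also have "\<dots> \<le> (2 * length xs) * (2 * length xs)"
    unfolding card_cartesian_product using Z by (intro mult_mono) auto
  finally have c2: "card D \<le> 4 * (length xs)\<^sup>2" by (simp add: power2_eq_square)
  have "A \<subseteq> {h \<in> A. h \<notin> T \<and> \<not> (dr s h \<and> base h \<in> Z \<and> base (sg s h) \<in> Z)} \<union> (A \<inter> T \<union> D)"
    by (auto simp: D_def)
  then have "card A \<le> card ({h \<in> A. h \<notin> T \<and> \<not> (dr s h \<and> base h \<in> Z \<and> base (sg s h) \<in> Z)} \<union> (A \<inter> T \<union> D))"
    by (rule card_mono[rotated]) (auto simp: finA D_def)
  also have "\<dots> \<le> card {h \<in> A. h \<notin> T \<and> \<not> (dr s h \<and> base h \<in> Z \<and> base (sg s h) \<in> Z)} + (card (A \<inter> T) + card D)"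
    by (meson add_left_mono card_Un_le le_trans)
  also have "card (A \<inter> T) + card D \<le> 5 * (length xs)\<^sup>2"
    using c1 c2 by (cases "length xs") (auto simp: power2_eq_square)
  finally show ?thesis by linarith
qed

lemma card_sequences_ge:
  assumes s: "s \<in> Om" and ap: "apart s (\<lambda>_. P) Q X Y"
    and P: "P \<inter> sg s ` P = {}" and Q: "Q \<inter> sg s ` Q = {}"
  shows "((card P - 5 * t\<^sup>2) * (card Q - 5 * t\<^sup>2)) ^ t \<le> card (choices (moves s (\<lambda>_. P) Q) t)"
proof (rule card_choices_ge[OF finite_moves])
  fix n ms assume n: "n < t" and ms: "ms \<in> choices (moves s (\<lambda>_. P) Q) n"
  note inv = run_invariant[OF s ap ms]
  have len: "length ms = n" using length_choices[OF ms] .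
  have PH: "P \<subseteq> H" "Q \<subseteq> H" using ap by (auto simp: apart_def)
  have XY: "X \<inter> Y = {}" "base ` P \<subseteq> X" "base ` Q \<subseteq> Y" using ap by (auto simp: apart_def)
  have n2: "n\<^sup>2 \<le> t\<^sup>2" using n by (simp add: power_mono)
  have "h = fst x \<or> h = sg s (fst x)" if "h \<in> P" "x \<in> set ms" "h \<in> {fst x, sg s (fst x), snd x, sg s (snd x)}" for h x
  proof -
    obtain a b where x: "x = (a, b)" by fastforce
    have "base b \<in> Y" "base (sg s b) \<in> Y" using inv that x by auto
    then show ?thesis using that XY x by auto
  qed
  moreover have "h = snd x \<or> h = sg s (snd x)" if "h \<in> Q" "x \<in> set ms" "h \<in> {fst x, sg s (fst x), snd x, sg s (snd x)}" for h x
  proof -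
    obtain a b where x: "x = (a, b)" by fastforce
    have "base a \<in> X" "base (sg s a) \<in> X" using inv that x by auto
    then show ?thesis using that XY x by auto
  qed
  ultimately have sub: "P \<inter> touched s ms \<subseteq> (\<Union>x \<in> set ms. {fst x, sg s (fst x)})"
    "Q \<inter> touched s ms \<subseteq> (\<Union>x \<in> set ms. {snd x, sg s (snd x)})"
    unfolding touched_def case_prod_unfold by blast+
  have subH: "fst ` set ms \<subseteq> H" "snd ` set ms \<subseteq> H" using inv by auto
  have "card P - 5 * t\<^sup>2 \<le> card P - 5 * (length ms)\<^sup>2" "card Q - 5 * t\<^sup>2 \<le> card Q - 5 * (length ms)\<^sup>2"
    using n2 len by (simp_all add: diff_le_mono2)
  then have "(card P - 5 * t\<^sup>2) * (card Q - 5 * t\<^sup>2) \<le>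
     card {h \<in> P. h \<notin> touched s ms \<and> \<not> (dr s h \<and> base h \<in> ends1 s ms \<and> base (sg s h) \<in> ends1 s ms)} *
     card {h \<in> Q. h \<notin> touched s ms \<and> \<not> (dr s h \<and> base h \<in> ends2 s ms \<and> base (sg s h) \<in> ends2 s ms)}"
    using card_undisturbed_ge[OF s PH(1) P sub(1) subH(1) ends_card(3,1)] 
      card_undisturbed_ge[OF s PH(2) Q sub(2) subH(2) ends_card(4,2)]
    by (intro mult_mono) (auto intro: le_trans)
  also have "\<dots> \<le> card (moves s (\<lambda>_. P) Q ms)"
    by (rule card_moves_ge[OF s ap ms]) (use P Q in auto)
  finally show "(card P - 5 * t\<^sup>2) * (card Q - 5 * t\<^sup>2) \<le> card (moves s (\<lambda>_. P) Q ms)" .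
qed

end

context dart_system
begin

section \<open>Exploration from a vertex\<close>

primrec reach :: "'s \<Rightarrow> 'h set \<Rightarrow> 'v \<Rightarrow> nat \<Rightarrow> 'v set" where
  "reach s N u 0 = {u}"
| "reach s N u (Suc j) =
     reach s N u j \<union> (\<lambda>d. base (sg s d)) ` {d \<in> H. d \<notin> N \<and> base d \<in> reach s N u j}"

text \<open>The exploration may ignore a set \<open>N\<close> of darts. With the new darts as \<open>N\<close>, the
exploration of a switched state recovers the balls of the original state.\<close>

abbreviation B :: "'s \<Rightarrow> 'v \<Rightarrow> nat \<Rightarrow> 'v set" where
  "B s \<equiv> reach s {}"

definition vol :: "'v set \<Rightarrow> nat" where
  "vol S = card {h \<in> H. base h \<in> S}"

definition depth :: "'s \<Rightarrow> 'v \<Rightarrow> 'v \<Rightarrow> nat" where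
  "depth s u v = (LEAST j. v \<in> B s u j)"

text \<open>The dart at the previous layer through which the vertex is reached in a breadth-first tree.\<close>

definition parent_dart :: "'s \<Rightarrow> 'v \<Rightarrow> 'v \<Rightarrow> 'h" where
  "parent_dart s u v = (SOME h. h \<in> H \<and> base (sg s h) = v \<and> base h \<in> B s u (depth s u v - 1))"

definition tree :: "'s \<Rightarrow> 'v \<Rightarrow> 'h set" where
  "tree s u = parent_dart s u ` {v. v \<noteq> u \<and> (\<exists>j. v \<in> B s u j)}"

definition nontree :: "'s \<Rightarrow> 'v \<Rightarrow> 'h set" where
  "nontree s u = {h \<in> H. h \<notin> tree s u \<and> sg s h \<notin> tree s u}"

definition layer :: "'s \<Rightarrow> 'v \<Rightarrow> nat \<Rightarrow> 'v set" where
  "layer s u r = {v \<in> B s u r. depth s u v = r}"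

definition out :: "'s \<Rightarrow> 'v \<Rightarrow> nat \<Rightarrow> 'h set" where
  "out s u r = {h \<in> H. base h \<in> B s u r \<and> base (sg s h) \<notin> B s u r}"

definition inside :: "'s \<Rightarrow> 'v \<Rightarrow> nat \<Rightarrow> 'h set" where
  "inside s u r = {h \<in> H. base h \<in> layer s u r \<and> base (sg s h) \<in> layer s u r}"

definition collisions :: "'s \<Rightarrow> 'v \<Rightarrow> nat \<Rightarrow> 'h set" where
  "collisions s u r = {h \<in> out s u r. h \<notin> tree s u}"

definition inner :: "'s \<Rightarrow> 'v \<Rightarrow> nat \<Rightarrow> 'h set" where
  "inner s u r = {h \<in> nontree s u. base h \<in> B s u r \<and> base (sg s h) \<in> B s u r}"

text \<open>Of the two darts of an edge only the smaller one is taken, so that darts count edges.\<close>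

definition far :: "'s \<Rightarrow> 'v \<Rightarrow> nat \<Rightarrow> 'h set" where
  "far s u r = {g \<in> H. base g \<notin> B s u (Suc r) \<and> base (sg s g) \<notin> B s u (Suc r) \<and> g < sg s g}"

lemma reach_mono: "i \<le> j \<Longrightarrow> reach s N u i \<subseteq> reach s N u j"
  by (rule lift_Suc_mono_le[of "reach s N u"]) auto

lemma reach_V: "u \<in> V \<Longrightarrow> s \<in> Om \<Longrightarrow> reach s N u j \<subseteq> V"
  by (induction j) (auto intro: base_V sg_in)

lemma B_step: "d \<in> H \<Longrightarrow> base d \<in> B s u j \<Longrightarrow> base (sg s d) \<in> B s u (Suc j)"
  by auto

lemma depth_le: "v \<in> B s u j \<Longrightarrow> depth s u v \<le> j"
  unfolding depth_def by (rule Least_le)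

lemma in_depth: "v \<in> B s u j \<Longrightarrow> v \<in> B s u (depth s u v)"
  unfolding depth_def by (rule LeastI)

lemma in_B_iff: "v \<in> B s u j \<Longrightarrow> v \<in> B s u i \<longleftrightarrow> depth s u v \<le> i"
  using depth_le in_depth reach_mono by blast

lemma layer_Suc: "layer s u (Suc r) = B s u (Suc r) - B s u r"
proof -
  have "v \<in> layer s u (Suc r) \<longleftrightarrow> v \<in> B s u (Suc r) \<and> v \<notin> B s u r" for v
    using in_B_iff[of v s u "Suc r" r] depth_le[of v s u "Suc r"]
    unfolding layer_def mem_Collect_eq by force
  then show ?thesis by blast
qed

lemma layer_0: "layer s u 0 = {u}"
  using depth_le[of u s u 0] by (auto simp: layer_def)

lemma parent_dart:
  assumes "v \<in> B s u j" "v \<noteq> u"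
  shows "parent_dart s u v \<in> H" "base (sg s (parent_dart s u v)) = v"
    "Suc (depth s u (base (parent_dart s u v))) = depth s u v"
    "base (parent_dart s u v) \<in> B s u (depth s u v - 1)"
proof -
  have v: "v \<in> B s u (depth s u v)" by (rule in_depth[OF assms(1)])
  then obtain i where i: "depth s u v = Suc i" using assms(2) by (cases "depth s u v") auto
  have vi: "v \<notin> B s u i" using depth_le[of v s u i] i by auto
  have "\<exists>h. h \<in> H \<and> base (sg s h) = v \<and> base h \<in> B s u (depth s u v - 1)"
    using v vi i by auto
  from someI_ex[OF this] have p: "parent_dart s u v \<in> H" "base (sg s (parent_dart s u v)) = v"
     "base (parent_dart s u v) \<in> B s u i"
    unfolding parent_dart_def[symmetric] using i by auto
  have "depth s u (base (parent_dart s u v)) = i"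
  proof (rule ccontr)
    assume "depth s u (base (parent_dart s u v)) \<noteq> i"
    then have "depth s u (base (parent_dart s u v)) < i" using depth_le[OF p(3)] by simp
    then have "v \<in> B s u i"
      using B_step[OF p(1) in_depth[OF p(3)]] p(2) reach_mono[of "Suc (depth s u (base (parent_dart s u v)))" i s "{}" u]
      by auto
    then show False using vi by simp
  qed
  then show "parent_dart s u v \<in> H" "base (sg s (parent_dart s u v)) = v"
    "Suc (depth s u (base (parent_dart s u v))) = depth s u v"
    "base (parent_dart s u v) \<in> B s u (depth s u v - 1)"
    using p i by auto
qed

lemma tree_depth: "h \<in> tree s u \<Longrightarrow> depth s u (base (sg s h)) = Suc (depth s u (base h))"
  unfolding tree_def using parent_dart by fastforce

lemma nontree_sg: "s \<in> Om \<Longrightarrow> h \<in> nontree s u \<Longrightarrow> sg s h \<in> nontree s u"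
  by (auto simp: nontree_def sg_in sg_sg)

lemma inside_nontree: "s \<in> Om \<Longrightarrow> inside s u r \<subseteq> nontree s u"
proof
  fix h assume s: "s \<in> Om" and "h \<in> inside s u r"
  then have "h \<in> H" "depth s u (base h) = r" "depth s u (base (sg s h)) = r"
    by (auto simp: inside_def layer_def)
  then show "h \<in> nontree s u"
    using tree_depth[of h s u] tree_depth[of "sg s h" s u] sg_sg[OF s, of h] by (auto simp: nontree_def)
qed

lemma collisions_nontree: "s \<in> Om \<Longrightarrow> collisions s u r \<subseteq> nontree s u"
proof
  fix h assume s: "s \<in> Om" and "h \<in> collisions s u r"
  then have h: "h \<in> H" "h \<notin> tree s u" "base h \<in> B s u r" "base (sg s h) \<notin> B s u r"
    by (auto simp: collisions_def out_def)
  have "base (sg s h) \<in> layer s u (Suc r)" unfolding layer_Suc using h B_step by blast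
  then have "depth s u (base (sg s h)) = Suc r" "depth s u (base h) \<le> r"
    using depth_le h by (auto simp: layer_def)
  then have "sg s h \<notin> tree s u" using tree_depth[of "sg s h" s u] sg_sg[OF s h(1)] by auto
  then show "h \<in> nontree s u" using h by (auto simp: nontree_def)
qed

lemma half:
  assumes "s \<in> Om" "A \<subseteq> H" "\<And>h. h \<in> A \<Longrightarrow> sg s h \<in> A"
  shows "card A = 2 * card {h \<in> A. h < sg s h}" "{h \<in> A. h < sg s h} \<inter> sg s ` {h \<in> A. h < sg s h} = {}"
    "A = {h \<in> A. h < sg s h} \<union> sg s ` {h \<in> A. h < sg s h}"
proof -
  let ?P = "{h \<in> A. h < sg s h}"
  have ss: "sg s (sg s h) = h" if "h \<in> A" for h
    using sg_sg[OF assms(1), of h] assms(2) that by auto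
  show d: "?P \<inter> sg s ` ?P = {}" 
  proof -
    have "sg s k \<notin> ?P" if "k \<in> ?P" for k
      using ss[of k] that by (auto dest: less_asym)
    then show ?thesis by auto
  qed
  show u: "A = ?P \<union> sg s ` ?P"
  proof
    show "A \<subseteq> ?P \<union> sg s ` ?P"
    proof
      fix h assume h: "h \<in> A"
      show "h \<in> ?P \<union> sg s ` ?P"
      proof (cases "h < sg s h")
        case False
        then have "sg s h < h" using sg_neq[OF assms(1), of h] h assms(2) by force
        then have "sg s h \<in> ?P" using h ss assms(3) by auto
        then show ?thesis using ss[OF h] by (metis UnCI imageI)
      qed (use h in auto)
    qed
  qed (use assms(3) in auto)
  have fin: "finite ?P" using finH assms(2) by (auto intro: finite_subset)
  have "inj_on (sg s) ?P" by (rule inj_on_inverseI[of _ "sg s"]) (simp add: ss)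
  then have "card (sg s ` ?P) = card ?P" by (rule card_image)
  then show "card A = 2 * card ?P"
    using card_Un_disjoint[OF fin finite_imageI[OF fin] d] arg_cong[OF u, of card] by linarith
qed

text \<open>An edge that is not far has both ends in the ball of radius \<open>r + 2\<close>. If the
volume of this ball is at most \<open>m\<close>, at most half of the \<open>2 m\<close> darts are lost.\<close>

lemma card_far:
  assumes s: "s \<in> Om" and m: "card H = 2 * m" and v: "vol (B s u (Suc (Suc r))) \<le> m"
  shows "m \<le> 2 * card (far s u r)"
proof -
  let ?A = "{g \<in> H. base g \<notin> B s u (Suc r) \<and> base (sg s g) \<notin> B s u (Suc r)}"
  let ?C = "{h \<in> H. base h \<in> B s u (Suc (Suc r))}"
  have "h \<in> ?C" if "h \<in> H" "h \<notin> ?A" for h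
  proof (cases "base h \<in> B s u (Suc r)")
    case True then show ?thesis using that reach_mono[of "Suc r" "Suc (Suc r)" s "{}" u] by auto
  next
    case False
    then have "base (sg s h) \<in> B s u (Suc r)" using that by auto
    then have "base (sg s (sg s h)) \<in> B s u (Suc (Suc r))" using B_step sg_in[OF s that(1)] by blast
    then show ?thesis using sg_sg[OF s that(1)] that by simp
  qed
  then have "H \<subseteq> ?A \<union> ?C" by blast
  then have "card H \<le> card (?A \<union> ?C)" by (rule card_mono[rotated]) (simp add: finH)
  also have "\<dots> \<le> card ?A + card ?C" by (rule card_Un_le)
  also have "card ?A = 2 * card {g \<in> ?A. g < sg s g}"
    by (rule half(1)[OF s]) (auto simp: sg_in[OF s] sg_sg[OF s])
  also have "{g \<in> ?A. g < sg s g} = far s u r" by (auto simp: far_def)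
  also have "card ?C \<le> m" using v by (simp add: vol_def)
  finally show ?thesis using m by simp
qed

lemma far_disj: "s \<in> Om \<Longrightarrow> far s u r \<inter> sg s ` far s u r = {}"
  by (auto simp: far_def sg_sg)

text \<open>Removing non-tree edges does not change the balls, as the tree still reaches all of their vertices.
For the ball of radius \<open>j\<close> it suffices to ignore the new darts at distance less than \<open>j\<close>:
this allows one to find the new darts layer by layer, starting from nothing.\<close>

lemma reach_after:
  assumes N: "N \<inter> tree s u = {}" "N' \<subseteq> N"
    and same: "\<And>d. d \<in> H \<Longrightarrow> d \<notin> N \<Longrightarrow> base d \<in> B s u \<rho> \<Longrightarrow> sg s' d = sg s d"
    and late: "\<And>d i. d \<in> N - N' \<Longrightarrow> i < j \<Longrightarrow> base d \<notin> B s u i"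
    and j: "j \<le> Suc \<rho>"
  shows "reach s' N' u j = B s u j"
proof -
  have "reach s' N' u i = B s u i" if "i \<le> j" for i
    using that
  proof (induction i)
    case (Suc i)
    then have IH: "reach s' N' u i = B s u i" and ij: "i < j" by auto
    have sub: "B s u i \<subseteq> B s u \<rho>" using reach_mono ij j by simp
    have eq: "sg s' d = sg s d \<and> d \<notin> N" if "d \<in> H" "d \<notin> N'" "base d \<in> B s u i" for d
      using late[of d i] same[of d] that sub ij by auto
    show ?case
    proof
      show "reach s' N' u (Suc i) \<subseteq> B s u (Suc i)" using IH eq by auto
      show "B s u (Suc i) \<subseteq> reach s' N' u (Suc i)"
      proof
        fix v assume v: "v \<in> B s u (Suc i)"
        show "v \<in> reach s' N' u (Suc i)"
        proof (cases "v \<in> B s u i")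
          case False
          moreover have "u \<in> B s u i" using reach_mono[of 0 i s "{}" u] by auto
          ultimately have vu: "v \<noteq> u" by auto
          have dv: "depth s u v = Suc i" using v False layer_Suc[of s u i] by (auto simp: layer_def)
          note p = parent_dart[OF v vu]
          have "parent_dart s u v \<in> tree s u" using v vu unfolding tree_def by blast
          then have "parent_dart s u v \<notin> N'" using N by auto
          moreover have "base (parent_dart s u v) \<in> B s u i" using p(4) dv by simp
          ultimately have "parent_dart s u v \<in> {d \<in> H. d \<notin> N' \<and> base d \<in> reach s' N' u i}"
              "base (sg s' (parent_dart s u v)) = v"
            using eq[OF p(1)] p(1,2) IH by auto
          then show ?thesis unfolding reach.simps by (metis (mono_tags, lifting) UnI2 image_eqI)
        qed (use IH in auto)
      qed
    qed
  qed simp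
  then show ?thesis by simp
qed

lemma vol_mono: "S \<subseteq> T \<Longrightarrow> vol S \<le> vol T"
  unfolding vol_def by (rule card_mono) (auto simp: finH)

end

lemma choicesI:
  assumes "\<And>ys x zs. xs = ys @ x # zs \<Longrightarrow> x \<in> S zs"
  shows "xs \<in> choices S (length xs)"
  using assms
proof (induction xs)
  case (Cons a xs)
  have "x \<in> S zs" if "xs = ys @ x # zs" for ys x zs
    using Cons.prems[of "a # ys" x zs] that by simp
  then show ?case using Cons.IH Cons.prems[of "[]" a xs] by auto
qed simp

context switch_system
begin

section \<open>Counting by switchings\<close>

text \<open>The dart moved by an exchange and its old partner. In the final state the
partner of the latter is the dart of the far edge, so these pairs determine the exchanges.\<close>

definition darts1 :: "'s \<Rightarrow> ('h \<times> 'h) list \<Rightarrow> ('h \<times> 'h) list" where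
  "darts1 s ms = map (\<lambda>(h, g). (h, sg s h)) ms"

text \<open>Double counting of the pairs of a state in \<open>Ev\<close> and a sequence of exchanges. There are at least
\<open>F\<close> sequences for each state, and a sequence is determined by the final state and a guess
of the exchanged darts among at most \<open>b\<close> possibilities.\<close>

theorem switching_bound:
  assumes Ev: "Ev \<subseteq> Om"
    and ap: "\<And>s. s \<in> Ev \<Longrightarrow> apart s (P s) (Q s) (X s) (Y s)"
    and forward: "\<And>s. s \<in> Ev \<Longrightarrow> F \<le> card (choices (moves s (P s) (Q s)) t)"
    and guess: "\<And>s ms. s \<in> Ev \<Longrightarrow> ms \<in> choices (moves s (P s) (Q s)) t \<Longrightarrow>
      darts1 s ms \<in> Guess (run ms s)"
    and backward: "\<And>s. s \<in> Om \<Longrightarrow> finite (Guess s) \<and> card (Guess s) \<le> b"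
  shows "card Ev * F \<le> card Om * b"
proof -
  let ?C = "\<lambda>s. choices (moves s (P s) (Q s)) t"
  have finEv: "finite Ev" using Ev finOm finite_subset by auto
  have "card Ev * F \<le> (\<Sum>s \<in> Ev. card (?C s))"
    using sum_mono[of Ev "\<lambda>_. F" "\<lambda>s. card (?C s)"] forward by simp
  also have "\<dots> = card (Sigma Ev ?C)"
    by (simp add: finEv finite_choices finite_moves)
  also have "\<dots> \<le> card (Sigma Om Guess)"
  proof (rule card_inj_on_le[of "\<lambda>(s, ms). (run ms s, darts1 s ms)"])
    show "inj_on (\<lambda>(s, ms). (run ms s, darts1 s ms)) (Sigma Ev ?C)"
    proof (rule inj_onI, clarsimp)
      fix s ms s' ms'
      assume s: "s \<in> Ev" "ms \<in> ?C s" and s': "s' \<in> Ev" "ms' \<in> ?C s'"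
        and eq: "run ms s = run ms' s'" "darts1 s ms = darts1 s' ms'"
      have Om: "s \<in> Om" "s' \<in> Om" using s s' Ev by auto
      have 1: "map (\<lambda>(h, y). (h, sg (run ms s) y)) (darts1 s ms) = ms"
        unfolding darts1_def map_map
        by (intro map_idI) (auto simp: run_pairs(8)[OF Om(1) ap[OF s(1)] s(2)])
      have 2: "map (\<lambda>(h, y). (h, sg (run ms' s') y)) (darts1 s' ms') = ms'"
        unfolding darts1_def map_map
        by (intro map_idI) (auto simp: run_pairs(8)[OF Om(2) ap[OF s'(1)] s'(2)])
      have "ms = ms'" using 1 2 eq by simp
      then show "s = s' \<and> ms = ms'"
        using run_inj[OF Om ap[OF s(1)] ap[OF s'(1)], of ms t] s(2) s'(2) eq by simp
    qed
    show "(\<lambda>(s, ms). (run ms s, darts1 s ms)) ` Sigma Ev ?C \<subseteq> Sigma Om Guess"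
    proof clarsimp
      fix s ms assume *: "s \<in> Ev" "ms \<in> ?C s"
      then show "run ms s \<in> Om \<and> darts1 s ms \<in> Guess (run ms s)"
        using guess[OF *] run_in_Om[OF _ ap[OF *(1)] *(2)] Ev by auto
    qed
    show "finite (Sigma Om Guess)" using finOm backward by auto
  qed
  also have "\<dots> = (\<Sum>s \<in> Om. card (Guess s))" using finOm backward by auto
  also have "\<dots> \<le> card Om * b" using sum_mono[of Om "\<lambda>s. card (Guess s)" "\<lambda>_. b"] backward by simp
  finally show ?thesis .
qed

lemma apart_far:
  assumes "\<And>i h. h \<in> P i \<Longrightarrow> h \<in> H \<and> base h \<in> B s u r \<and> base (sg s h) \<in> B s u r"
  shows "apart s P (far s u r) (B s u r) (- B s u (Suc r))"
proof -
  have "B s u r \<subseteq> B s u (Suc r)" by (rule reach_mono) simp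
  then show ?thesis unfolding apart_def far_def
    using assms B_step[of _ s u r] by (auto simp del: reach.simps)
qed

text \<open>In the outcome of exchanges between non-tree edges of a ball and far edges, the new edges leave
the ball of radius \<open>r + 1\<close>, all other edges at this ball are unchanged, and the exploration
recovers the original balls once it ignores the new darts near the start.\<close>

lemma after_switching:
  assumes s: "s \<in> Om" and P: "\<And>i. P i \<subseteq> inner s u r"
    and ms: "ms \<in> choices (moves s P (far s u r)) t"
  defines "s' \<equiv> run ms s" and "N \<equiv> (\<Union>(h, g) \<in> set ms. {h, sg s h})"
  shows "s' \<in> Om" "N \<subseteq> inner s u r"
    "\<And>d. d \<in> N \<Longrightarrow> base (sg s' d) \<notin> B s u (Suc r)"
    "\<And>d. d \<in> H \<Longrightarrow> d \<notin> N \<Longrightarrow> base d \<in> B s u (Suc r) \<Longrightarrow> sg s' d = sg s d"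
    "\<And>N' j. N' \<subseteq> N \<Longrightarrow> (\<And>d i. d \<in> N - N' \<Longrightarrow> i < j \<Longrightarrow> base d \<notin> B s u i) \<Longrightarrow> j \<le> Suc r \<Longrightarrow>
       reach s' N' u j = B s u j"
    "\<And>h g. (h, g) \<in> set ms \<Longrightarrow> (\<exists>i. h \<in> P i) \<or> (\<exists>i. sg s h \<in> P i)"
proof -
  have P': "h \<in> H \<and> base h \<in> B s u r \<and> base (sg s h) \<in> B s u r" if "h \<in> P i" for h i
    using P that by (auto simp: inner_def nontree_def)
  have ap: "apart s P (far s u r) (B s u r) (- B s u (Suc r))" by (rule apart_far) (rule P')
  note inv = run_pairs[OF s ap ms]
  have mP: "(\<exists>i. h \<in> P i) \<or> (\<exists>i. sg s h \<in> P i)" if "(h, g) \<in> set ms" for h g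
    using ms that
  proof (induction t arbitrary: ms)
    case (Suc t)
    then show ?case by (auto simp: moves_def)
  qed simp
  then show "\<And>h g. (h, g) \<in> set ms \<Longrightarrow> (\<exists>i. h \<in> P i) \<or> (\<exists>i. sg s h \<in> P i)" by blast
  show "s' \<in> Om" unfolding s'_def by (rule run_in_Om[OF s ap ms])
  have in_inner: "h \<in> inner s u r \<and> sg s h \<in> inner s u r" if "(h, g) \<in> set ms" for h g
  proof -
    have h: "h \<in> H" by (rule run_pairs(1)[OF s ap ms that])
    have *: "sg s k \<in> inner s u r" if "k \<in> inner s u r" for k
      using that nontree_sg[OF s] sg_sg[OF s] by (auto simp: inner_def nontree_def)
    show ?thesis using mP[OF that] P * sg_sg[OF s h] by (metis subsetD)
  qed
  then show N: "N \<subseteq> inner s u r" by (auto simp: N_def)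
  show "base (sg s' d) \<notin> B s u (Suc r)" if d: "d \<in> N" for d
  proof -
    obtain h g where hg: "(h, g) \<in> set ms" "d = h \<or> d = sg s h" using d by (auto simp: N_def)
    have "base g \<in> - B s u (Suc r)" "base (sg s g) \<in> - B s u (Suc r)" "sg s' h = sg s g" "sg s' (sg s h) = g"
      using inv[OF hg(1)] unfolding s'_def by blast+
    then show ?thesis using hg(2) by auto
  qed
  show same: "sg s' d = sg s d" if d: "d \<in> H" "d \<notin> N" "base d \<in> B s u (Suc r)" for d
  proof -
    have "d \<notin> touched s ms"
    proof
      assume "d \<in> touched s ms"
      then obtain h g where hg: "(h, g) \<in> set ms" "d \<in> {h, sg s h, g, sg s g}" by (auto simp: touched_def)
      have "base g \<in> - B s u (Suc r)" "base (sg s g) \<in> - B s u (Suc r)"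
        using inv[OF hg(1)] by blast+
      then have "d = h \<or> d = sg s h" using hg(2) d(3) by auto
      then show False using hg(1) d(2) unfolding N_def by blast
    qed
    then show ?thesis unfolding s'_def by (rule run_same[OF s ap ms d(1)])
  qed
  show "reach s' N' u j = B s u j"
    if "N' \<subseteq> N" "\<And>d i. d \<in> N - N' \<Longrightarrow> i < j \<Longrightarrow> base d \<notin> B s u i" "j \<le> Suc r" for N' j
  proof (rule reach_after[of N s u N' "Suc r"])
    show "N \<inter> tree s u = {}" using N unfolding inner_def nontree_def by blast
    show "j \<le> Suc (Suc r)" using that(3) by simp
    show "sg s' d = sg s d" if "d \<in> H" "d \<notin> N" "base d \<in> B s u (Suc r)" for d
      using same that by blast
  qed (rule that(1), rule that(2))
qed

end

context dart_system
begin

section \<open>Volumes, widths and collisions\<close>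

definition forward_darts :: "'s \<Rightarrow> 'v \<Rightarrow> nat \<Rightarrow> 'h set" where
  "forward_darts s u r = {d \<in> H. base d \<in> layer s u (Suc r) \<and> base (sg s d) \<notin> B s u r}"

text \<open>For a layer after the first, this is the number of darts of the layer that do not lead
back to the previous one (\<open>card_forward_darts\<close>).\<close>

definition width :: "'s \<Rightarrow> 'v \<Rightarrow> nat \<Rightarrow> nat" where
  "width s u r = card (inside s u r) + card (out s u r)"

lemma finite_dart_sets: "finite (out s u r)" "finite (inside s u r)" "finite (inner s u r)"
  "finite (collisions s u r)" "finite (forward_darts s u r)"
  using finH by (auto simp: out_def inside_def inner_def nontree_def collisions_def forward_darts_def)

lemma forward_darts_eq:
  assumes s: "s \<in> Om"
  shows "forward_darts s u r = inside s u (Suc r) \<union> out s u (Suc r)"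
proof
  show "forward_darts s u r \<subseteq> inside s u (Suc r) \<union> out s u (Suc r)"
    by (auto simp: forward_darts_def inside_def out_def layer_Suc simp del: reach.simps)
  show "inside s u (Suc r) \<union> out s u (Suc r) \<subseteq> forward_darts s u r"
  proof
    fix d assume d: "d \<in> inside s u (Suc r) \<union> out s u (Suc r)"
    then have "base d \<notin> B s u r \<or> base (sg s d) \<in> B s u (Suc r)" "d \<in> H"
      using B_step[of d s u r] by (auto simp: inside_def out_def simp del: reach.simps)
    then show "d \<in> forward_darts s u r"
      using d reach_mono[of r "Suc r" s "{}" u]
      by (auto simp: forward_darts_def inside_def out_def layer_Suc simp del: reach.simps)
  qed
qed

lemma card_forward_darts: "s \<in> Om \<Longrightarrow> card (forward_darts s u r) = width s u (Suc r)"
  unfolding forward_darts_eq width_def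
  by (rule card_Un_disjoint[OF finite_dart_sets(2,1)]) (auto simp: inside_def out_def layer_def)

lemma width_0: "width s u 0 = vol (B s u 0)"
proof -
  have "{h \<in> H. base h \<in> B s u 0} = inside s u 0 \<union> out s u 0"
    by (auto simp: inside_def out_def layer_0)
  moreover have "card (inside s u 0 \<union> out s u 0) = card (inside s u 0) + card (out s u 0)"
    by (rule card_Un_disjoint[OF finite_dart_sets(2,1)]) (auto simp: inside_def out_def layer_def)
  ultimately show ?thesis by (simp add: width_def vol_def)
qed

lemma vol_layer:
  assumes s: "s \<in> Om"
  shows "vol (layer s u (Suc r)) = card (out s u r) + width s u (Suc r)"
proof -
  let ?C = "{d \<in> H. base d \<in> layer s u (Suc r) \<and> base (sg s d) \<in> B s u r}"
  have "bij_betw (sg s) (out s u r) ?C"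
  proof (rule bij_betw_byWitness[where f' = "sg s"])
    show "sg s ` out s u r \<subseteq> ?C"
      using B_step[of _ s u r] sg_in[OF s] sg_sg[OF s] by (auto simp: out_def layer_Suc simp del: reach.simps)
    show "sg s ` ?C \<subseteq> out s u r"
      using sg_in[OF s] sg_sg[OF s] by (auto simp: out_def layer_Suc simp del: reach.simps)
  qed (use sg_sg[OF s] in \<open>auto simp: out_def\<close>)
  then have c: "card ?C = card (out s u r)" by (simp add: bij_betw_same_card)
  have "{d \<in> H. base d \<in> layer s u (Suc r)} = ?C \<union> forward_darts s u r"
    by (auto simp: forward_darts_def)
  moreover have "card (?C \<union> forward_darts s u r) = card ?C + card (forward_darts s u r)"
    by (rule card_Un_disjoint) (auto simp: finH forward_darts_def)
  ultimately show ?thesis by (simp add: vol_def c card_forward_darts[OF s])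
qed

lemma vol_Suc:
  assumes s: "s \<in> Om"
  shows "vol (B s u (Suc r)) = vol (B s u r) + card (out s u r) + width s u (Suc r)"
proof -
  have "{d \<in> H. base d \<in> B s u (Suc r)} = {d \<in> H. base d \<in> B s u r} \<union> {d \<in> H. base d \<in> layer s u (Suc r)}"
    using reach_mono[of r "Suc r" s "{}" u] unfolding layer_Suc by auto
  moreover have "card ({d \<in> H. base d \<in> B s u r} \<union> {d \<in> H. base d \<in> layer s u (Suc r)}) =
      card {d \<in> H. base d \<in> B s u r} + card {d \<in> H. base d \<in> layer s u (Suc r)}"
    by (rule card_Un_disjoint) (auto simp: finH layer_Suc)
  ultimately show ?thesis using vol_layer[OF s, of u r] by (simp add: vol_def)
qed

lemma vol_ge:
  assumes "S \<subseteq> V"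
  shows "3 * card S \<le> vol S"
proof -
  have fin: "finite S" using assms finV finite_subset by auto
  have "{h \<in> H. base h \<in> S} = (\<Union>v \<in> S. {h \<in> H. base h = v})" by auto
  moreover have "card (\<Union>v \<in> S. {h \<in> H. base h = v}) = (\<Sum>v \<in> S. card {h \<in> H. base h = v})"
    by (rule card_UN_disjoint[OF fin]) (auto simp: finH)
  moreover have "(\<Sum>v \<in> S. 3) \<le> (\<Sum>v \<in> S. card {h \<in> H. base h = v})"
    by (rule sum_mono) (use assms deg3 in auto)
  ultimately show ?thesis by (simp add: vol_def mult.commute)
qed

lemma tree_inj: "h \<in> tree s u \<Longrightarrow> k \<in> tree s u \<Longrightarrow> base (sg s h) = base (sg s k) \<Longrightarrow> h = k"
proof -
  assume a: "h \<in> tree s u" "k \<in> tree s u" and e: "base (sg s h) = base (sg s k)"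
  have "x = parent_dart s u (base (sg s x))" if x: "x \<in> tree s u" for x
  proof -
    obtain w j where w: "x = parent_dart s u w" "w \<noteq> u" "w \<in> B s u j" using x unfolding tree_def by blast
    then show ?thesis using parent_dart(2)[OF w(3,2)] by simp
  qed
  from this[OF a(1)] this[OF a(2)] show "h = k" using e by simp
qed

lemma card_out_le:
  assumes s: "s \<in> Om" and u: "u \<in> V"
  shows "card (out s u r) \<le> card (layer s u (Suc r)) + card (collisions s u r)"
proof -
  let ?T = "out s u r \<inter> tree s u"
  have fl: "finite (layer s u (Suc r))"
    by (rule finite_subset[OF _ finV]) (use reach_V[OF u s, of "{}" "Suc r"] in \<open>auto simp: layer_def simp del: reach.simps\<close>)
  have "card ?T \<le> card (layer s u (Suc r))"
  proof (rule card_inj_on_le[of "\<lambda>h. base (sg s h)"])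
    show "inj_on (\<lambda>h. base (sg s h)) ?T" using tree_inj by (auto simp: inj_on_def)
    show "(\<lambda>h. base (sg s h)) ` ?T \<subseteq> layer s u (Suc r)"
      using B_step[of _ s u r] by (auto simp: out_def layer_Suc simp del: reach.simps)
  qed (rule fl)
  moreover have "out s u r = ?T \<union> collisions s u r" by (auto simp: collisions_def)
  then have "card (out s u r) \<le> card ?T + card (collisions s u r)" by (metis card_Un_le)
  ultimately show ?thesis by simp
qed

text \<open>Apart from collisions, each dart leaving the ball finds a vertex of its own, and this vertex has
at least two further darts.\<close>

lemma out_width:
  assumes s: "s \<in> Om" and u: "u \<in> V"
  shows "2 * card (out s u r) \<le> width s u (Suc r) + 3 * card (collisions s u r)"
proof -
  have "layer s u (Suc r) \<subseteq> V" using reach_V[OF u s, of "{}" "Suc r"] by (auto simp: layer_def simp del: reach.simps)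
  then have "3 * card (layer s u (Suc r)) \<le> card (out s u r) + width s u (Suc r)"
    using vol_ge[of "layer s u (Suc r)"] vol_layer[OF s, of u r] by simp
  then show ?thesis using card_out_le[OF s u, of r] by linarith
qed

text \<open>A dart at the ball leaves it, belongs to one of its \<open>card (B s u r) - 1\<close> tree edges, or to an
inner non-tree edge, and the number of vertices of the ball is at most a third of its volume.\<close>

lemma vol_le_out_inner:
  assumes s: "s \<in> Om" and u: "u \<in> V"
  shows "vol (B s u r) + 6 \<le> 3 * card (out s u r) + 3 * card (inner s u r)"
proof -
  have BV: "B s u r \<subseteq> V" by (rule reach_V[OF u s])
  have finB: "finite (B s u r)" using BV finV finite_subset by auto
  have uB: "u \<in> B s u r" using reach_mono[of 0 r s "{}" u] by auto
  let ?T = "{h \<in> tree s u. base (sg s h) \<in> B s u r}"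
  have TH: "?T \<subseteq> H" using parent_dart(1) by (auto simp: tree_def)
  have finT: "finite ?T" using TH finH finite_subset by auto
  have "card ?T \<le> card (B s u r - {u})"
  proof (rule card_inj_on_le[of "\<lambda>h. base (sg s h)"])
    show "inj_on (\<lambda>h. base (sg s h)) ?T" using tree_inj by (auto simp: inj_on_def)
    show "(\<lambda>h. base (sg s h)) ` ?T \<subseteq> B s u r - {u}"
    proof (rule image_subsetI)
      fix x assume x: "x \<in> ?T"
      then obtain w j where w: "x = parent_dart s u w" "w \<noteq> u" "w \<in> B s u j" unfolding tree_def by blast
      then show "base (sg s x) \<in> B s u r - {u}" using parent_dart(2)[OF w(3,2)] x by simp
    qed
  qed (use finB in simp)
  then have T: "card ?T + 1 \<le> card (B s u r)" using uB finB
    by (metis Suc_eq_plus1 Suc_le_mono card_Suc_Diff1)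
  have "{h \<in> H. base h \<in> B s u r} \<subseteq> out s u r \<union> inner s u r \<union> ?T \<union> sg s ` ?T"
  proof
    fix h assume h: "h \<in> {h \<in> H. base h \<in> B s u r}"
    consider "base (sg s h) \<notin> B s u r" | "base (sg s h) \<in> B s u r" "h \<in> nontree s u"
      | "base (sg s h) \<in> B s u r" "h \<in> tree s u" | "base (sg s h) \<in> B s u r" "sg s h \<in> tree s u"
      using h by (auto simp: nontree_def)
    then show "h \<in> out s u r \<union> inner s u r \<union> ?T \<union> sg s ` ?T"
    proof cases
      case 4
      then have "sg s h \<in> ?T" using h sg_sg[OF s] by auto
      then have "sg s (sg s h) \<in> sg s ` ?T" by (rule imageI)
      then show ?thesis using sg_sg[OF s, of h] h by simp
    qed (use h in \<open>auto simp: out_def inner_def\<close>)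
  qed
  then have "vol (B s u r) \<le> card (out s u r \<union> inner s u r \<union> ?T \<union> sg s ` ?T)"
    unfolding vol_def by (rule card_mono[rotated]) (simp add: finite_dart_sets finT)
  also have "\<dots> \<le> card (out s u r \<union> inner s u r \<union> ?T) + card (sg s ` ?T)" by (rule card_Un_le)
  also have "\<dots> \<le> card (out s u r) + card (inner s u r) + card ?T + card ?T"
    using card_Un_le[of "out s u r \<union> inner s u r" ?T] card_Un_le[of "out s u r" "inner s u r"]
      card_image_le[OF finT, of "sg s"] by linarith
  finally show ?thesis using T vol_ge[OF BV] by linarith
qed

end

section \<open>Exponential growth of the explored volume\<close>

text \<open>The numbers that describe the exploration of one state that has volume at most \<open>m\<close> at
radius \<open>R\<close>: the volume \<open>v j\<close> of the ball of radius \<open>j\<close>, the number \<open>k j\<close> of darts leaving it, the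
numbers \<open>I j\<close> of darts inside layer \<open>j\<close>, \<open>c j\<close> of collisions and \<open>X j\<close> of
darts on inner non-tree edges, and the width \<open>h j\<close>. The assumptions \<open>two\<close>,
\<open>many\<close>, \<open>ins\<close> and \<open>col\<close> say that no rare event occurs. The aim is to derive a
contradiction. The constant \<open>\<eta>\<close> is \<open>1 / (960 * 5760)\<close>, where the two factors come from
\<open>wide_step\<close>.\<close>

locale growth =
  fixes v k I c X :: "nat \<Rightarrow> nat" and m t R :: nat and V1 \<eta> H0 :: real and h :: "nat \<Rightarrow> nat"
  assumes \<eta>_def: "\<eta> = 1 / 5529600" and H0_def: "H0 = V1 / 25"
    and h: "\<And>j. h j = I j + k j" and h0: "h 0 = v 0" and v0: "3 \<le> v 0"
    and v_Suc: "\<And>j. v (Suc j) = v j + k j + h (Suc j)"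
    and k_le: "\<And>j. 2 * k j \<le> h (Suc j) + 3 * c j"
    and v_le: "\<And>j. v j + 6 \<le> 3 * k j + 3 * X j"
    and X_even: "\<And>j. even (X j)"
    and small: "v R \<le> m"
    and two: "\<And>j. j + 3 \<le> R \<Longrightarrow> j \<le> 460 \<Longrightarrow> v j \<le> 460 \<Longrightarrow> X j < 4"
    and many: "\<And>j. j + 3 \<le> R \<Longrightarrow> real (v j) \<le> V1 \<Longrightarrow> X j < 92"
    and ins: "\<And>j. j + 3 \<le> R \<Longrightarrow> 20 * t\<^sup>2 \<le> I j \<Longrightarrow> I j * m < 48 * (k j + 2 * t)\<^sup>2"
    and col: "\<And>j. j + 3 \<le> R \<Longrightarrow> 10 * t\<^sup>2 \<le> c j \<Longrightarrow> c j * m < 48 * (k j * (h (Suc j) + t))"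
    and t1: "1 \<le> t" and H0_t: "600 * (real t)\<^sup>2 \<le> H0" and H0_m: "H0 \<le> \<eta> * m" and t_m: "real t \<le> \<eta> * m" 
begin

lemma v_mono: "i \<le> j \<Longrightarrow> v i \<le> v j"
  by (rule lift_Suc_mono_le[of v]) (auto simp: v_Suc)

lemma h_le_v: "h j \<le> v j"
  by (cases j) (auto simp: h0 v_Suc)

lemma H0: "0 \<le> H0"
  by (rule order_trans[OF _ H0_t]) simp

text \<open>With at most one inner non-tree edge at least a third of the volume leaves the ball, and with fewer
than \<open>92 / 2\<close> of them at least \<open>2 / 15\<close> of it does as soon as the volume exceeds \<open>460\<close>.\<close>

lemma small_step:
  assumes j: "j + 3 \<le> R" "real (v j) \<le> V1" "j \<le> v j"
  shows "2 * v j \<le> 15 * k j"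
proof (cases "v j \<le> 460")
  case True
  then have "X j < 4" using two j by simp
  then have "X j \<le> 2" using X_even[of j] by presburger
  then show ?thesis using v_le[of j] by linarith
next
  case False
  then show ?thesis using many[OF j(1,2)] v_le[of j] by linarith
qed

lemma exponential_start:
  assumes "j + 2 \<le> R"
  shows "V1 < v j \<or> (3 * (17/15) ^ j \<le> real (v j) \<and> j \<le> v j)"
  using assms
proof (induction j)
  case 0
  then show ?case using v0 by simp
next
  case (Suc j)
  show ?case
  proof (cases "V1 < v j")
    case True
    then show ?thesis using v_mono[of j "Suc j"] by (auto intro: less_le_trans)
  next
    case False
    then have IH: "3 * (17/15) ^ j \<le> real (v j)" "j \<le> v j" using Suc by auto
    have k: "2 * v j \<le> 15 * k j" using small_step IH False Suc.prems by simp
    have "v 0 \<le> v j" by (rule v_mono) simp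
    then have "1 \<le> k j" using k v0 by linarith
    then have "Suc j \<le> v (Suc j)" using IH v_Suc[of j] by linarith
    moreover have "(17/15) * real (v j) \<le> real (v (Suc j))" using k unfolding v_Suc by (simp add: field_simps)
    then have "3 * (17/15) ^ Suc j \<le> real (v (Suc j))" using IH(1) by simp
    ultimately show ?thesis by blast
  qed
qed

text \<open>When the volume first exceeds \<open>V1\<close>, a constant fraction of it lies in the width of the layer
just reached or of the layer before it. From then on the widths are followed instead of the volume.\<close>

lemma wide_layer:
  assumes J: "J + 2 \<le> R" "V1 < 3 * (17/15) ^ J"
  shows "\<exists>\<rho> \<le> J. H0 \<le> h \<rho>"
proof -
  have "V1 < v J" using exponential_start[OF J(1)] J(2) by auto
  define r where "r = (LEAST j. V1 < v j)"
  have r: "V1 < v r" "r \<le> J" unfolding r_def using \<open>V1 < v J\<close> by (auto intro: LeastI Least_le)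
  have V1: "0 \<le> V1" using H0 unfolding H0_def by simp
  show ?thesis
  proof (cases r)
    case 0
    then have "H0 \<le> h 0" using r(1) h0 V1 by (simp add: H0_def)
    then show ?thesis by blast
  next
    case (Suc p)
    have p: "real (v p) \<le> V1" using not_less_Least[of p "\<lambda>j. V1 < v j"] Suc unfolding r_def by auto
    then have "p \<le> v p" using exponential_start[of p] J(1) r(2) Suc by auto
    then have k: "2 * v p \<le> 15 * k p" using small_step[of p] p J(1) r(2) Suc by simp
    have "H0 \<le> h (Suc p) \<or> H0 \<le> h p"
    proof (rule ccontr)
      assume a: "\<not> ?thesis"
      then have "real (h (Suc p)) < V1 / 25" "real (k p) < V1 / 25" using h[of p] by (auto simp: H0_def)
      moreover have "V1 < real (v p) + real (k p) + real (h (Suc p))" using r(1) Suc v_Suc[of p] by simp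
      moreover have "2 * real (v p) \<le> 15 * real (k p)" using k by linarith
      ultimately show False using V1 by linarith
    qed
    then show ?thesis using r(2) Suc by (metis Suc_leD)
  qed
qed

text \<open>A layer of small width grows by the factor \<open>17 / 15\<close>, since otherwise a constant proportion of
its darts would be on edges inside the layer or on collisions. If the width is a constant
proportion of \<open>m\<close>, this argument fails. Then the width can at most drop to \<open>\<eta> * m\<close>,
because a much larger drop would again be a rare event.\<close>

lemma wide_step:
  assumes j: "j + 3 \<le> R" and h_ge: "H0 \<le> h j"
  shows "(h j \<le> m / 960 \<and> (17/15) * h j \<le> h (Suc j)) \<or> \<eta> * m \<le> h (Suc j)"
proof (rule ccontr)
  assume contr: "\<not> ?thesis"
  define hj kj Ij cj h' M T where "hj = real (h j)" and "kj = real (k j)" and "Ij = real (I j)"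
    and "cj = real (c j)" and "h' = real (h (Suc j))" and "M = real m" and "T = real t"
  have T1: "1 \<le> T" using t1 by (simp add: T_def)
  have T2: "T \<le> T\<^sup>2" using T1 by (simp add: power2_eq_square)
  have hT: "600 * T\<^sup>2 \<le> hj" using H0_t h_ge by (simp add: T_def hj_def)
  have e1: "hj = Ij + kj" using h[of j] by (simp add: hj_def kj_def Ij_def)
  have e2: "2 * kj \<le> h' + 3 * cj" using k_le[of j] unfolding kj_def h'_def cj_def by linarith
  have nn: "0 \<le> kj" "0 \<le> Ij" "0 \<le> cj" "0 \<le> h'" "0 \<le> M" by (auto simp: kj_def Ij_def cj_def h'_def M_def)
  have hp: "0 < hj" using hT T1 T2 by linarith
  have hM: "hj \<le> M" using h_le_v[of j] v_mono[of j R] small j by (simp add: hj_def M_def)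
  have insr: "Ij * M < 48 * (kj + 2 * T)\<^sup>2" if "20 * T\<^sup>2 \<le> Ij"
  proof -
    have "real (20 * t\<^sup>2) \<le> real (I j)" using that by (simp add: T_def Ij_def)
    then have "real (I j * m) < real (48 * (k j + 2 * t)\<^sup>2)" using ins[OF j] of_nat_le_iff of_nat_less_iff by metis
    then show ?thesis by (simp add: Ij_def M_def kj_def T_def)
  qed
  have colr: "cj * M < 48 * (kj * (h' + T))" if "10 * T\<^sup>2 \<le> cj"
  proof -
    have "real (10 * t\<^sup>2) \<le> real (c j)" using that by (simp add: T_def cj_def)
    then have "real (c j * m) < real (48 * (k j * (h (Suc j) + t)))" using col[OF j] of_nat_le_iff of_nat_less_iff by metis
    then show ?thesis by (simp add: cj_def M_def kj_def T_def h'_def)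
  qed
  show False
  \<comment> \<open>In the first case, \<open>Ij\<close> at least \<open>hj / 5\<close> or \<open>cj\<close> at least \<open>hj / 10\<close> contradicts that \<open>hj\<close> is small compared with \<open>M\<close>. In the second case at least \<open>hj / 20\<close> darts must leave the layer, and only then collisions are counted.\<close>
  proof (cases "hj \<le> M / 960")
    case True
    then have h'small: "h' < (17/15) * hj" using contr by (auto simp: hj_def M_def h'_def)
    have "Ij < hj / 5"
    proof (rule ccontr)
      assume "\<not> ?thesis"
      then have I5: "hj / 5 \<le> Ij" by simp
      then have "Ij * M < 48 * (kj + 2 * T)\<^sup>2" using insr hT zero_le_power2[of T] by linarith
      moreover have "kj + 2 * T \<le> 2 * hj" using e1 nn hT T2 by linarith
      then have "(kj + 2 * T)\<^sup>2 \<le> (2 * hj)\<^sup>2" using nn T1 by (intro power_mono) auto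
      moreover have "hj / 5 * (960 * hj) \<le> Ij * M" using I5 True hp by (intro mult_mono) auto
      ultimately show False by (simp add: power2_eq_square)
    qed
    then have "hj / 10 \<le> cj" using e1 e2 h'small hp by linarith
    moreover have "cj * M < 48 * (kj * (h' + T))" using calculation colr hT zero_le_power2[of T] by linarith
    moreover have "kj * (h' + T) \<le> hj * (2 * hj)" using e1 nn h'small hT T2 T1 by (intro mult_mono) linarith+
    moreover have "hj / 10 * (960 * hj) \<le> cj * M" using calculation(1) True hp by (intro mult_mono) auto
    ultimately show False by (simp add: power2_eq_square)
  next
    case False
    then have hM': "M < 960 * hj" by simp
    have "h' < \<eta> * M" using contr unfolding h'_def M_def by linarith
    then have h'small: "h' < hj / 5760" using hM' by (simp add: \<eta>_def)
    have TM: "T \<le> hj / 5760" using t_m hM' by (simp add: \<eta>_def T_def M_def)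
    have "hj / 20 \<le> kj"
    proof (rule ccontr)
      assume a: "\<not> ?thesis"
      then have "Ij * M < 48 * (kj + 2 * T)\<^sup>2" using insr e1 hT hp zero_le_power2[of T] by linarith
      moreover have "(kj + 2 * T)\<^sup>2 \<le> (hj / 10)\<^sup>2" using a nn T1 TM hp by (intro power_mono) linarith+
      moreover have "(19/20 * hj) * hj \<le> Ij * M" using a e1 hM hp by (intro mult_mono) linarith+
      moreover have "0 < hj * hj" using hp by simp
      ultimately show False by (simp add: power2_eq_square)
    qed
    then have c60: "hj / 60 \<le> cj" using e2 h'small hp by linarith
    then have "cj * M < 48 * (kj * (h' + T))" using colr hT by linarith
    moreover have "kj * (h' + T) \<le> hj * (hj / 2880)" using e1 nn h'small TM T1 by (intro mult_mono) linarith+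
    moreover have "hj / 60 * hj \<le> cj * M" using c60 hM hp by (intro mult_mono) auto
    ultimately show False by (simp add: power2_eq_square)
  qed
qed

lemma wide_layers:
  assumes "H0 \<le> h \<rho>" "\<rho> + i + 2 \<le> R"
  shows "min (\<eta> * m) (H0 * (17/15) ^ i) \<le> h (\<rho> + i)"
  using assms(2)
proof (induction i)
  case (Suc i)
  then have IH: "min (\<eta> * m) (H0 * (17/15) ^ i) \<le> h (\<rho> + i)" by simp
  have "H0 * 1 \<le> H0 * (17/15) ^ i" by (rule mult_left_mono[OF one_le_power H0]) simp
  then have "H0 \<le> h (\<rho> + i)" using IH H0_m by linarith
  moreover have "\<rho> + i + 3 \<le> R" using Suc.prems by simp
  ultimately have "(17/15) * real (h (\<rho> + i)) \<le> h (Suc (\<rho> + i)) \<or> \<eta> * m \<le> h (Suc (\<rho> + i))"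
    using wide_step[of "\<rho> + i"] by blast
  then show ?case
  proof
    assume a: "(17/15) * real (h (\<rho> + i)) \<le> h (Suc (\<rho> + i))"
    have "0 \<le> \<eta> * m" by (simp add: \<eta>_def)
    then have "min (\<eta> * m) (H0 * (17/15) ^ i * (17/15)) \<le> (17/15) * min (\<eta> * m) (H0 * (17/15) ^ i)"
      by linarith
    also have "\<dots> \<le> h (Suc (\<rho> + i))" using IH a by linarith
    finally show ?thesis by (simp add: mult_ac)
  qed simp
qed (use assms(1) in auto)

text \<open>Exponential growth of the volume for \<open>J\<close> layers, then exponential growth of the width for
\<open>i\<close> layers, and finally \<open>L\<close> layers of width at least \<open>\<eta> * m\<close> each, which together have
volume greater than \<open>m\<close>.\<close>

lemma no_growth_impossible:
  assumes "V1 < 3 * (17/15) ^ J" "\<eta> * m \<le> H0 * (17/15) ^ i" "J + i + L + 2 \<le> R" "1 < real L * \<eta>" "0 < m"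
  shows False
proof -
  have "J + 2 \<le> R" using assms(3) by linarith
  then obtain \<rho> where \<rho>: "\<rho> \<le> J" "H0 \<le> h \<rho>" using wide_layer[OF _ assms(1)] by blast
  have w: "\<eta> * m \<le> h (\<rho> + i + a)" if "a \<le> L" for a
  proof -
    have "\<eta> * m \<le> H0 * (17/15) ^ (i + a)"
      by (rule order_trans[OF assms(2)]) (intro mult_left_mono power_increasing H0; simp)
    moreover have "\<rho> + (i + a) + 2 \<le> R" using \<rho>(1) that assms(3) by linarith
    ultimately show ?thesis using wide_layers[OF \<rho>(2), of "i + a"] by (simp add: add.assoc)
  qed
  have "real a * (\<eta> * m) \<le> v (\<rho> + i + a)" if "a \<le> L" for a
    using that
  proof (induction a)
    case (Suc a)
    have "real (v (\<rho> + i + Suc a)) \<ge> real (v (\<rho> + i + a)) + real (h (\<rho> + i + Suc a))"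
      using v_Suc[of "\<rho> + i + a"] by simp
    moreover have "real a * (\<eta> * m) \<le> v (\<rho> + i + a)" by (rule Suc.IH) (use Suc.prems in simp)
    moreover have "\<eta> * m \<le> h (\<rho> + i + Suc a)" by (rule w[OF Suc.prems])
    moreover have "real (Suc a) * (\<eta> * m) = real a * (\<eta> * m) + \<eta> * m" by (simp add: distrib_right)
    ultimately show ?case by linarith
  qed simp
  from this[OF order_refl] have a: "real L * (\<eta> * m) \<le> v (\<rho> + i + L)" .
  have b: "real m < real L * (\<eta> * m)"
    using mult_strict_right_mono[OF assms(4), of "real m"] assms(5) unfolding mult.assoc by linarith
  have c: "v (\<rho> + i + L) \<le> v R" by (rule v_mono) (use \<rho>(1) assms(3) in linarith)
  show False using a b c small by linarith
qed

end

context switch_system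
begin

section \<open>Rare configurations of non-tree edges\<close>

lemma inside_inner: "s \<in> Om \<Longrightarrow> inside s u r \<subseteq> inner s u r"
  using inside_nontree[of s u r] by (auto simp: inner_def inside_def layer_def)

lemma inside_sg: "s \<in> Om \<Longrightarrow> h \<in> inside s u r \<Longrightarrow> sg s h \<in> inside s u r"
  by (auto simp: inside_def sg_in sg_sg)

lemma card_far': "s \<in> Om \<Longrightarrow> card H = 2 * m \<Longrightarrow> vol (B s u (r + 2)) \<le> m \<Longrightarrow> m div 2 \<le> card (far s u r)"
  using card_far[of s m u r] by (simp del: reach.simps)

lemma layer_not_in: "base d \<in> layer s u r \<Longrightarrow> i < r \<Longrightarrow> base d \<notin> B s u i"
  using depth_le by (fastforce simp: layer_def)

text \<open>Exchanging edges inside layer \<open>r\<close> preserves the ball of radius \<open>r\<close>, and all moved darts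
leave this ball afterwards. So both darts of each exchanged edge are among \<open>k + 2 t\<close> darts.\<close>

lemma inside_bound:
  assumes m: "card H = 2 * m"
    and Ev: "Ev \<subseteq> {s \<in> Om. 2 * i \<le> card (inside s u r) \<and> card (out s u r) \<le> k \<and> vol (B s u (r + 2)) \<le> m}"
  shows "card Ev * ((i - 5 * t\<^sup>2) * (m div 2 - 5 * t\<^sup>2)) ^ t \<le> card Om * ((k + 2 * t)\<^sup>2) ^ t"
proof -
  define P where "P s = {h \<in> inside s u r. h < sg s h}" for s
  define Guess where "Guess s = (if card (out s u r) \<le> k + 2 * t
    then {zs. set zs \<subseteq> out s u r \<times> out s u r \<and> length zs = t} else {})" for s
  have Ev': "s \<in> Om" "2 * i \<le> card (inside s u r)" "card (out s u r) \<le> k" "vol (B s u (r + 2)) \<le> m" if "s \<in> Ev" for s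
    using that Ev by auto
  have insH: "inside s u r \<subseteq> H" for s by (auto simp: inside_def)
  have Pin: "P s \<subseteq> inner s u r" if "s \<in> Ev" for s
    using inside_inner[OF Ev'(1)[OF that], of u r] by (auto simp: P_def)
  show ?thesis
  proof (rule switching_bound[where P = "\<lambda>s _. P s" and Q = "\<lambda>s. far s u r" and X = "\<lambda>s. B s u r"
        and Y = "\<lambda>s. - B s u (Suc r)" and Guess = Guess])
    show "Ev \<subseteq> Om" using Ev by auto
    show ap: "apart s (\<lambda>_. P s) (far s u r) (B s u r) (- B s u (Suc r))" if "s \<in> Ev" for s
      by (rule apart_far) (use Pin[OF that] in \<open>auto simp: inner_def nontree_def\<close>)
    show "((i - 5 * t\<^sup>2) * (m div 2 - 5 * t\<^sup>2)) ^ t \<le> card (choices (moves s (\<lambda>_. P s) (far s u r)) t)"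
      if s: "s \<in> Ev" for s
    proof -
      note hf = half[OF Ev'(1)[OF s] insH inside_sg[OF Ev'(1)[OF s]]]
      have "i \<le> card (P s)" using hf(1) Ev'(2)[OF s] by (simp add: P_def)
      moreover have "m div 2 \<le> card (far s u r)" by (rule card_far'[OF Ev'(1)[OF s] m Ev'(4)[OF s]])
      ultimately have "((i - 5 * t\<^sup>2) * (m div 2 - 5 * t\<^sup>2)) ^ t \<le> ((card (P s) - 5 * t\<^sup>2) * (card (far s u r) - 5 * t\<^sup>2)) ^ t"
        by (intro power_mono mult_mono diff_le_mono) auto
      also have "\<dots> \<le> card (choices (moves s (\<lambda>_. P s) (far s u r)) t)"
        by (rule card_sequences_ge[OF Ev'(1)[OF s] ap[OF s] _ far_disj[OF Ev'(1)[OF s]]]) (use hf(2) in \<open>simp add: P_def\<close>)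
      finally show ?thesis .
    qed
    show "finite (Guess s) \<and> card (Guess s) \<le> ((k + 2 * t)\<^sup>2) ^ t" for s
      using finite_dart_sets(1)[of s u r]
      by (auto simp: Guess_def card_lists_length_eq finite_lists_length_eq card_cartesian_product power2_eq_square
          intro!: power_mono mult_mono)
    show "darts1 s ms \<in> Guess (run ms s)" if s: "s \<in> Ev" and ms: "ms \<in> choices (moves s (\<lambda>_. P s) (far s u r)) t" for s ms
    proof -
      note s' = Ev'(1)[OF s]
      define N where "N = (\<Union>(h, g) \<in> set ms. {h, sg s h})"
      note af = after_switching[OF s' Pin[OF s] ms, folded N_def]
      have Nin: "N \<subseteq> inside s u r"
        using af(6) inside_sg[OF s'] sg_sg[OF s'] run_pairs(1)[OF s' ap[OF s] ms]
        unfolding N_def P_def by fastforce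
      have R: "reach (run ms s) {} u j = B s u j" if "j \<le> r" for j
        by (rule af(5)) (use that Nin layer_not_in[of _ s u r] in \<open>auto simp: inside_def\<close>)
      have mono: "B s u r \<subseteq> B s u (Suc r)" by (rule reach_mono) simp
      have "d \<in> out (run ms s) u r" if "d \<in> N" for d
        using that Nin af(3)[OF that] R[of r] mono unfolding out_def inside_def layer_def by auto
      then have sub: "N \<subseteq> out (run ms s) u r" by blast
      have "out (run ms s) u r \<subseteq> out s u r \<union> N"
      proof
        fix d assume d: "d \<in> out (run ms s) u r"
        then have d': "d \<in> H" "base d \<in> B s u r" using R[of r] by (auto simp: out_def)
        show "d \<in> out s u r \<union> N"
        proof (cases "d \<in> N")
          case False
          then have "sg (run ms s) d = sg s d" using af(4) d' mono by blast
          then show ?thesis using d R[of r] by (auto simp: out_def)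
        qed simp
      qed
      then have "card (out (run ms s) u r) \<le> card (out s u r \<union> N)"
        by (rule card_mono[rotated]) (use finite_dart_sets(1) in \<open>auto simp: N_def\<close>)
      also have "\<dots> \<le> card (out s u r) + card N" by (rule card_Un_le)
      also have "card N \<le> 2 * t"
        using card_UN_pair_le[of "\<lambda>(h, g). h" "\<lambda>(h, g). sg s h" ms] length_choices[OF ms]
        by (simp add: N_def case_prod_unfold)
      finally have "card (out (run ms s) u r) \<le> k + 2 * t" using Ev'(3)[OF s] by simp
      moreover have "set (darts1 s ms) \<subseteq> N \<times> N" unfolding darts1_def N_def by force
      ultimately show ?thesis using sub length_choices[OF ms] by (auto simp: Guess_def darts1_def)
    qed
  qed
qed

text \<open>For a collision between layers \<open>r\<close> and \<open>r + 1\<close> the two darts are guessed in turn. The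
darts in layer \<open>r\<close> are among the \<open>k\<close> darts that leave the ball. Once these are known and
ignored, layer \<open>r + 1\<close> of the original state can be recovered (its vertices keep their
tree edges), and the other darts are among the at most \<open>w + t\<close> darts of this layer that do not lead
back. It is essential not to look for them in layer \<open>r + 1\<close> of the switched state, which
may contain new vertices of large degree. The factor \<open>2\<close> accounts for which of the two
darts was moved.\<close>

lemma collisions_bound:
  assumes m: "card H = 2 * m"
    and Ev: "Ev \<subseteq> {s \<in> Om. c \<le> card (collisions s u r) \<and> card (out s u r) \<le> k \<and>
      card (forward_darts s u r) \<le> w \<and> vol (B s u (r + 3)) \<le> m}"
  shows "card Ev * ((c - 5 * t\<^sup>2) * (m div 2 - 5 * t\<^sup>2)) ^ t \<le> card Om * (2 * k * (w + t)) ^ t"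
proof -
  define W where "W s X = {d \<in> H. base d \<in> reach s X u (Suc r) - reach s {} u r \<and> base (sg s d) \<notin> reach s {} u r}" for s X
  define G0 where "G0 s = (SIGMA xs : (if card (out s u r) \<le> k then {xs. set xs \<subseteq> out s u r \<and> length xs = t} else {}).
     (if card (W s (set xs)) \<le> w + t then {ys. set ys \<subseteq> W s (set xs) \<and> length ys = t} else {}) \<times> {bs :: bool list. length bs = t})" for s
  define Guess where "Guess s = (\<lambda>(xs, ys, bs). map (\<lambda>(x, y, b). if b then (x, y) else (y, x)) (zip xs (zip ys bs))) ` G0 s" for s
  have Ev': "s \<in> Om" "c \<le> card (collisions s u r)" "card (out s u r) \<le> k"
    "card (forward_darts s u r) \<le> w" "vol (B s u (Suc r + 2)) \<le> m" if "s \<in> Ev" for s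
    using that Ev by (auto simp: numeral_3_eq_3 simp del: reach.simps)
  have col: "h \<in> H" "base h \<in> B s u r" "base (sg s h) \<notin> B s u r" "base (sg s h) \<in> layer s u (Suc r)"
    "base (sg s h) \<in> B s u (Suc r)" "base h \<in> B s u (Suc r)"
    if "h \<in> collisions s u r" for s h
    using that B_step[of h s u r] reach_mono[of r "Suc r" s "{}" u] unfolding layer_Suc
    by (auto simp: collisions_def out_def simp del: reach.simps)
  have Pin: "collisions s u r \<subseteq> inner s u (Suc r)" if "s \<in> Ev" for s
    using collisions_nontree[OF Ev'(1)[OF that], of u r] col(5,6) by (auto simp: inner_def simp del: reach.simps)
  show ?thesis
  proof (rule switching_bound[where P = "\<lambda>s _. collisions s u r" and Q = "\<lambda>s. far s u (Suc r)" and X = "\<lambda>s. B s u (Suc r)"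
        and Y = "\<lambda>s. - B s u (Suc (Suc r))" and Guess = Guess])
    show "Ev \<subseteq> Om" using Ev by auto
    show ap: "apart s (\<lambda>_. collisions s u r) (far s u (Suc r)) (B s u (Suc r)) (- B s u (Suc (Suc r)))" if "s \<in> Ev" for s
      by (rule apart_far) (use Pin[OF that] in \<open>auto simp: inner_def nontree_def\<close>)
    show "((c - 5 * t\<^sup>2) * (m div 2 - 5 * t\<^sup>2)) ^ t \<le> card (choices (moves s (\<lambda>_. collisions s u r) (far s u (Suc r))) t)"
      if s: "s \<in> Ev" for s
    proof -
      have "m div 2 \<le> card (far s u (Suc r))" by (rule card_far'[OF Ev'(1)[OF s] m Ev'(5)[OF s]])
      then have "((c - 5 * t\<^sup>2) * (m div 2 - 5 * t\<^sup>2)) ^ t \<le> ((card (collisions s u r) - 5 * t\<^sup>2) * (card (far s u (Suc r)) - 5 * t\<^sup>2)) ^ t"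
        using Ev'(2)[OF s] by (intro power_mono mult_mono diff_le_mono) auto
      also have "\<dots> \<le> card (choices (moves s (\<lambda>_. collisions s u r) (far s u (Suc r))) t)"
        by (rule card_sequences_ge[OF Ev'(1)[OF s] ap[OF s] _ far_disj[OF Ev'(1)[OF s]]])
          (use col(2,3)[of _ s] in auto)
      finally show ?thesis .
    qed
    show "finite (Guess s) \<and> card (Guess s) \<le> (2 * k * (w + t)) ^ t" for s
    proof -
      have fW: "finite (W s X)" for X using finH by (simp add: W_def)
      have fb: "finite {bs :: bool list. length bs = t}" "card {bs :: bool list. length bs = t} = 2 ^ t"
        using finite_lists_length_eq[of "UNIV :: bool set" t] card_lists_length_eq[of "UNIV :: bool set" t] by auto
      have fin: "finite (G0 s)" unfolding G0_def
        by (auto intro!: finite_SigmaI simp: finite_lists_length_eq finite_dart_sets(1) fW fb)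
      have "card (G0 s) \<le> k ^ t * ((w + t) ^ t * 2 ^ t)"
      proof -
        let ?X = "if card (out s u r) \<le> k then {xs. set xs \<subseteq> out s u r \<and> length xs = t} else {}"
        let ?Y = "\<lambda>xs. (if card (W s (set xs)) \<le> w + t then {ys. set ys \<subseteq> W s (set xs) \<and> length ys = t} else {}) \<times> {bs :: bool list. length bs = t}"
        have X: "finite ?X" "card ?X \<le> k ^ t"
          using finite_dart_sets(1)[of s u r] by (auto simp: card_lists_length_eq finite_lists_length_eq intro!: power_mono)
        have Y: "finite (?Y xs)" "card (?Y xs) \<le> (w + t) ^ t * 2 ^ t" for xs
          using fW[of "set xs"] fb by (auto simp: card_lists_length_eq finite_lists_length_eq card_cartesian_product intro!: power_mono)
        have "card (G0 s) = (\<Sum>xs\<in>?X. card (?Y xs))" unfolding G0_def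
          by (rule card_SigmaI) (use X Y in blast)+
        also have "\<dots> \<le> (\<Sum>xs\<in>?X. (w + t) ^ t * 2 ^ t)" by (rule sum_mono) (rule Y(2))
        also have "\<dots> = card ?X * ((w + t) ^ t * 2 ^ t)" by simp
        also have "\<dots> \<le> k ^ t * ((w + t) ^ t * 2 ^ t)" by (rule mult_le_mono1) (rule X(2))
        finally show ?thesis .
      qed
      then have "card (Guess s) \<le> k ^ t * ((w + t) ^ t * 2 ^ t)"
        using card_image_le[OF fin] le_trans unfolding Guess_def by blast
      also have "k ^ t * ((w + t) ^ t * 2 ^ t) = (2 * k * (w + t)) ^ t"
        by (simp only: power_mult_distrib mult_ac)
      finally show ?thesis using fin by (simp add: Guess_def)
    qed
    show "darts1 s ms \<in> Guess (run ms s)" if s: "s \<in> Ev" and ms: "ms \<in> choices (moves s (\<lambda>_. collisions s u r) (far s u (Suc r))) t" for s ms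
    proof -
      note s' = Ev'(1)[OF s]
      define N where "N = (\<Union>(h, g) \<in> set ms. {h, sg s h})"
      note af = after_switching[OF s' Pin[OF s] ms, folded N_def]
      define xs where "xs = map (\<lambda>(h, g). if base h \<in> B s u r then h else sg s h) ms"
      define ys where "ys = map (\<lambda>(h, g). if base h \<in> B s u r then sg s h else h) ms"
      define bs where "bs = map (\<lambda>(h, g). base h \<in> B s u r) ms"
      have len: "length ms = t" using length_choices[OF ms] .
      then have leny: "length ys = t" by (simp add: ys_def)
      have mono: "B s u r \<subseteq> B s u (Suc r)" by (rule reach_mono) simp
      have xy: "(if base h \<in> B s u r then h else sg s h) \<in> collisions s u r \<and>
         (if base h \<in> B s u r then sg s h else h) = sg s (if base h \<in> B s u r then h else sg s h)"
        if "(h, g) \<in> set ms" for h g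
      proof -
        have h: "h \<in> H" by (rule run_pairs(1)[OF s' ap[OF s] ms that])
        have "h \<in> collisions s u r \<or> sg s h \<in> collisions s u r" using af(6)[OF that] by blast
        then show ?thesis using col(2,3)[of h s] col(2,3)[of "sg s h" s] sg_sg[OF s' h] by auto
      qed
      have xs: "set xs \<subseteq> collisions s u r" "set xs \<subseteq> N" and ys: "set ys \<subseteq> sg s ` collisions s u r" "set ys \<subseteq> N"
        using xy by (force simp: xs_def ys_def N_def)+
      have "{h, sg s h} = {if base h \<in> B s u r then h else sg s h, if base h \<in> B s u r then sg s h else h}" for h
        by auto
      then have N: "N = set xs \<union> set ys"
        unfolding N_def xs_def ys_def set_map case_prod_unfold by blast
      have ysl: "base d \<in> layer s u (Suc r)" if "d \<in> set ys" for d using ys that col(4) by blast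
      have R0: "reach (run ms s) {} u r = B s u r"
      proof (rule af(5))
        fix d i assume d: "d \<in> N - {}" "i < r"
        show "base d \<notin> B s u i"
        proof
          assume a: "base d \<in> B s u i"
          have di: "depth s u (base d) \<le> i" by (rule depth_le[OF a])
          have "d \<in> set xs \<or> d \<in> set ys" using d N by auto
          then show False
          proof
            assume "d \<in> set ys" then show False using ysl[of d] di d by (auto simp: layer_def)
          next
            assume "d \<in> set xs"
            then have dc: "d \<in> collisions s u r" using xs by blast
            then have "base (sg s d) \<in> B s u (Suc i)" using B_step a col(1) by blast
            moreover have "B s u (Suc i) \<subseteq> B s u r" by (rule reach_mono) (use d in simp)
            ultimately show False using col(3)[OF dc] by blast
          qed
        qed
      qed auto
      have R1: "reach (run ms s) (set xs) u (Suc r) = B s u (Suc r)"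
      proof (rule af(5))
        fix d i assume d: "d \<in> N - set xs" "i < Suc r"
        then have "d \<in> set ys" using N by auto
        then show "base d \<notin> B s u i" using layer_not_in[OF ysl d(2)] by blast
      qed (use xs in auto)
      have o: "out (run ms s) u r \<subseteq> out s u r"
      proof
        fix d assume d: "d \<in> out (run ms s) u r"
        then have d': "d \<in> H" "base d \<in> B s u r" "base (sg (run ms s) d) \<notin> B s u r" using R0 by (auto simp: out_def)
        show "d \<in> out s u r"
        proof (cases "d \<in> N")
          case True
          then have "d \<in> set xs" using N ysl d'(2) layer_Suc by blast
          then show ?thesis using xs by (auto simp: collisions_def)
        next
          case False
          moreover have "base d \<in> B s u (Suc (Suc r))" using d'(2) reach_mono[of r "Suc (Suc r)" s "{}" u] by auto
          ultimately have "sg (run ms s) d = sg s d" using af(4) d' by blast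
          then show ?thesis using d' by (auto simp: out_def)
        qed
      qed
      then have ck: "card (out (run ms s) u r) \<le> k"
        using card_mono[OF finite_dart_sets(1) o] Ev'(3)[OF s] by simp
      have W: "W (run ms s) (set xs) = {d \<in> H. base d \<in> layer s u (Suc r) \<and> base (sg (run ms s) d) \<notin> B s u r}"
        unfolding W_def R0 R1 layer_Suc by blast
      have far: "base (sg (run ms s) d) \<notin> B s u r" if "d \<in> N" for d
        using af(3)[OF that] reach_mono[of r "Suc (Suc r)" s "{}" u] by auto
      have NH: "N \<subseteq> H" using af(2) by (auto simp: inner_def nontree_def)
      have "W (run ms s) (set xs) \<subseteq> forward_darts s u r \<union> set ys"
      proof
        fix d assume d: "d \<in> W (run ms s) (set xs)"
        show "d \<in> forward_darts s u r \<union> set ys"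
        proof (cases "d \<in> N")
          case True
          moreover have "d \<notin> set xs" using d xs(1) col(2) unfolding W layer_Suc by blast
          ultimately show ?thesis using N by auto
        next
          case False
          moreover have "base d \<in> B s u (Suc (Suc r))"
            using d reach_mono[of "Suc r" "Suc (Suc r)" s "{}" u] unfolding W layer_Suc by auto
          ultimately have "sg (run ms s) d = sg s d" using af(4) d unfolding W by blast
          then show ?thesis using d unfolding W forward_darts_def by auto
        qed
      qed
      then have "card (W (run ms s) (set xs)) \<le> card (forward_darts s u r \<union> set ys)"
        by (rule card_mono[rotated]) (simp add: forward_darts_def finH)
      also have "\<dots> \<le> card (forward_darts s u r) + card (set ys)" by (rule card_Un_le)
      also have "card (set ys) \<le> t" using card_length[of ys] len by (simp add: ys_def)
      finally have cw: "card (W (run ms s) (set xs)) \<le> w + t" using Ev'(4)[OF s] by simp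
      have "d \<in> out (run ms s) u r" if "d \<in> set xs" for d
      proof -
        have "d \<in> N" "d \<in> collisions s u r" using xs that by auto
        then show ?thesis using far[of d] col(1,2)[of d s] R0 by (auto simp: out_def)
      qed
      then have "xs \<in> {xs. set xs \<subseteq> out (run ms s) u r \<and> length xs = t}" using len by (auto simp: xs_def)
      moreover have "ys \<in> {ys. set ys \<subseteq> W (run ms s) (set xs) \<and> length ys = t}"
        unfolding W using ys(2) NH ysl far leny by blast
      ultimately have "(xs, ys, bs) \<in> G0 (run ms s)"
        using ck cw len by (simp add: G0_def bs_def)
      moreover have "darts1 s ms = map (\<lambda>(x, y, b). if b then (x, y) else (y, x)) (zip xs (zip ys bs))"
        unfolding darts1_def xs_def ys_def bs_def
        by (rule nth_equalityI) (auto simp: case_prod_unfold)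
      ultimately show ?thesis unfolding Guess_def by force
    qed
  qed
qed

end

context switch_system
begin

text \<open>The new darts, sorted by their distance from \<open>u\<close>, can be found one after the other: the next
one lies in the ball of some radius \<open>j \<le> r\<close> around \<open>u\<close> when the earlier ones are
ignored, and this ball has volume at most \<open>v\<close>. The last factor accounts for the assignment
of the \<open>2 t\<close> darts to the exchanges.\<close>

lemma inner_bound:
  assumes Ev: "\<And>s. s \<in> Ev \<Longrightarrow> s \<in> Om \<and> vol (B s u r) \<le> v"
    and P: "\<And>s i. s \<in> Ev \<Longrightarrow> P s i \<subseteq> inner s u r"
    and F: "\<And>s. s \<in> Ev \<Longrightarrow> F \<le> card (choices (moves s (P s) (far s u r)) t)"
  shows "card Ev * F \<le> card Om * (((r + 1) * v) ^ (2 * t) * (2 * t) ^ (2 * t))"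
proof -
  define S where "S s X = (\<Union>j \<le> r. if vol (reach s X u j) \<le> v then {d \<in> H. base d \<in> reach s X u j} else {})" for s X
  define Guess where "Guess s = (\<Union>D \<in> choices (\<lambda>X. S s (set X)) (2 * t). {zs. set zs \<subseteq> set D \<times> set D \<and> length zs = t})" for s
  have finS: "finite (S s X)" for s X using finH by (simp add: S_def)
  have cardS: "card (S s X) \<le> (r + 1) * v" for s X
  proof -
    have "card (S s X) \<le> (\<Sum>j \<le> r. card (if vol (reach s X u j) \<le> v then {d \<in> H. base d \<in> reach s X u j} else {}))"
      unfolding S_def by (rule card_UN_le) simp
    also have "\<dots> \<le> (\<Sum>j \<le> r. v)" by (rule sum_mono) (auto simp: vol_def)
    finally show ?thesis by simp
  qed
  show ?thesis
  proof (rule switching_bound[where P = P and Q = "\<lambda>s. far s u r" and X = "\<lambda>s. B s u r"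
        and Y = "\<lambda>s. - B s u (Suc r)" and Guess = Guess])
    show "Ev \<subseteq> Om" using Ev by auto
    show ap: "apart s (P s) (far s u r) (B s u r) (- B s u (Suc r))" if "s \<in> Ev" for s
      by (rule apart_far) (use P[OF that] in \<open>auto simp: inner_def nontree_def\<close>)
    show "F \<le> card (choices (moves s (P s) (far s u r)) t)" if "s \<in> Ev" for s by (rule F[OF that])
    show "finite (Guess s) \<and> card (Guess s) \<le> ((r + 1) * v) ^ (2 * t) * (2 * t) ^ (2 * t)" for s
    proof
      let ?C = "choices (\<lambda>X. S s (set X)) (2 * t)"
      have fC: "finite ?C" by (rule finite_choices) (rule finS)
      show "finite (Guess s)" unfolding Guess_def
        using fC by (auto intro!: finite_lists_length_eq)
      have each: "card {zs. set zs \<subseteq> set D \<times> set D \<and> length zs = t} \<le> (2 * t) ^ (2 * t)" if "D \<in> ?C" for D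
      proof -
        have cs: "card (set D) \<le> 2 * t" using length_choices[OF that] card_length[of D] by linarith
        have "card (set D \<times> set D) \<le> (2 * t)\<^sup>2"
          unfolding card_cartesian_product power2_eq_square by (rule mult_le_mono[OF cs cs])
        then have "card (set D \<times> set D) ^ t \<le> ((2 * t)\<^sup>2) ^ t" by (rule power_mono) simp
        then show ?thesis by (simp add: card_lists_length_eq power_mult)
      qed
      have "card (Guess s) \<le> (\<Sum>D \<in> ?C. card {zs. set zs \<subseteq> set D \<times> set D \<and> length zs = t})"
        unfolding Guess_def by (rule card_UN_le[OF fC])
      also have "\<dots> \<le> (\<Sum>D \<in> ?C. (2 * t) ^ (2 * t))" by (rule sum_mono) (rule each)
      also have "\<dots> = card ?C * (2 * t) ^ (2 * t)" by simp
      also have "\<dots> \<le> ((r + 1) * v) ^ (2 * t) * (2 * t) ^ (2 * t)"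
        by (rule mult_le_mono1) (rule card_choices_le[OF finS cardS])
      finally show "card (Guess s) \<le> ((r + 1) * v) ^ (2 * t) * (2 * t) ^ (2 * t)" .
    qed
    show "darts1 s ms \<in> Guess (run ms s)" if s: "s \<in> Ev" and ms: "ms \<in> choices (moves s (P s) (far s u r)) t" for s ms
    proof -
      have s': "s \<in> Om" "vol (B s u r) \<le> v" using Ev[OF s] by auto
      define N where "N = (\<Union>(h, g) \<in> set ms. {h, sg s h})"
      note af = after_switching[OF s'(1) P[OF s] ms, folded N_def]
      define L where "L = map fst ms @ map (\<lambda>(h, g). sg s h) ms"
      define D where "D = rev (sort_key (\<lambda>d. depth s u (base d)) L)"
      have len: "length ms = t" using length_choices[OF ms] .
      have "set D = set L" by (simp add: D_def)
      also have "set L = N" by (force simp: L_def N_def)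
      finally have setD: "set D = N" .
      have sorted: "sorted (map (\<lambda>d. depth s u (base d)) (rev D))" unfolding D_def by simp
      have "D \<in> choices (\<lambda>X. S (run ms s) (set X)) (length D)"
      proof (rule choicesI)
        fix E d D' assume D': "D = E @ d # D'"
        let ?j = "depth s u (base d)"
        have dN: "d \<in> N" using D' setD by auto
        then have d: "d \<in> H" "base d \<in> B s u r" using af(2) by (auto simp: inner_def nontree_def)
        have jr: "?j \<le> r" by (rule depth_le[OF d(2)])
        have *: "?j \<le> depth s u (base e)" if "e \<in> set E" for e
          using sorted that unfolding D' by (auto simp: sorted_append)
        have "reach (run ms s) (set D') u ?j = B s u ?j"
        proof (rule af(5))
          show "set D' \<subseteq> N" using D' setD by auto
          fix e i assume e: "e \<in> N - set D'" "i < ?j"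
          then have "?j \<le> depth s u (base e)" using * D' setD by auto
          then show "base e \<notin> B s u i" using depth_le[of "base e" s u i] e(2) by auto
        qed (use jr in simp)
        moreover have "vol (B s u ?j) \<le> v" using vol_mono[OF reach_mono[OF jr]] s'(2) le_trans by blast
        ultimately show "d \<in> S (run ms s) (set D')"
          using d(1) in_depth[OF d(2)] jr unfolding S_def by (intro UN_I[of ?j]) auto
      qed
      moreover have "length D = 2 * t" by (simp add: D_def L_def len)
      ultimately have "D \<in> choices (\<lambda>X. S (run ms s) (set X)) (2 * t)" by simp
      moreover have "set (darts1 s ms) \<subseteq> set D \<times> set D" unfolding darts1_def setD N_def by force
      ultimately show ?thesis using len unfolding Guess_def by (auto simp: darts1_def)
    qed
  qed
qed

lemma inner_sg: "s \<in> Om \<Longrightarrow> h \<in> inner s u r \<Longrightarrow> sg s h \<in> inner s u r"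
  using nontree_sg[of s h u] sg_sg[of s h] by (auto simp: inner_def nontree_def)

lemma inner_H: "inner s u r \<subseteq> H"
  by (auto simp: inner_def nontree_def)

lemma many_inner_bound:
  assumes m: "card H = 2 * m"
    and Ev: "Ev \<subseteq> {s \<in> Om. 2 * b \<le> card (inner s u r) \<and> vol (B s u r) \<le> v \<and> vol (B s u (r + 2)) \<le> m}"
  shows "card Ev * ((b - 5 * t\<^sup>2) * (m div 2 - 5 * t\<^sup>2)) ^ t \<le> card Om * (((r + 1) * v) ^ (2 * t) * (2 * t) ^ (2 * t))"
proof (rule inner_bound[where P = "\<lambda>s _. {h \<in> inner s u r. h < sg s h}"])
  have Ev': "s \<in> Om" "2 * b \<le> card (inner s u r)" "vol (B s u (r + 2)) \<le> m" if "s \<in> Ev" for s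
    using that Ev by auto
  show "s \<in> Om \<and> vol (B s u r) \<le> v" if "s \<in> Ev" for s using that Ev by auto
  show "((b - 5 * t\<^sup>2) * (m div 2 - 5 * t\<^sup>2)) ^ t \<le> card (choices (moves s (\<lambda>_. {h \<in> inner s u r. h < sg s h}) (far s u r)) t)"
    if s: "s \<in> Ev" for s
  proof -
    let ?P = "{h \<in> inner s u r. h < sg s h}"
    note hf = half[OF Ev'(1)[OF s] inner_H inner_sg[OF Ev'(1)[OF s]]]
    have ap: "apart s (\<lambda>_. ?P) (far s u r) (B s u r) (- B s u (Suc r))"
      by (rule apart_far) (auto simp: inner_def nontree_def)
    have "b \<le> card ?P" using hf(1) Ev'(2)[OF s] by simp
    moreover have "m div 2 \<le> card (far s u r)" by (rule card_far'[OF Ev'(1)[OF s] m Ev'(3)[OF s]])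
    ultimately have "((b - 5 * t\<^sup>2) * (m div 2 - 5 * t\<^sup>2)) ^ t \<le> ((card ?P - 5 * t\<^sup>2) * (card (far s u r) - 5 * t\<^sup>2)) ^ t"
      by (intro power_mono mult_mono diff_le_mono) auto
    also have "\<dots> \<le> card (choices (moves s (\<lambda>_. ?P) (far s u r)) t)"
      by (rule card_sequences_ge[OF Ev'(1)[OF s] ap hf(2) far_disj[OF Ev'(1)[OF s]]])
    finally show ?thesis .
  qed
qed auto

text \<open>If both edges were direct with their ends at the same two vertices, they would be
parallel. So the edge that obeys the restriction of \<open>some_swap\<close> can be exchanged second, and
two non-tree edges suffice in the next bound.\<close>

lemma order_two_edges:
  assumes s: "s \<in> Om" and hk: "h \<in> H" "k \<in> H" "h \<noteq> k" "h \<noteq> sg s k"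
  shows "\<not> (dr s h \<and> {base h, base (sg s h)} \<subseteq> {base k, base (sg s k)}) \<or>
         \<not> (dr s k \<and> {base k, base (sg s k)} \<subseteq> {base h, base (sg s h)})"
proof (rule ccontr)
  assume "\<not> ?thesis"
  then have a: "dr s h" "dr s k" "{base h, base (sg s h)} \<subseteq> {base k, base (sg s k)}" by auto
  have "base h \<noteq> base (sg s h)" using dr_loop[OF s hk(1) a(1)] by auto
  then have "(base h = base k \<and> base (sg s h) = base (sg s k)) \<or> (base h = base (sg s k) \<and> base (sg s h) = base k)"
    using a(3) by auto
  then show False
    using dr_par[OF s hk(2,1) a(2,1)] dr_par[OF s sg_in[OF s hk(2)] hk(1)] dr_sg[OF s hk(2)] sg_sg[OF s hk(2)] a hk
    by auto
qed

lemma two_inner_bound: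
  assumes m: "card H = 2 * m"
    and Ev: "Ev \<subseteq> {s \<in> Om. 4 \<le> card (inner s u r) \<and> vol (B s u r) \<le> v \<and> vol (B s u (r + 2)) \<le> m}"
  shows "card Ev * (m div 2 - 20)\<^sup>2 \<le> card Om * (((r + 1) * v) ^ 4 * 4 ^ 4)"
proof -
  have Ev': "s \<in> Om" "4 \<le> card (inner s u r)" "vol (B s u (r + 2)) \<le> m" if "s \<in> Ev" for s
    using that Ev by auto
  have "\<exists>P. (\<forall>i. P i \<subseteq> inner s u r) \<and> (m div 2 - 20)\<^sup>2 \<le> card (choices (moves s P (far s u r)) 2)"
    if "s \<in> Ev" for s
  proof -
    note s = Ev'(1)[OF that]
    let ?P = "{h \<in> inner s u r. h < sg s h}"
    have "2 \<le> card ?P" using half(1)[OF s inner_H inner_sg[OF s], of u r] Ev'(2)[OF that] by simp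
    then obtain x y where xy: "x \<in> ?P" "y \<in> ?P" "x \<noteq> y"
      by (metis (no_types, lifting) One_nat_def card_le_Suc0_iff_eq card.infinite not_less_eq_eq numeral_2_eq_2 zero_le)
    have H: "x \<in> H" "y \<in> H" using xy inner_H by auto
    have ne: "x \<noteq> sg s y" "y \<noteq> sg s x"
    proof -
      have lt: "x < sg s x" "y < sg s y" using xy by auto
      have ss: "sg s (sg s x) = x" "sg s (sg s y) = y" using sg_sg[OF s] H by auto
      show "x \<noteq> sg s y"
      proof
        assume e: "x = sg s y"
        then have "sg s x = y" using ss(2) by simp
        then show False using lt less_asym[of x y] e by simp
      qed
      show "y \<noteq> sg s x"
      proof
        assume e: "y = sg s x"
        then have "sg s y = x" using ss(1) by simp
        then show False using lt less_asym[of x y] e by simp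
      qed
    qed
    obtain h k where hk: "h \<in> ?P" "k \<in> ?P" "h \<noteq> k" "k \<noteq> sg s h"
      and fine: "\<not> (dr s k \<and> {base k, base (sg s k)} \<subseteq> {base h, base (sg s h)})"
      using order_two_edges[OF s H xy(3) ne(1)] that[OF xy(2,1) xy(3)[symmetric] ne(1)] that[OF xy(1,2,3) ne(2)]
      by argo
    have hkH: "h \<in> H" "k \<in> H" using hk inner_H by auto
    define P where "P i = (if i = 0 then {h} else {k})" for i :: nat
    have Pin: "P i \<subseteq> inner s u r" for i using hk by (auto simp: P_def)
    have ap: "apart s P (far s u r) (B s u r) (- B s u (Suc r))"
      by (rule apart_far) (use hk in \<open>auto simp: P_def inner_def nontree_def split: if_splits\<close>)
    have Pd: "P i \<inter> sg s ` P i = {}" for i using sg_neq[OF s] hkH by (auto simp: P_def)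
    have Qm: "m div 2 \<le> card (far s u r)" by (rule card_far'[OF s m Ev'(3)[OF that]])
    have Q: "far s u r \<subseteq> H" by (auto simp: far_def)
    have "(m div 2 - 20) ^ 2 \<le> card (choices (moves s P (far s u r)) 2)"
    proof (rule card_choices_ge[OF finite_moves])
      fix n ms assume n: "n < 2" and ms: "ms \<in> choices (moves s P (far s u r)) n"
      have len: "length ms = n" using length_choices[OF ms] .
      note prs = run_pairs[OF s ap ms]
      have sub: "far s u r \<inter> touched s ms \<subseteq> (\<Union>x \<in> set ms. {snd x, sg s (snd x)})"
      proof
        fix q assume q: "q \<in> far s u r \<inter> touched s ms"
        then obtain a b where ab: "(a, b) \<in> set ms" "q \<in> {a, sg s a, b, sg s b}" by (auto simp: touched_def)
        have "base q \<notin> B s u r" using q reach_mono[of r "Suc r" s "{}" u] by (auto simp: far_def)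
        then have "q \<in> {b, sg s b}" using ab prs(3,4)[OF ab(1)] by auto
        then show "q \<in> (\<Union>x \<in> set ms. {snd x, sg s (snd x)})" by (intro UN_I[OF ab(1)]) simp
      qed
      have subH: "snd ` set ms \<subseteq> H" using prs(2) by auto
      let ?Q = "{h \<in> far s u r. h \<notin> touched s ms \<and> \<not> (dr s h \<and> base h \<in> ends2 s ms \<and> base (sg s h) \<in> ends2 s ms)}"
      have nle: "5 * n\<^sup>2 \<le> 20" using n by (cases n) auto
      have "m div 2 - 20 \<le> card (far s u r) - 5 * n\<^sup>2" using Qm nle by linarith
      also have "\<dots> \<le> card ?Q"
        using card_undisturbed_ge[OF s Q far_disj[OF s] sub subH ends_card(4,2)] len by simp
      finally have cQ: "m div 2 - 20 \<le> card ?Q" .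
      have "p \<notin> touched s ms \<and> \<not> (dr s p \<and> base p \<in> ends1 s ms \<and> base (sg s p) \<in> ends1 s ms)" if p: "p \<in> P n" for p
      proof (cases n)
        case 0 then show ?thesis using len by (simp add: touched_def ends1_def)
      next
        case (Suc n')
        then have n1: "n = 1" using n by simp
        then obtain a b where ab: "ms = [(a, b)]" "(a, b) \<in> moves s P (far s u r) []" using ms by auto
        have a: "a = h \<or> sg s a = h" "a \<in> H" using ab(2) by (auto simp: moves_def P_def)
        then have a': "{a, sg s a} = {h, sg s h}" using sg_sg[OF s a(2)] by auto
        have pk: "p = k" using p n1 by (simp add: P_def)
        have "base b \<notin> B s u (Suc r)" "base (sg s b) \<notin> B s u (Suc r)" using prs(5,6)[of a b] ab(1) by auto
        moreover have "base k \<in> B s u (Suc r)" using hk reach_mono[of r "Suc r" s "{}" u] by (auto simp: inner_def)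
        ultimately have "k \<notin> touched s ms" using hk a' by (auto simp: touched_def ab(1))
        moreover have "ends1 s ms = base ` {a, sg s a}" by (simp add: ends1_def ab(1))
        ultimately show ?thesis using fine pk unfolding a' by auto
      qed
      then have "card (P n) * card ?Q \<le> card (moves s P (far s u r) ms)"
        by (intro card_moves_ge[OF s ap ms Pd far_disj[OF s]]) auto
      then show "m div 2 - 20 \<le> card (moves s P (far s u r) ms)" using cQ by (simp add: P_def split: if_splits)
    qed
    then show ?thesis using Pin by blast
  qed
  then obtain P where P: "\<And>s. s \<in> Ev \<Longrightarrow> (\<forall>i. P s i \<subseteq> inner s u r) \<and> (m div 2 - 20)\<^sup>2 \<le> card (choices (moves s (P s) (far s u r)) 2)"
    by metis
  have "card Ev * (m div 2 - 20)\<^sup>2 \<le> card Om * (((r + 1) * v) ^ (2 * 2) * (2 * 2) ^ (2 * 2))"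
    by (rule inner_bound[where P = P]) (use P Ev in auto)
  then show ?thesis by simp
qed

end

section \<open>Union bound over the rare events\<close>

text \<open>The numerical conditions under which the union bound over all rare events succeeds: \<open>R\<close> is the
radius of the exploration, \<open>t\<close> the number of edges exchanged at once, and \<open>V1\<close> the volume up to which
the crude bounds are used.\<close>

definition suitable :: "nat \<Rightarrow> nat \<Rightarrow> nat \<Rightarrow> nat \<Rightarrow> bool" where
  "suitable m R t V1 \<longleftrightarrow> 200 \<le> m \<and> 1 \<le> t \<and> 600 * (real t)\<^sup>2 \<le> V1 / 25 \<and>
     V1 / 25 \<le> m / 5529600 \<and> t \<le> m / 5529600 \<and> m / 4 \<le> real (m div 2) - 5 * (real t)\<^sup>2 \<and>
     (\<exists>J i L. V1 < 3 * (17/15) ^ J \<and> m / 5529600 \<le> V1 / 25 * (17/15) ^ i \<and>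
        J + i + L + 2 \<le> R \<and> 1 < real L / 5529600) \<and>
     (real R + 1) ^ 7 * real V1 ^ 6 * (6 ^ 6 * 64) \<le> m \<and>
     2 * (real R + 1) * (2 * real m + 1) ^ 3 * (real m)\<^sup>2 \<le> 3 ^ t"

lemma card_UN_bound:
  assumes "finite I" "\<And>i. i \<in> I \<Longrightarrow> real (card (A i)) \<le> b"
  shows "real (card (\<Union>i \<in> I. A i)) \<le> real (card I) * b"
proof -
  have "real (card (\<Union>i \<in> I. A i)) \<le> real (\<Sum>i \<in> I. card (A i))"
    using card_UN_le[OF assms(1), of A] by linarith
  also have "\<dots> = (\<Sum>i \<in> I. real (card (A i)))" by simp
  also have "\<dots> \<le> (\<Sum>i \<in> I. b)" by (rule sum_mono) (rule assms(2))
  finally show ?thesis by simp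
qed

context switch_system
begin

declare reach.simps [simp del]

text \<open>Both brackets lose at most a constant factor against \<open>b\<close> and \<open>m\<close>, so that each exchange
gains a factor three.\<close>

lemma rare_if_many_switchings:
  assumes su: "suitable m R t V1" and b: "10 * t\<^sup>2 \<le> b" "24 * x \<le> b * m"
    and count: "e * ((b - 5 * t\<^sup>2) * (m div 2 - 5 * t\<^sup>2)) ^ t \<le> N * x ^ t"
  shows "real e \<le> real N / 3 ^ t"
proof -
  have t: "1 \<le> t" "m / 4 \<le> real (m div 2) - 5 * (real t)\<^sup>2" "0 < m" using su by (auto simp: suitable_def)
  have bt: "10 * (real t)\<^sup>2 \<le> real b" using of_nat_mono[OF b(1), where 'a = real] by simp
  have t2: "1 \<le> (real t)\<^sup>2" using t(1) by simp
  have "0 < real b * real m" using bt t2 t(3) by simp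
  then have pos: "0 < (real b * real m / 8) ^ t" by simp
  have b': "real b / 2 \<le> real (b - 5 * t\<^sup>2)"
  proof -
    have "5 * t\<^sup>2 \<le> b" using b(1) by linarith
    then have "real (b - 5 * t\<^sup>2) = real b - 5 * (real t)\<^sup>2" by (simp add: of_nat_diff)
    then show ?thesis using bt by linarith
  qed
  have m': "real m / 4 \<le> real (m div 2 - 5 * t\<^sup>2)"
  proof -
    have "real (m div 2) - real (5 * t\<^sup>2) \<le> real (m div 2 - 5 * t\<^sup>2)" by linarith
    then show ?thesis using t(2) by simp
  qed
  have "real e * (real b * real m / 8) ^ t \<le> real e * real ((b - 5 * t\<^sup>2) * (m div 2 - 5 * t\<^sup>2)) ^ t"
  proof (intro mult_left_mono power_mono)
    have "real b / 2 * (real m / 4) \<le> real (b - 5 * t\<^sup>2) * real (m div 2 - 5 * t\<^sup>2)"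
      by (intro mult_mono b' m') auto
    then show "real b * real m / 8 \<le> real ((b - 5 * t\<^sup>2) * (m div 2 - 5 * t\<^sup>2))" by simp
  qed auto
  also have "\<dots> \<le> real N * real x ^ t"
    using of_nat_mono[OF count, where 'a = real] by (simp only: of_nat_mult of_nat_power)
  also have "\<dots> \<le> real N * (real b * real m / 8 / 3) ^ t"
  proof (intro mult_left_mono power_mono)
    have "real (24 * x) \<le> real (b * m)" using b(2) of_nat_le_iff by blast
    then show "real x \<le> real b * real m / 8 / 3" by simp
  qed auto
  also have "\<dots> = real N / 3 ^ t * (real b * real m / 8) ^ t"
    by (subst power_divide[of "real b * real m / 8" 3 t]) (simp only: times_divide_eq_right times_divide_eq_left)
  finally show ?thesis by (rule mult_right_le_imp_le[OF _ pos])
qed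

lemma inside_rare:
  assumes m: "card H = 2 * m" and su: "suitable m R t V1"
    and big: "10 * t\<^sup>2 \<le> i" "24 * (k + 2 * t)\<^sup>2 \<le> i * m"
  shows "real (card {s \<in> Om. 2 * i \<le> card (inside s u r) \<and> card (out s u r) \<le> k \<and> vol (B s u (r + 2)) \<le> m})
    \<le> real (card Om) / 3 ^ t"
  by (rule rare_if_many_switchings[OF su big inside_bound[OF m order_refl]])

lemma collisions_rare:
  assumes m: "card H = 2 * m" and su: "suitable m R t V1"
    and big: "10 * t\<^sup>2 \<le> c" "48 * (k * (w + t)) \<le> c * m"
  shows "real (card {s \<in> Om. c \<le> card (collisions s u r) \<and> card (out s u r) \<le> k \<and>
      card (forward_darts s u r) \<le> w \<and> vol (B s u (r + 3)) \<le> m})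
    \<le> real (card Om) / 3 ^ t"
  by (rule rare_if_many_switchings[OF su big(1) _ collisions_bound[OF m order_refl]]) (use big(2) in simp)

lemma two_inner_rare:
  assumes m: "card H = 2 * m" and su: "suitable m R t V1" and r: "r \<le> 460"
  shows "real (card {s \<in> Om. 4 \<le> card (inner s u r) \<and> vol (B s u r) \<le> 460 \<and> vol (B s u (r + 2)) \<le> m})
    \<le> real (card Om) * ((461 * 460) ^ 4 * 4 ^ 6) / (real m)\<^sup>2" (is "real (card ?E) \<le> _")
proof -
  define E where "E = ?E"
  have m0: "200 \<le> m" using su by (simp add: suitable_def)
  have m': "real m / 4 \<le> real (m div 2 - 20)" using m0 by linarith
  have "real (card E) * (real m / 4)\<^sup>2 \<le> real (card E) * (real (m div 2 - 20))\<^sup>2"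
    by (intro mult_left_mono power_mono m') auto
  also have "\<dots> \<le> real (card Om * (((r + 1) * 460) ^ 4 * 4 ^ 4))"
    using of_nat_mono[OF two_inner_bound[OF m order_refl, of u r 460], where 'a = real] unfolding E_def by (simp only: of_nat_mult of_nat_power)
  also have "\<dots> \<le> real (card Om) * ((461 * 460) ^ 4 * 4 ^ 4)"
  proof -
    have "((r + 1) * 460) ^ 4 \<le> (461 * 460) ^ 4" using r by (intro power_mono mult_mono) auto
    then have "card Om * (((r + 1) * 460) ^ 4 * 4 ^ 4) \<le> card Om * ((461 * 460) ^ 4 * 4 ^ 4)"
      by (intro mult_le_mono) auto
    then have "real (card Om * (((r + 1) * 460) ^ 4 * 4 ^ 4)) \<le> real (card Om * ((461 * 460) ^ 4 * 4 ^ 4))"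
      by (rule of_nat_mono)
    then show ?thesis by simp
  qed
  finally show ?thesis unfolding E_def[symmetric] using m0 by (simp add: field_simps power2_eq_square)
qed

lemma many_inner_rare:
  assumes m: "card H = 2 * m" and su: "suitable m R t V1" and r: "r \<le> R"
  shows "real (card {s \<in> Om. 92 \<le> card (inner s u r) \<and> vol (B s u r) \<le> V1 \<and> vol (B s u (r + 2)) \<le> m})
    \<le> real (card Om) * (((real R + 1) * V1) ^ 6 * (6 ^ 6 * 64)) / (real m) ^ 3" (is "real (card ?E) \<le> _")
proof -
  define E where "E = ?E"
  have m0: "200 \<le> m" using su by (simp add: suitable_def)
  have m': "real m / 4 \<le> real (m div 2 - 45)" using m0 by linarith
  have "real (card E) * (real m / 4) ^ 3 \<le> real (card E) * (real (m div 2 - 45)) ^ 3"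
    by (intro mult_left_mono power_mono m') auto
  also have "\<dots> \<le> real (card Om * (((r + 1) * V1) ^ 6 * 6 ^ 6))"
  proof -
    have "card E * ((46 - 5 * 3\<^sup>2) * (m div 2 - 5 * 3\<^sup>2)) ^ 3 \<le> card Om * (((r + 1) * V1) ^ (2 * 3) * (2 * 3) ^ (2 * 3))"
      by (rule many_inner_bound[OF m]) (auto simp: E_def)
    then have "card E * (m div 2 - 45) ^ 3 \<le> card Om * (((r + 1) * V1) ^ 6 * 6 ^ 6)" by simp
    from of_nat_mono[OF this, where 'a = real] show ?thesis by (simp only: of_nat_mult of_nat_power)
  qed
  also have "\<dots> \<le> real (card Om) * (((real R + 1) * V1) ^ 6 * 6 ^ 6)"
  proof -
    have "((real r + 1) * V1) ^ 6 \<le> ((real R + 1) * V1) ^ 6" using r by (intro power_mono mult_mono) auto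
    then have "real (card Om) * (((real r + 1) * V1) ^ 6 * 6 ^ 6) \<le> real (card Om) * (((real R + 1) * V1) ^ 6 * 6 ^ 6)"
      by (intro mult_left_mono mult_right_mono) auto
    then show ?thesis by (simp only: of_nat_mult of_nat_power of_nat_add of_nat_1 of_nat_numeral)
  qed
  finally show ?thesis unfolding E_def[symmetric] using m0 by (simp add: field_simps power3_eq_cube)
qed

text \<open>Excluding the four kinds of rare events leaves nothing by \<open>no_growth_impossible\<close>. The events
with two inner non-tree edges dominate the sum. There are only \<open>461\<close> of them because the volume
grows by at least one in each layer, so that it can stay below \<open>461\<close> only in the first
\<open>461\<close> layers.\<close>

theorem slow_exploration_rare:
  assumes m: "card H = 2 * m" and su: "suitable m R t V1" and u: "u \<in> V"
  shows "real (card {s \<in> Om. vol (B s u R) \<le> m}) \<le>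
    real (card Om) * (461 * ((461 * 460) ^ 4 * 4 ^ 6) + 2) / (real m)\<^sup>2"
proof -
  let ?N = "real (card Om)"
  let ?M = "real m"
  define E2 where "E2 = (\<Union>j \<in> {..460::nat}. {s \<in> Om. 4 \<le> card (inner s u j) \<and> vol (B s u j) \<le> 460 \<and> vol (B s u (j + 2)) \<le> m})"
  define E3 where "E3 = (\<Union>j \<in> {..R}. {s \<in> Om. 92 \<le> card (inner s u j) \<and> vol (B s u j) \<le> V1 \<and> vol (B s u (j + 2)) \<le> m})"
  define XI where "XI = {..R} \<times> {(i, k). i \<le> 2 * m \<and> k \<le> 2 * m \<and> 10 * t\<^sup>2 \<le> i \<and> 24 * (k + 2 * t)\<^sup>2 \<le> i * m}"
  define EI where "EI = (\<Union>x \<in> XI. {s \<in> Om. 2 * fst (snd x) \<le> card (inside s u (fst x)) \<and> card (out s u (fst x)) \<le> snd (snd x) \<and> vol (B s u (fst x + 2)) \<le> m})"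
  define XC where "XC = {..R} \<times> {(c, k, w). c \<le> 2 * m \<and> k \<le> 2 * m \<and> w \<le> 2 * m \<and> 10 * t\<^sup>2 \<le> c \<and> 48 * (k * (w + t)) \<le> c * m}"
  define EC where "EC = (\<Union>x \<in> XC. {s \<in> Om. fst (snd x) \<le> card (collisions s u (fst x)) \<and>
     card (out s u (fst x)) \<le> fst (snd (snd x)) \<and> card (forward_darts s u (fst x)) \<le> snd (snd (snd x)) \<and> vol (B s u (fst x + 3)) \<le> m})"
  have m0: "200 \<le> m" using su by (simp add: suitable_def)
  have sub: "{s \<in> Om. vol (B s u R) \<le> m} \<subseteq> E2 \<union> E3 \<union> EI \<union> EC"
  proof (rule subsetI, rule ccontr)
    fix s assume s: "s \<in> {s \<in> Om. vol (B s u R) \<le> m}" and no: "s \<notin> E2 \<union> E3 \<union> EI \<union> EC"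
    have sO: "s \<in> Om" using s by simp
    have vm: "vol (B s u j) \<le> m" if "j \<le> R" for j
      using vol_mono[OF reach_mono[OF that]] s le_trans by blast
    have le2m: "card A \<le> 2 * m" if "A \<subseteq> H" for A using card_mono[OF finH that] m by simp
    have subs: "out s u j \<subseteq> H" "inside s u j \<subseteq> H" "collisions s u j \<subseteq> H" "forward_darts s u j \<subseteq> H" for j
      by (auto simp: out_def inside_def collisions_def forward_darts_def)
    obtain J i L where JiL: "V1 < 3 * (17/15) ^ J" "m / 5529600 \<le> V1 / 25 * (17/15) ^ i"
        "J + i + L + 2 \<le> R" "1 < real L / 5529600"
      using su by (auto simp: suitable_def)
    interpret growth "\<lambda>j. vol (B s u j)" "\<lambda>j. card (out s u j)" "\<lambda>j. card (inside s u j)"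
      "\<lambda>j. card (collisions s u j)" "\<lambda>j. card (inner s u j)" m t R "real V1" "1 / 5529600" "real V1 / 25" "\<lambda>j. width s u j"
    proof
      show "width s u j = card (inside s u j) + card (out s u j)" for j by (simp add: width_def)
      show "width s u 0 = vol (B s u 0)" by (rule width_0)
      show "3 \<le> vol (B s u 0)" using vol_ge[of "{u}"] u by (simp add: reach.simps)
      show "vol (B s u (Suc j)) = vol (B s u j) + card (out s u j) + width s u (Suc j)" for j
        by (rule vol_Suc[OF sO])
      show "2 * card (out s u j) \<le> width s u (Suc j) + 3 * card (collisions s u j)" for j
        by (rule out_width[OF sO u])
      show "vol (B s u j) + 6 \<le> 3 * card (out s u j) + 3 * card (inner s u j)" for j
        by (rule vol_le_out_inner[OF sO u])
      show "even (card (inner s u j))" for j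
        using half(1)[OF sO inner_H inner_sg[OF sO], of u j] by simp
      show "vol (B s u R) \<le> m" using s by simp
      show "card (inner s u j) < 4" if "j + 3 \<le> R" "j \<le> 460" "vol (B s u j) \<le> 460" for j
      proof (rule ccontr)
        assume "\<not> ?thesis"
        then have "s \<in> E2" unfolding E2_def using sO that vm[of "j + 2"] by (intro UN_I[of j]) auto
        then show False using no by simp
      qed
      show "card (inner s u j) < 92" if "j + 3 \<le> R" "real (vol (B s u j)) \<le> real V1" for j
      proof (rule ccontr)
        assume "\<not> ?thesis"
        then have "s \<in> E3" unfolding E3_def using sO that vm[of "j + 2"] by (intro UN_I[of j]) auto
        then show False using no by simp
      qed
      show "card (inside s u j) * m < 48 * (card (out s u j) + 2 * t)\<^sup>2"
        if j: "j + 3 \<le> R" and b: "20 * t\<^sup>2 \<le> card (inside s u j)" for j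
      proof (rule ccontr)
        assume a: "\<not> ?thesis"
        obtain i where i: "card (inside s u j) = 2 * i"
          using half(1)[OF sO subs(2) inside_sg[OF sO], of j] by blast
        have "(j, i, card (out s u j)) \<in> XI"
          using a b i j le2m[OF subs(1), of j] le2m[OF subs(2), of j] by (auto simp: XI_def)
        then have "s \<in> EI" unfolding EI_def using sO i vm[of "j + 2"] j by (intro UN_I[of "(j, i, card (out s u j))"]) auto
        then show False using no by simp
      qed
      show "card (collisions s u j) * m < 48 * (card (out s u j) * (width s u (Suc j) + t))"
        if j: "j + 3 \<le> R" and b: "10 * t\<^sup>2 \<le> card (collisions s u j)" for j
      proof (rule ccontr)
        assume a: "\<not> ?thesis"
        let ?x = "(j, card (collisions s u j), card (out s u j), card (forward_darts s u j))"
        have "?x \<in> XC"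
          using a b j le2m[OF subs(1), of j] le2m[OF subs(3), of j] le2m[OF subs(4), of j] card_forward_darts[OF sO, of u j]
          by (auto simp: XC_def)
        then have "s \<in> EC" unfolding EC_def using sO vm[of "j + 3"] j by (intro UN_I[of ?x]) auto
        then show False using no by simp
      qed
    qed (use su in \<open>auto simp: suitable_def\<close>)
    show False by (rule no_growth_impossible[of J i L]) (use JiL m0 in auto)
  qed
  have fin: "finite E2" "finite E3" "finite EI" "finite EC"
    using finOm by (auto simp: E2_def E3_def EI_def EC_def intro: finite_subset[of _ Om])
  have "card {s \<in> Om. vol (B s u R) \<le> m} \<le> card (E2 \<union> E3 \<union> EI \<union> EC)"
    by (rule card_mono[OF _ sub]) (use fin in simp)
  also have "\<dots> \<le> card E2 + card E3 + card EI + card EC"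
    using card_Un_le[of "E2 \<union> E3 \<union> EI" EC] card_Un_le[of "E2 \<union> E3" EI] card_Un_le[of E2 E3] by linarith
  finally have total: "real (card {s \<in> Om. vol (B s u R) \<le> m}) \<le> real (card E2) + card E3 + card EI + card EC"
    by linarith
  have c2: "real (card E2) \<le> real (card {..460::nat}) * (?N * ((461 * 460) ^ 4 * 4 ^ 6) / ?M\<^sup>2)"
    unfolding E2_def by (rule card_UN_bound) (use two_inner_rare[OF m su] in auto)
  have c3: "real (card E3) \<le> real (card {..R}) * (?N * (((real R + 1) * V1) ^ 6 * (6 ^ 6 * 64)) / ?M ^ 3)"
    unfolding E3_def by (rule card_UN_bound) (use many_inner_rare[OF m su] in auto)
  have c3': "real (card E3) \<le> ?N / ?M\<^sup>2"
  proof -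
    have "real (card {..R}) * (?N * (((real R + 1) * V1) ^ 6 * (6 ^ 6 * 64)) / ?M ^ 3) =
        ?N * ((real R + 1) ^ 7 * real V1 ^ 6 * (6 ^ 6 * 64)) / ?M ^ 3"
    proof -
      have "a * (n * ((a * v) ^ 6 * c) / d) = n * (a ^ 7 * v ^ 6 * c) / d" for a n v c d :: real
        using power_Suc[of a 6] by (simp add: power_mult_distrib mult_ac)
      moreover have "real (card {..R}) = real R + 1" by simp
      ultimately show ?thesis by (simp only:)
    qed
    also have "\<dots> \<le> ?N * ?M / ?M ^ 3"
      by (intro divide_right_mono mult_left_mono) (use su in \<open>auto simp: suitable_def\<close>)
    also have "\<dots> = ?N / ?M\<^sup>2" using m0 by (simp add: power3_eq_cube power2_eq_square)
    finally show ?thesis using c3 by linarith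
  qed
  have XIf: "XI \<subseteq> {..R} \<times> {..2 * m} \<times> {..2 * m}" by (auto simp: XI_def)
  have XCf: "XC \<subseteq> {..R} \<times> {..2 * m} \<times> {..2 * m} \<times> {..2 * m}" by (auto simp: XC_def)
  have fX: "finite XI" "finite XC" by (rule finite_subset[OF XIf], simp) (rule finite_subset[OF XCf], simp)
  have XIc: "real (card XI) \<le> (real R + 1) * (2 * ?M + 1) ^ 2"
  proof -
    have "card XI \<le> card ({..R} \<times> {..2 * m} \<times> {..2 * m})" by (rule card_mono[OF _ XIf]) simp
    then have "real (card XI) \<le> real ((R + 1) * ((2 * m + 1) * (2 * m + 1)))"
      unfolding card_cartesian_product by (intro of_nat_mono) simp
    then show ?thesis by (simp only: power2_eq_square of_nat_mult of_nat_add of_nat_1 of_nat_numeral)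
  qed
  have XCc: "real (card XC) \<le> (real R + 1) * (2 * ?M + 1) ^ 3"
  proof -
    have "card XC \<le> card ({..R} \<times> {..2 * m} \<times> {..2 * m} \<times> {..2 * m})" by (rule card_mono[OF _ XCf]) simp
    then have "real (card XC) \<le> real ((R + 1) * ((2 * m + 1) * ((2 * m + 1) * (2 * m + 1))))"
      unfolding card_cartesian_product by (intro of_nat_mono) simp
    then show ?thesis by (simp only: power3_eq_cube of_nat_mult of_nat_add of_nat_1 of_nat_numeral mult.assoc)
  qed
  have cI: "real (card EI) \<le> real (card XI) * (?N / 3 ^ t)"
    unfolding EI_def
    by (rule card_UN_bound[OF fX(1)]) (use inside_rare[OF m su] in \<open>auto simp: XI_def\<close>)
  have cC: "real (card EC) \<le> real (card XC) * (?N / 3 ^ t)"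
    unfolding EC_def
    by (rule card_UN_bound[OF fX(2)]) (use collisions_rare[OF m su] in \<open>auto simp: XC_def\<close>)
  have "(2 * ?M + 1) ^ 2 \<le> (2 * ?M + 1) ^ 3" by (rule power_increasing) auto
  then have "real (card XI) + real (card XC) \<le> 2 * (real R + 1) * (2 * ?M + 1) ^ 3"
    using XIc XCc mult_left_mono[of "(2 * ?M + 1) ^ 2" "(2 * ?M + 1) ^ 3" "real R + 1"] by linarith
  then have "(real (card XI) + real (card XC)) * ?M\<^sup>2 \<le> 2 * (real R + 1) * (2 * ?M + 1) ^ 3 * ?M\<^sup>2"
    by (rule mult_right_mono) simp
  also have "\<dots> \<le> 3 ^ t" using su by (simp add: suitable_def)
  finally have q: "(real (card XI) + real (card XC)) / 3 ^ t \<le> 1 / ?M\<^sup>2"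
    using m0 by (simp add: field_simps)
  have "real (card EI) + real (card EC) \<le> ?N * ((real (card XI) + real (card XC)) / 3 ^ t)"
    using cI cC by (simp add: field_simps)
  also have "\<dots> \<le> ?N * (1 / ?M\<^sup>2)" by (rule mult_left_mono[OF q]) simp
  finally have cIC: "real (card EI) + real (card EC) \<le> ?N / ?M\<^sup>2" by simp
  have "?N * (461 * ((461 * 460) ^ 4 * 4 ^ 6) + 2) / ?M\<^sup>2 =
     461 * (?N * ((461 * 460) ^ 4 * 4 ^ 6) / ?M\<^sup>2) + ?N / ?M\<^sup>2 + ?N / ?M\<^sup>2"
    by (simp add: field_simps)
  then show ?thesis using total c2 c3' cIC by simp
qed

end

section \<open>Choice of the parameters\<close>

lemma exp_le_power3: "exp (y :: real) \<le> 3 ^ nat \<lceil>y\<rceil>"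
proof -
  have "exp y \<le> exp (real (nat \<lceil>y\<rceil>) * 1)" by (simp add: real_nat_ceiling_ge)
  also have "\<dots> = exp 1 ^ nat \<lceil>y\<rceil>" by (rule exp_of_nat_mult)
  also have "\<dots> \<le> 3 ^ nat \<lceil>y\<rceil>" by (rule power_mono[OF exp_le]) simp
  finally show ?thesis .
qed

lemma exp_le_power_17_15: "exp (y :: real) \<le> (17/15) ^ (9 * nat \<lceil>y\<rceil>)"
proof -
  have "(3::real) \<le> (17/15) ^ 9" by (simp add: eval_nat_numeral)
  then have "(3::real) ^ nat \<lceil>y\<rceil> \<le> ((17/15) ^ 9) ^ nat \<lceil>y\<rceil>" by (rule power_mono) simp
  then show ?thesis using exp_le_power3[of y] by (simp add: power_mult)
qed

text \<open>The choice is \<open>R \<approx> 15 ln m\<close>, \<open>t \<approx> 6 ln m\<close> and \<open>V1 \<approx> m powr (1 / 12)\<close>. As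
\<open>(17 / 15) ^ 9 \<ge> 3\<close> exceeds the base of the natural logarithm, \<open>9 ln m\<close> layers of exponential growth suffice, which leaves
room for the constant number of layers at the end.\<close>

lemma suitable_exists:
  "\<exists>m0 > 0. \<forall>m \<ge> m0. \<exists>R t V1. suitable m R t V1 \<and> 2 * real R < 31 * ln (real m)"
proof -
  have "eventually (\<lambda>x::real. 200 \<le> x \<and> 1 < ln x \<and>
      600 * (6 * ln x + 1)\<^sup>2 \<le> (x powr (1/12) - 1) / 25 \<and>
      x powr (1/12) / 25 \<le> x / 5529600 \<and>
      6 * ln x + 1 \<le> x / 5529600 \<and>
      x / 4 \<le> (x - 1) / 2 - 5 * (6 * ln x + 1)\<^sup>2 \<and>
      9 * (ln x / 12 + 1) + 9 * (11 / 12 * ln x + 1) + 6000000 \<le> 15 * ln x - 1 \<and>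
      (15 * ln x + 1) ^ 7 * (x powr (1/12)) ^ 6 * 3000000 \<le> x \<and>
      2 * (15 * ln x + 1) * (2 * x + 1) ^ 3 * x\<^sup>2 \<le> x ^ 6 \<and>
      x / 5529600 \<le> (x powr (1/12) - 1) / 25 * x powr (11/12)) at_top"
    by (intro eventually_conj; real_asymp)
  then obtain x0 :: real where x0: "\<And>x. x0 \<le> x \<Longrightarrow> 200 \<le> x \<and> 1 < ln x \<and>
      600 * (6 * ln x + 1)\<^sup>2 \<le> (x powr (1/12) - 1) / 25 \<and>
      x powr (1/12) / 25 \<le> x / 5529600 \<and>
      6 * ln x + 1 \<le> x / 5529600 \<and>
      x / 4 \<le> (x - 1) / 2 - 5 * (6 * ln x + 1)\<^sup>2 \<and>
      9 * (ln x / 12 + 1) + 9 * (11 / 12 * ln x + 1) + 6000000 \<le> 15 * ln x - 1 \<and>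
      (15 * ln x + 1) ^ 7 * (x powr (1/12)) ^ 6 * 3000000 \<le> x \<and>
      2 * (15 * ln x + 1) * (2 * x + 1) ^ 3 * x\<^sup>2 \<le> x ^ 6 \<and>
      x / 5529600 \<le> (x powr (1/12) - 1) / 25 * x powr (11/12)"
    unfolding eventually_at_top_linorder by blast
  have "\<exists>R t V1. suitable m R t V1 \<and> 2 * real R < 31 * ln (real m)" if m: "m \<ge> nat \<lceil>x0\<rceil> + 1" for m
  proof -
    define x where "x = real m"
    have "x0 \<le> x" using m unfolding x_def by linarith
    note E = x0[OF this]
    define R t V1 where "R = nat \<lfloor>15 * ln x\<rfloor>" and "t = nat \<lceil>6 * ln x\<rceil>" and "V1 = nat \<lfloor>x powr (1/12)\<rfloor>"
    have x: "200 \<le> x" "1 < ln x" using E by auto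
    have R: "15 * ln x - 1 \<le> real R" "real R \<le> 15 * ln x" using x unfolding R_def by linarith+
    have t: "6 * ln x \<le> real t" "real t \<le> 6 * ln x + 1" using x unfolding t_def by linarith+
    have p: "0 \<le> x powr (1/12)" by simp
    have V1: "x powr (1/12) - 1 \<le> real V1" "real V1 \<le> x powr (1/12)" using p unfolding V1_def by linarith+
    have t2: "(real t)\<^sup>2 \<le> (6 * ln x + 1)\<^sup>2" using t by (intro power_mono) auto
    have 1: "600 * (real t)\<^sup>2 \<le> V1 / 25"
    proof -
      have "600 * (real t)\<^sup>2 \<le> 600 * (6 * ln x + 1)\<^sup>2" using t2 by (rule mult_left_mono) simp
      also have "\<dots> \<le> (x powr (1/12) - 1) / 25" using E by blast
      also have "\<dots> \<le> V1 / 25" using V1 by (simp add: divide_right_mono)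
      finally show ?thesis .
    qed
    have 2: "V1 / 25 \<le> m / 5529600" using E V1 unfolding x_def[symmetric] by linarith
    have 3: "t \<le> m / 5529600" using E t unfolding x_def[symmetric] by linarith
    have "(x - 1) / 2 \<le> real q" if "m \<le> 2 * q + 1" for q
      using of_nat_mono[OF that, where 'a = real] unfolding x_def by simp
    from this[of "m div 2"] have "(x - 1) / 2 \<le> real (m div 2)" by simp
    then have 4: "m / 4 \<le> real (m div 2) - 5 * (real t)\<^sup>2"
      using E t2 unfolding x_def[symmetric] by linarith
    define J i where "J = 9 * nat \<lceil>ln x / 12\<rceil>" and "i = 9 * nat \<lceil>11 / 12 * ln x\<rceil>"
    have eJ: "x powr (1/12) \<le> (17/15) ^ J"
      using exp_le_power_17_15[of "ln x / 12"] x unfolding J_def by (simp add: powr_def mult.commute)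
    have ei: "x powr (11/12) \<le> (17/15) ^ i"
      using exp_le_power_17_15[of "11 / 12 * ln x"] x unfolding i_def by (simp add: powr_def)
    have cl: "real (nat \<lceil>y\<rceil>) \<le> y + 1" if "0 \<le> y" for y :: real using that by linarith
    have Jb: "real J \<le> 9 * (ln x / 12 + 1)" unfolding J_def of_nat_mult of_nat_numeral
      by (rule mult_left_mono[OF cl]) (use x in simp_all)
    have ib: "real i \<le> 9 * (11 / 12 * ln x + 1)" unfolding i_def of_nat_mult of_nat_numeral
      by (rule mult_left_mono[OF cl]) (use x in simp_all)
    have 5: "V1 < 3 * (17/15) ^ J"
    proof -
      have "0 < (17/15 :: real) ^ J" by simp
      then show ?thesis using V1 eJ by linarith
    qed
    have 6: "m / 5529600 \<le> V1 / 25 * (17/15) ^ i"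
    proof -
      have "(x powr (1/12) - 1) / 25 * x powr (11/12) \<le> V1 / 25 * (17/15) ^ i"
        using V1 by (intro mult_mono divide_right_mono ei) auto
      then show ?thesis using E unfolding x_def[symmetric] by linarith
    qed
    have E6: "9 * (ln x / 12 + 1) + 9 * (11 / 12 * ln x + 1) + 6000000 \<le> 15 * ln x - 1" using E by blast
    have "real (J + i + 5529601 + 2) = real J + real i + 5529603" by simp
    then have "real (J + i + 5529601 + 2) \<le> real R" using E6 Jb ib R by linarith
    then have 7: "J + i + 5529601 + 2 \<le> R" unfolding of_nat_le_iff .
    have 8: "(real R + 1) ^ 7 * real V1 ^ 6 * (6 ^ 6 * 64) \<le> m"
    proof -
      have "(real R + 1) ^ 7 * real V1 ^ 6 * (6 ^ 6 * 64) \<le> (15 * ln x + 1) ^ 7 * (x powr (1/12)) ^ 6 * 3000000"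
        using R V1 x by (intro mult_mono power_mono) auto
      then show ?thesis using E unfolding x_def[symmetric] by linarith
    qed
    have 9: "2 * (real R + 1) * (2 * real m + 1) ^ 3 * (real m)\<^sup>2 \<le> 3 ^ t"
    proof -
      have "2 * (real R + 1) * (2 * x + 1) ^ 3 * x\<^sup>2 \<le> 2 * (15 * ln x + 1) * (2 * x + 1) ^ 3 * x\<^sup>2"
        using R x by (intro mult_right_mono) auto
      also have "\<dots> \<le> x ^ 6" using E by blast
      also have "x ^ 6 = exp (6 * ln x)" using exp_of_nat_mult[of 6 "ln x"] x by simp
      also have "\<dots> \<le> 3 ^ t" unfolding t_def by (rule exp_le_power3)
      finally show ?thesis by (simp add: x_def)
    qed
    have t1: "1 \<le> t" using t x by linarith
    have "suitable m R t V1" unfolding suitable_def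
    proof (intro conjI)
      show "\<exists>J i L. V1 < 3 * (17/15) ^ J \<and> m / 5529600 \<le> V1 / 25 * (17/15) ^ i \<and>
        J + i + L + 2 \<le> R \<and> 1 < real L / 5529600"
        using 5 6 7 by (intro exI[of _ J] exI[of _ i] exI[of _ 5529601]) auto
      show "200 \<le> m" using x(1) unfolding x_def by linarith
    qed (rule t1 1 2 3 4 8 9)+
    moreover have "2 * real R < 31 * ln (real m)" using R x unfolding x_def by linarith
    ultimately show ?thesis by blast
  qed
  then show ?thesis by (intro exI[of _ "nat \<lceil>x0\<rceil> + 1"]) auto
qed

section \<open>Kernel edges as paths\<close>

definition nbr :: "nat set set \<Rightarrow> nat \<Rightarrow> nat set" where
  "nbr E v = {w. {v, w} \<in> E}"

text \<open>A kernel edge as a path of the graph: kernel vertices are those that are at most \<open>n\<close>, and the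
last condition says that the path does not turn back.\<close>

definition kpath :: "nat \<Rightarrow> nat set set \<Rightarrow> nat list \<Rightarrow> bool" where
  "kpath n E p \<longleftrightarrow> 2 \<le> length p \<and> p ! 0 \<le> n \<and> p ! (length p - 1) \<le> n \<and>
     (\<forall>i. 0 < i \<and> i < length p - 1 \<longrightarrow> n < p ! i) \<and>
     (\<forall>i. Suc i < length p \<longrightarrow> {p ! i, p ! Suc i} \<in> E) \<and>
     (\<forall>i. Suc (Suc i) < length p \<longrightarrow> p ! i \<noteq> p ! Suc (Suc i))"

locale subdivided =
  fixes n l :: nat and E :: "nat set set"
  assumes edge: "e \<in> E \<Longrightarrow> e \<subseteq> {1..l} \<and> card e = 2"
    and deg2: "n < x \<Longrightarrow> x \<le> l \<Longrightarrow> card (nbr E x) = 2"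
begin

lemma edgeD: "{x, y} \<in> E \<Longrightarrow> x \<noteq> y \<and> x \<in> {1..l} \<and> y \<in> {1..l}"
  using edge[of "{x, y}"] by (auto simp: card_insert_if split: if_splits)

lemma other_nbr:
  assumes "n < x" "{x, a} \<in> E" "{x, b} \<in> E" "a \<noteq> b" "{x, c} \<in> E"
  shows "c = a \<or> c = b"
proof (rule ccontr)
  assume "\<not> ?thesis"
  then have "card {a, b, c} = 3" using assms(4) by auto
  moreover have "{a, b, c} \<subseteq> nbr E x" using assms by (auto simp: nbr_def)
  moreover have "card (nbr E x) = 2" using deg2 assms(1) edgeD[OF assms(2)] by auto
  ultimately show False using card_mono[of "nbr E x" "{a, b, c}"] by (simp add: card_ge_0_finite)
qed

lemma ex_other_nbr:
  assumes "n < x" "{x, a} \<in> E"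
  shows "\<exists>b. {x, b} \<in> E \<and> b \<noteq> a"
proof (rule ccontr)
  assume "\<not> ?thesis"
  then have "nbr E x \<subseteq> {a}" by (auto simp: nbr_def)
  then have "card (nbr E x) \<le> 1" using card_mono[of "{a}" "nbr E x"] by simp
  then show False using deg2 assms(1) edgeD[OF assms(2)] by auto
qed

text \<open>At a vertex of degree two the walk has no choice. If it met itself at such a vertex, then following
both visits backwards, or one backwards and the other one forwards, would lead to the start, to a
turning point, or to a loop.\<close>

lemma walk_inj:
  assumes f0: "f 0 \<le> n" and int: "\<And>k. 1 \<le> k \<Longrightarrow> k \<le> K \<Longrightarrow> n < f k"
    and e: "\<And>k. k < K \<Longrightarrow> {f k, f (Suc k)} \<in> E"
    and nb: "\<And>k. Suc (Suc k) \<le> K \<Longrightarrow> f k \<noteq> f (Suc (Suc k))"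
  shows "1 \<le> i \<Longrightarrow> i < j \<Longrightarrow> j \<le> K \<Longrightarrow> f i \<noteq> f j"
proof (induction j arbitrary: i)
  case (Suc j)
  show ?case
  proof
    assume eq: "f i = f (Suc j)"
    obtain i' where i': "i = Suc i'" using Suc.prems(1) by (cases i) auto
    have ij: "i \<noteq> j" using eq e[of j] Suc.prems edgeD[of "f j" "f (Suc j)"] by auto
    then have ij: "i < j" using Suc.prems by simp
    have "n < f i" using int Suc.prems by simp
    moreover have "{f i, f i'} \<in> E" using e[of i'] Suc.prems i' by (simp add: insert_commute)
    moreover have "{f i, f (Suc i)} \<in> E" using e[of i] Suc.prems by simp
    moreover have "f i' \<noteq> f (Suc i)" using nb[of i'] Suc.prems i' by simp
    moreover have "{f i, f j} \<in> E" using e[of j] Suc.prems eq by (simp add: insert_commute)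
    ultimately consider "f j = f i'" | "f j = f (Suc i)" using other_nbr by blast
    then show False
    proof cases
      case 1
      show False
      proof (cases "i' = 0")
        case True
        then show False using 1 f0 int[of j] Suc.prems ij by simp
      next
        case False
        then show False using Suc.IH[of i'] 1 i' ij Suc.prems by simp
      qed
    next
      case 2
      show False
      proof (cases "Suc i = j")
        case True
        then show False using nb[of i] eq Suc.prems by simp
      next
        case False
        then show False using Suc.IH[of "Suc i"] 2 ij Suc.prems by simp
      qed
    qed
  qed
qed simp

lemma kpath_internal_inj:
  assumes p: "kpath n E p" and "1 \<le> i" "i < j" "j < length p - 1"
  shows "p ! i \<noteq> p ! j"
  by (rule walk_inj[of "\<lambda>i. p ! i" "length p - 2"]) (use assms in \<open>auto simp: kpath_def\<close>)

lemma kpath_unique: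
  assumes p: "kpath n E p" and q: "kpath n E q" and eq: "p ! 0 = q ! 0" "p ! 1 = q ! 1"
  shows "p = q"
proof -
  have *: "p ! i = q ! i" if "i < length p" "i < length q" for i
    using that
  proof (induction i rule: less_induct)
    case (less i)
    consider "i = 0" | "i = 1" | j where "i = Suc (Suc j)" by (metis One_nat_def not0_implies_Suc)
    then show ?case
    proof cases
      case 3
      then have IH: "p ! j = q ! j" "p ! Suc j = q ! Suc j" using less by auto
      have "n < p ! Suc j" "{p ! Suc j, p ! j} \<in> E" "{p ! Suc j, p ! i} \<in> E" "p ! j \<noteq> p ! i"
        "{q ! Suc j, q ! i} \<in> E" "q ! j \<noteq> q ! i"
        using p q less.prems 3 by (auto simp: kpath_def insert_commute)
      then show ?thesis using other_nbr[of "p ! Suc j" "p ! j" "p ! i" "q ! i"] IH by auto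
    qed (use eq in auto)
  qed
  have lens: "2 \<le> length p" "2 \<le> length q" using p q by (auto simp: kpath_def)
  have int: "0 < i \<Longrightarrow> i < length p - 1 \<Longrightarrow> n < p ! i" "0 < i \<Longrightarrow> i < length q - 1 \<Longrightarrow> n < q ! i" for i
    using p q by (auto simp: kpath_def)
  have "length p = length q"
  proof (rule ccontr)
    assume "length p \<noteq> length q"
    then consider "length p < length q" | "length q < length p" by linarith
    then show False
    proof cases
      case 1
      have "p ! (length p - 1) = q ! (length p - 1)" by (rule *) (use lens 1 in auto)
      moreover have "n < q ! (length p - 1)" by (rule int(2)) (use lens 1 in auto)
      ultimately show False using p by (simp add: kpath_def)
    next
      case 2
      have "p ! (length q - 1) = q ! (length q - 1)" by (rule *) (use lens 2 in auto)
      moreover have "n < p ! (length q - 1)" by (rule int(1)) (use lens 2 in auto)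
      ultimately show False using q by (simp add: kpath_def)
    qed
  qed
  then show ?thesis using * by (auto intro: nth_equalityI)
qed

text \<open>By \<open>walk_inj\<close> a walk that never returned to the kernel would visit infinitely many vertices.\<close>

lemma kpath_exists:
  assumes v: "v \<le> n" and vw: "{v, w} \<in> E"
  shows "\<exists>p. kpath n E p \<and> p ! 0 = v \<and> p ! 1 = w"
proof -
  define step where "step = (\<lambda>(x, y). (y, SOME z. {y, z} \<in> E \<and> z \<noteq> x))"
  define f where "f k = fst ((step ^^ k) (v, w))" for k
  have snd: "snd ((step ^^ k) (v, w)) = f (Suc k)" for k
    by (simp add: f_def step_def case_prod_unfold)
  have f0: "f 0 = v" "f 1 = w" by (auto simp: f_def step_def)
  have fS: "f (Suc (Suc k)) = (SOME z. {f (Suc k), z} \<in> E \<and> z \<noteq> f k)" for k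
    using snd[of k] by (simp add: f_def step_def case_prod_unfold)
  have ok: "{f k, f (Suc k)} \<in> E \<and> (\<forall>j. k = Suc j \<longrightarrow> f j \<noteq> f (Suc k))"
    if "\<And>j. 1 \<le> j \<Longrightarrow> j \<le> k \<Longrightarrow> n < f j" for k
    using that
  proof (induction k)
    case 0 then show ?case using f0 vw by simp
  next
    case (Suc k)
    then have "{f (Suc k), f k} \<in> E" "n < f (Suc k)" by (simp_all add: insert_commute)
    then have "\<exists>z. {f (Suc k), z} \<in> E \<and> z \<noteq> f k" using ex_other_nbr by blast
    from someI_ex[OF this] show ?case using fS[of k] by simp
  qed
  have "\<exists>k \<ge> 1. f k \<le> n"
  proof (rule ccontr)
    assume "\<not> ?thesis"
    then have int: "n < f k" if "1 \<le> k" for k using that not_le by blast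
    have okE: "{f k, f (Suc k)} \<in> E" for k using ok[OF int] by blast
    have okN: "f k \<noteq> f (Suc (Suc k))" for k using ok[of "Suc k", OF int] by blast
    have inj: "inj_on f {1..l + 1}"
    proof (rule linorder_inj_onI)
      fix i j assume ij: "i < j" "i \<in> {1..l + 1}" "j \<in> {1..l + 1}"
      show "f i \<noteq> f j"
      proof (rule walk_inj[of f "l + 1"])
        show "f 0 \<le> n" using f0 v by simp
      qed (use ij in \<open>auto intro: int okE simp: okN\<close>)
    qed auto
    have "f ` {1..l + 1} \<subseteq> {1..l}" using edgeD[OF okE] by blast
    then have "card (f ` {1..l + 1}) \<le> card {1..l}" by (rule card_mono[rotated]) simp
    then show False using card_image[OF inj] by simp
  qed
  then obtain k0 where k0: "1 \<le> k0" "f k0 \<le> n" by blast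
  define k where "k = (LEAST k. 1 \<le> k \<and> f k \<le> n)"
  have k: "1 \<le> k" "f k \<le> n" unfolding k_def using LeastI[of "\<lambda>k. 1 \<le> k \<and> f k \<le> n"] k0 by auto
  have int: "n < f j" if "1 \<le> j" "j < k" for j
    using not_less_Least[of j "\<lambda>k. 1 \<le> k \<and> f k \<le> n"] that unfolding k_def by auto
  define p where "p = map f [0..<Suc k]"
  have len: "length p = Suc k" by (simp add: p_def)
  have nth: "p ! i = f i" if "i \<le> k" for i using that by (simp add: p_def nth_map_upt del: upt_Suc)
  have "kpath n E p"
    unfolding kpath_def len
  proof (intro conjI allI impI)
    fix i assume "Suc i < Suc k"
    then show "{p ! i, p ! Suc i} \<in> E" using ok[of i] int by (simp add: nth)
  next
    fix i assume i: "Suc (Suc i) < Suc k"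
    then have "{f (Suc i), f (Suc (Suc i))} \<in> E \<and> (\<forall>j. Suc i = Suc j \<longrightarrow> f j \<noteq> f (Suc (Suc i)))"
      by (intro ok) (use int in auto)
    then show "p ! i \<noteq> p ! Suc (Suc i)" using i by (simp add: nth)
  qed (use k int f0 v in \<open>auto simp: nth\<close>)
  moreover have "p ! 0 = v" "p ! 1 = w" using f0 k by (simp_all add: nth)
  ultimately show ?thesis by blast
qed

lemma kpath_rev:
  assumes p: "kpath n E p"
  shows "kpath n E (rev p)"
proof -
  have len: "2 \<le> length p" using p by (simp add: kpath_def)
  have e: "{p ! i, p ! Suc i} \<in> E" if "Suc i < length p" for i using p that by (simp add: kpath_def)
  have nb: "p ! i \<noteq> p ! Suc (Suc i)" if "Suc (Suc i) < length p" for i using p that by (simp add: kpath_def)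
  show ?thesis unfolding kpath_def length_rev
  proof (intro conjI allI impI)
    fix i assume i: "Suc i < length p"
    have "{p ! (length p - Suc (Suc i)), p ! Suc (length p - Suc (Suc i))} \<in> E" by (rule e) (use i in simp)
    moreover have "Suc (length p - Suc (Suc i)) = length p - Suc i" using i by simp
    ultimately show "{rev p ! i, rev p ! Suc i} \<in> E" using i by (simp add: rev_nth insert_commute)
  next
    fix i assume i: "Suc (Suc i) < length p"
    have "p ! (length p - Suc (Suc (Suc i))) \<noteq> p ! Suc (Suc (length p - Suc (Suc (Suc i))))" by (rule nb) (use i in simp)
    moreover have "Suc (Suc (length p - Suc (Suc (Suc i)))) = length p - Suc i" using i by simp
    ultimately show "rev p ! i \<noteq> rev p ! Suc (Suc i)" using i by (simp add: rev_nth)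
  next
    fix i assume i: "0 < i \<and> i < length p - 1"
    have int: "n < p ! k" if "0 < k" "k < length p - 1" for k using p that by (simp add: kpath_def)
    have "n < p ! (length p - Suc i)" by (rule int) (use i in auto)
    moreover have "i < length p" using i by linarith
    ultimately show "n < rev p ! i" by (simp add: rev_nth)
  next
    have "rev p ! 0 = p ! (length p - 1)" "rev p ! (length p - 1) = p ! 0"
    proof -
      have "p \<noteq> []" "length p - 1 < length p" using len by auto
      then show "rev p ! 0 = p ! (length p - 1)" "rev p ! (length p - 1) = p ! 0"
        using rev_nth[of 0 p] rev_nth[of "length p - 1" p] by simp_all
    qed
    then show "rev p ! 0 \<le> n" "rev p ! (length p - 1) \<le> n" using p by (simp_all add: kpath_def)
  qed (rule len)
qed

lemma kpath_not_palindrome: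
  assumes p: "kpath n E p"
  shows "rev p \<noteq> p"
proof
  assume r: "rev p = p"
  have len: "2 \<le> length p" using p by (simp add: kpath_def)
  have sym: "p ! i = p ! (length p - Suc i)" if "i < length p" for i
    using rev_nth[OF that] r by simp
  show False
  proof (cases "even (length p)")
    case True
    then obtain k where k: "length p = 2 * k" by blast
    obtain k' where k': "k = Suc k'" using len k by (cases k) auto
    have "p ! k' = p ! Suc k'" using sym[of k'] k k' by simp
    moreover have "{p ! k', p ! Suc k'} \<in> E" using p k k' by (simp add: kpath_def)
    ultimately show False using edgeD by auto
  next
    case False
    then obtain k where k: "length p = 2 * k + 1" using oddE by blast
    obtain k' where k': "k = Suc k'" using len k by (cases k) auto
    have "p ! k' = p ! Suc (Suc k')" using sym[of k'] k k' by simp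
    moreover have "p ! k' \<noteq> p ! Suc (Suc k')" using p k k' by (simp add: kpath_def)
    ultimately show False by simp
  qed
qed

end

lemma set_of_two: "card e = 2 \<Longrightarrow> \<exists>x y. e = {x, y} \<and> x \<noteq> y"
  by (simp add: card_2_iff)

section \<open>Labelled graphs\<close>

lemma rev_ends:
  assumes "2 \<le> length p"
  shows "rev p ! 0 = p ! (length p - 1)" "rev p ! 1 = p ! (length p - 2)"
    "rev p ! (length p - 1) = p ! 0" "rev p ! (length p - 2) = p ! 1"
proof -
  have "0 < length p" "1 < length p" "length p - 1 < length p" "length p - 2 < length p" using assms by linarith+
  moreover have "length p - Suc (length p - 2) = 1" "length p - Suc (length p - 1) = 0" "length p - Suc 1 = length p - 2"
    using assms by linarith+
  ultimately show "rev p ! 0 = p ! (length p - 1)" "rev p ! 1 = p ! (length p - 2)"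
    "rev p ! (length p - 1) = p ! 0" "rev p ! (length p - 2) = p ! 1"
    using rev_nth[of 0 p] rev_nth[of 1 p] rev_nth[of "length p - 1" p] rev_nth[of "length p - 2" p] by auto
qed

lemma deg_eq_card_nbr:
  assumes "\<And>e. e \<in> E \<Longrightarrow> card e = 2"
  shows "deg \<lparr>verts = W, edges = E\<rparr> v = card (nbr E v)"
proof -
  have "{e \<in> E. v \<in> e} = (\<lambda>w. {v, w}) ` nbr E v"
  proof
    show "{e \<in> E. v \<in> e} \<subseteq> (\<lambda>w. {v, w}) ` nbr E v"
    proof clarify
      fix e assume e: "e \<in> E" "v \<in> e"
      then obtain x y where xy: "e = {x, y}" using set_of_two assms by blast
      then have "e = {v, if v = x then y else x}" using e(2) by auto
      then show "e \<in> (\<lambda>w. {v, w}) ` nbr E v" using e(1) by (auto simp: nbr_def)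
    qed
  qed (auto simp: nbr_def)
  moreover have "inj_on (\<lambda>w. {v, w}) (nbr E v)" by (auto simp: inj_on_def doubleton_eq_iff)
  ultimately show ?thesis by (simp add: deg_def card_image)
qed

text \<open>The darts are the numbers below \<open>2 * m\<close>, and \<open>base\<close> distributes them over the kernel
vertices according to the degrees.\<close>

locale degrees =
  fixes n l m :: nat and d :: "nat \<Rightarrow> nat" and base :: "nat \<Rightarrow> nat"
  assumes n_l: "n \<le> l" and d3: "v \<in> {1..n} \<Longrightarrow> 3 \<le> d v" and d2: "v \<in> {n<..l} \<Longrightarrow> d v = 2"
    and base: "h < 2 * m \<Longrightarrow> base h \<in> {1..n}"
    and fiber: "v \<in> {1..n} \<Longrightarrow> card {h \<in> {..<2 * m}. base h = v} = d v"
begin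

abbreviation "H \<equiv> {..<2 * m}"

definition graph_of :: "nat set set \<Rightarrow> nat ugraph" where
  "graph_of E = \<lparr>verts = {1..l}, edges = E\<rparr>"

definition good :: "nat set set \<Rightarrow> bool" where
  "good E \<longleftrightarrow> graph_of E \<in> graphs_minus l d"

text \<open>A labelling assigns to each dart the first vertex of its kernel edge, seen from its base. Darts at
the same vertex get distinct neighbours because the graph is simple.\<close>

definition labels :: "nat set set \<Rightarrow> (nat \<Rightarrow> nat) set" where
  "labels E = {lam \<in> extensional H. \<forall>v \<in> {1..n}. bij_betw lam {h \<in> H. base h = v} (nbr E v)}"

definition Om :: "(nat set set \<times> (nat \<Rightarrow> nat)) set" where
  "Om = {(E, lam). good E \<and> lam \<in> labels E}"

text \<open>The path \<open>p\<close> is the kernel edge that starts at dart \<open>h\<close> and arrives at dart \<open>h'\<close>.\<close>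

definition leads :: "nat set set \<times> (nat \<Rightarrow> nat) \<Rightarrow> nat \<Rightarrow> nat list \<Rightarrow> nat \<Rightarrow> bool" where
  "leads s h p h' \<longleftrightarrow> h \<in> H \<and> h' \<in> H \<and> kpath n (fst s) p \<and> p ! 0 = base h \<and> p ! 1 = snd s h \<and>
     p ! (length p - 1) = base h' \<and> p ! (length p - 2) = snd s h'"

definition sg :: "nat set set \<times> (nat \<Rightarrow> nat) \<Rightarrow> nat \<Rightarrow> nat" where
  "sg s h = (SOME h'. \<exists>p. leads s h p h')"

definition dr :: "nat set set \<times> (nat \<Rightarrow> nat) \<Rightarrow> nat \<Rightarrow> bool" where
  "dr s h \<longleftrightarrow> snd s h \<le> n"

lemma good_edge: "good E \<Longrightarrow> e \<in> E \<Longrightarrow> e \<subseteq> {1..l} \<and> card e = 2"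
  by (auto simp: good_def graphs_minus_def graph_of_def simple_graph_def)

lemma good_card_nbr: "good E \<Longrightarrow> v \<in> {1..l} \<Longrightarrow> card (nbr E v) = d v"
  using deg_eq_card_nbr[of E "{1..l}" v] good_edge[of E]
  by (auto simp: good_def graphs_minus_def graph_of_def)

lemma good_subdivided: "good E \<Longrightarrow> subdivided n l E"
  using good_edge[of E] good_card_nbr[of E] d2 unfolding subdivided_def by auto

lemma lam_nbr: "(E, lam) \<in> Om \<Longrightarrow> h \<in> H \<Longrightarrow> {base h, lam h} \<in> E"
proof -
  assume a: "(E, lam) \<in> Om" "h \<in> H"
  then have "bij_betw lam {k \<in> H. base k = base h} (nbr E (base h))"
    using base[of h] by (auto simp: Om_def labels_def)
  then have "lam h \<in> nbr E (base h)" by (rule bij_betw_apply) (use a in auto)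
  then show ?thesis by (simp add: nbr_def)
qed

lemma lam_inj: "(E, lam) \<in> Om \<Longrightarrow> h \<in> H \<Longrightarrow> k \<in> H \<Longrightarrow> base h = base k \<Longrightarrow> lam h = lam k \<Longrightarrow> h = k"
proof -
  assume a: "(E, lam) \<in> Om" "h \<in> H" "k \<in> H" "base h = base k" "lam h = lam k"
  then have "inj_on lam {j \<in> H. base j = base h}"
    using base[of h] by (auto simp: Om_def labels_def bij_betw_def)
  then show ?thesis by (rule inj_onD) (use a in auto)
qed

lemma lam_surj:
  assumes "(E, lam) \<in> Om" "v \<in> {1..n}" "{v, w} \<in> E"
  shows "\<exists>h \<in> H. base h = v \<and> lam h = w"
proof -
  have eq: "lam ` {h \<in> H. base h = v} = nbr E v" using assms by (auto simp: Om_def labels_def bij_betw_def)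
  have "w \<in> lam ` {h \<in> H. base h = v}" unfolding eq using assms(3) by (simp add: nbr_def)
  then show ?thesis by blast
qed

lemma leads_exists:
  assumes s: "s \<in> Om" and h: "h \<in> H"
  shows "\<exists>p h'. leads s h p h'"
proof -
  obtain E lam where s': "s = (E, lam)" by fastforce
  have g: "good E" using s s' by (simp add: Om_def)
  interpret subdivided n l E by (rule good_subdivided[OF g])
  have e: "{base h, lam h} \<in> E" using lam_nbr s s' h by blast
  have "base h \<le> n" using base h by auto
  then obtain p where p: "kpath n E p" "p ! 0 = base h" "p ! 1 = lam h" using kpath_exists[OF _ e] by blast
  have len: "2 \<le> length p" using p by (simp add: kpath_def)
  have "{p ! (length p - 2), p ! Suc (length p - 2)} \<in> E" using p(1) len by (simp add: kpath_def)
  moreover have "Suc (length p - 2) = length p - 1" using len by simp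
  ultimately have e': "{p ! (length p - 1), p ! (length p - 2)} \<in> E" by (simp add: insert_commute)
  have "p ! (length p - 1) \<in> {1..n}" using edgeD[OF e'] p(1) by (simp add: kpath_def)
  then obtain h' where "h' \<in> H" "base h' = p ! (length p - 1)" "lam h' = p ! (length p - 2)"
    using lam_surj[OF _ _ e'] s s' by blast
  then show ?thesis using p h s' unfolding leads_def by force
qed

lemma leads_unique:
  assumes s: "s \<in> Om" and "leads s h p h'" "leads s h q k'"
  shows "p = q \<and> h' = k'"
proof -
  obtain E lam where s': "s = (E, lam)" by fastforce
  have g: "good E" using s s' by (simp add: Om_def)
  interpret subdivided n l E by (rule good_subdivided[OF g])
  have "p = q" using kpath_unique[of p q] assms(2,3) s' by (simp add: leads_def)
  then show ?thesis using lam_inj[of E lam h' k'] s s' assms(2,3) by (auto simp: leads_def)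
qed

lemma sg_eq: "s \<in> Om \<Longrightarrow> leads s h p h' \<Longrightarrow> sg s h = h'"
  unfolding sg_def using leads_unique by (intro some_equality) blast+

lemma leads_sg: "s \<in> Om \<Longrightarrow> h \<in> H \<Longrightarrow> \<exists>p. leads s h p (sg s h)"
  using leads_exists sg_eq by blast

lemma leads_rev:
  assumes s: "s \<in> Om" and p: "leads s h p h'"
  shows "leads s h' (rev p) h"
proof -
  obtain E lam where s': "s = (E, lam)" by fastforce
  have g: "good E" using s s' by (simp add: Om_def)
  interpret subdivided n l E by (rule good_subdivided[OF g])
  have len: "2 \<le> length p" using p by (simp add: leads_def kpath_def)
  have "kpath n E (rev p)" using kpath_rev p s' by (simp add: leads_def)
  moreover have "rev p ! 0 = p ! (length p - 1)" "rev p ! 1 = p ! (length p - 2)"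
    "rev p ! (length p - 1) = p ! 0" "rev p ! (length p - 2) = p ! 1"
    using rev_ends[OF len] by auto
  ultimately show ?thesis using p s' by (simp add: leads_def)
qed

lemma direct_path:
  assumes s: "s \<in> Om" and p: "leads s h p h'"
  shows "dr s h \<longleftrightarrow> length p = 2"
proof -
  have k: "kpath n (fst s) p" and p1: "p ! 1 = snd s h" using p by (auto simp: leads_def)
  show ?thesis
  proof
    assume "dr s h"
    then have "\<not> n < p ! 1" using p1 by (simp add: dr_def)
    then have "\<not> 1 < length p - 1" using k unfolding kpath_def by auto
    moreover have "2 \<le> length p" using k by (simp add: kpath_def)
    ultimately show "length p = 2" by linarith
  next
    assume "length p = 2"
    then have "p ! (length p - 1) = p ! 1" by simp
    then show "dr s h" using k p1 by (simp add: kpath_def dr_def)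
  qed
qed

lemma direct_end:
  assumes s: "s \<in> Om" and h: "h \<in> H" "dr s h"
  shows "base (sg s h) = snd s h" "snd s (sg s h) = base h"
proof -
  obtain p where p: "leads s h p (sg s h)" using leads_sg[OF s h(1)] by blast
  then have "length p = 2" using direct_path[OF s p] h by simp
  then show "base (sg s h) = snd s h" "snd s (sg s h) = base h" using p by (auto simp: leads_def)
qed

lemma sg_H: "s \<in> Om \<Longrightarrow> h \<in> H \<Longrightarrow> sg s h \<in> H"
  using leads_sg[of s h] by (auto simp: leads_def)

lemma sg_sg: "s \<in> Om \<Longrightarrow> h \<in> H \<Longrightarrow> sg s (sg s h) = h"
  using leads_sg[of s h] leads_rev sg_eq by blast

lemma finite_Om: "finite Om"
proof (rule finite_subset)
  show "Om \<subseteq> Pow (Pow {1..l}) \<times> PiE H (\<lambda>_. {1..l})"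
  proof (rule subsetI)
    fix s assume "s \<in> Om"
    moreover obtain E lam where s': "s = (E, lam)" by fastforce
    ultimately have s: "(E, lam) \<in> Om" by simp
    then have g: "good E" by (simp add: Om_def)
    interpret subdivided n l E by (rule good_subdivided[OF g])
    have "lam h \<in> {1..l}" if "h \<in> H" for h using edgeD[OF lam_nbr[OF s that]] by simp
    moreover have "lam \<in> extensional H" using s by (simp add: Om_def labels_def)
    ultimately have "lam \<in> PiE H (\<lambda>_. {1..l})" by (auto simp: PiE_def)
    moreover have "E \<subseteq> Pow {1..l}" using good_edge[OF g] by auto
    ultimately show "s \<in> Pow (Pow {1..l}) \<times> PiE H (\<lambda>_. {1..l})" using s' by auto
  qed
qed (auto intro: finite_PiE)

sublocale dart_system H "{1..n}" base Om sg dr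
proof
  fix s h assume s: "s \<in> Om" and h: "h \<in> H"
  obtain E lam where s': "s = (E, lam)" by fastforce
  have g: "good E" using s s' by (simp add: Om_def)
  interpret subdivided n l E by (rule good_subdivided[OF g])
  show "sg s h \<in> H" "sg s (sg s h) = h" using sg_H[OF s h] sg_sg[OF s h] by auto
  obtain p where p: "leads s h p (sg s h)" using leads_sg[OF s h] by blast
  note q = leads_rev[OF s p]
  show "sg s h \<noteq> h"
  proof
    assume "sg s h = h"
    then have "leads s h p h" "leads s h (rev p) h" using p q by auto
    then have "rev p = p" using leads_unique[OF s] by blast
    then show False using kpath_not_palindrome p s' by (auto simp: leads_def)
  qed
  show "dr s (sg s h) = dr s h" using direct_path[OF s p] direct_path[OF s q] by simp
  show "base (sg s h) \<noteq> base h" if "dr s h"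
    using direct_end(1)[OF s h that] edgeD[OF lam_nbr[OF s[unfolded s'] h]] s' by auto
  show "k = h" if "k \<in> H" "dr s h" "dr s k" "base k = base h" "base (sg s k) = base (sg s h)" for k
    using direct_end(1)[OF s h that(2)] direct_end(1)[OF s that(1,3)] that lam_inj[OF s[unfolded s'] that(1) h] s' by auto
qed (use base fiber d3 finite_Om in auto)

end

section \<open>Exchanging two darts of a labelled graph\<close>

text \<open>Hence all vertices of a cycle component have degree two, and no such component contains a kernel vertex.\<close>

lemma card_edges_at_cycle:
  assumes vs: "distinct vs" "3 \<le> length vs" and x: "x \<in> set vs"
  shows "card {e \<in> {{vs ! i, vs ! (Suc i mod length vs)} |i. i < length vs}. x \<in> e} \<le> 2"
proof -
  let ?e = "\<lambda>i. {vs ! i, vs ! (Suc i mod length vs)}"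
  obtain i0 where i0: "i0 < length vs" "x = vs ! i0" using x by (auto simp: in_set_conv_nth)
  define i1 where "i1 = (if i0 = 0 then length vs - 1 else i0 - 1)"
  have "{e \<in> {?e i |i. i < length vs}. x \<in> e} \<subseteq> ?e ` {i0, i1}"
  proof clarify
    fix i assume i: "i < length vs" and "x \<in> ?e i" 
    then consider "vs ! i0 = vs ! i" | "vs ! i0 = vs ! (Suc i mod length vs)" using i0 by auto
    then have "i = i0 \<or> i = i1"
    proof cases
      case 1
      then show ?thesis using vs(1) i i0 nth_eq_iff_index_eq by blast
    next
      case 2
      have "Suc i mod length vs < length vs" using i by (intro mod_less_divisor) linarith
      then have "i0 = Suc i mod length vs" using 2 vs(1) i0(1) nth_eq_iff_index_eq by blast
      then show ?thesis using i by (cases "Suc i = length vs") (auto simp: i1_def)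
    qed
    then show "?e i \<in> ?e ` {i0, i1}" by blast
  qed
  then have "card {e \<in> {?e i |i. i < length vs}. x \<in> e} \<le> card (?e ` {i0, i1})"
    by (rule card_mono[rotated]) simp
  also have "\<dots> \<le> card {i0, i1}" by (rule card_image_le) simp
  also have "\<dots> \<le> 2" by (simp add: card_insert_if)
  finally show ?thesis .
qed

lemma bij_betw_upd:
  assumes "bij_betw f A B" "x \<in> A" "b \<notin> B"
  shows "bij_betw (f(x := b)) A (insert b (B - {f x}))"
proof -
  have inj: "inj_on f A" and im: "f ` A = B" using assms(1) by (auto simp: bij_betw_def)
  have *: "f z \<noteq> b" if "z \<in> A" for z using assms(3) im that by blast
  have "inj_on (f(x := b)) A" using inj * by (auto simp: inj_on_def)
  moreover have "(f(x := b)) ` A = insert b (f ` (A - {x}))" using assms(2) by auto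
  moreover have "f ` (A - {x}) = B - {f x}" using inj im assms(2) by (auto simp: inj_on_def)
  ultimately show ?thesis by (simp add: bij_betw_def)
qed

context degrees
begin

text \<open>An exchange of two graph edges. The label changes at \<open>h\<close> and \<open>g\<close>, and also at the other end of
a direct edge, because the neighbour recorded there is the kernel vertex that has been replaced.\<close>

definition sw :: "nat \<Rightarrow> nat \<Rightarrow> nat set set \<times> (nat \<Rightarrow> nat) \<Rightarrow> nat set set \<times> (nat \<Rightarrow> nat)" where
  "sw h g s = (fst s - {{base h, snd s h}, {base g, snd s g}} \<union> {{base h, snd s g}, {base g, snd s h}},
     \<lambda>k. if k = h then snd s g else if k = g then snd s h
       else if dr s h \<and> k = sg s h then base g else if dr s g \<and> k = sg s g then base h else snd s k)"

lemma swappable_sym: "swappable s h g \<Longrightarrow> swappable s g h"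
  unfolding swappable_def by auto

lemma sw_sym:
  assumes "s \<in> Om" "swappable s h g"
  shows "sw h g s = sw g h s"
proof -
  have "h \<noteq> g" "h \<in> H" "g \<in> H" using assms(2) by (auto simp: swappable_def)
  then have "sg s h \<noteq> sg s g" using sg_sg[OF assms(1)] by metis
  then show ?thesis using \<open>h \<noteq> g\<close> unfolding sw_def by (auto simp: insert_commute)
qed

lemma good_no_cycle: "good E \<Longrightarrow> v \<in> {1..l} \<Longrightarrow> \<not> is_cycle (component_of (graph_of E) v)"
  by (auto simp: good_def graphs_minus_def graph_components_def graph_of_def)

context
  fixes E :: "nat set set" and lam :: "nat \<Rightarrow> nat" and h g y p a q :: nat and s E' lam'
  defines "s \<equiv> (E, lam)" and "y \<equiv> base h" and "a \<equiv> base g" and "p \<equiv> lam h" and "q \<equiv> lam g"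
    and "E' \<equiv> fst (sw h g (E, lam))" and "lam' \<equiv> snd (sw h g (E, lam))"
  assumes s: "s \<in> Om" and sw: "swappable s h g"
begin

interpretation subdivided n l E
  by (rule good_subdivided) (use s in \<open>simp add: Om_def s_def\<close>)

lemma E'_eq: "E' = E - {{y, p}, {a, q}} \<union> {{y, q}, {a, p}}"
  by (simp add: E'_def sw_def y_def p_def a_def q_def)

lemma lam'_eq: "lam' k = (if k = h then q else if k = g then p
       else if dr s h \<and> k = sg s h then a else if dr s g \<and> k = sg s g then y else lam k)"
  by (simp only: lam'_def sw_def snd_conv y_def p_def a_def q_def s_def)

lemma hg: "h \<in> H" "g \<in> H" "y \<noteq> a" "base (sg s h) \<noteq> a" "base (sg s g) \<noteq> y" "h \<noteq> g"
  using sw by (auto simp: swappable_def y_def a_def)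

lemma old_edges: "{y, p} \<in> E" "{a, q} \<in> E"
  using lam_nbr[of E lam] s hg by (auto simp: s_def y_def p_def a_def q_def)

lemma y_a_n: "y \<le> n" "a \<le> n" "y \<in> {1..n}" "a \<in> {1..n}"
  using base hg by (auto simp: y_def a_def)

lemma dr_h: "dr s h \<longleftrightarrow> p \<le> n" and dr_g: "dr s g \<longleftrightarrow> q \<le> n"
  by (auto simp: dr_def s_def p_def q_def)

lemma dr_h': "dr s h \<Longrightarrow> base (sg s h) = p" "dr s h \<Longrightarrow> lam (sg s h) = y"
  and dr_g': "dr s g \<Longrightarrow> base (sg s g) = q" "dr s g \<Longrightarrow> lam (sg s g) = a"
  using direct_end[OF s] hg by (auto simp: s_def p_def q_def y_def a_def)

text \<open>A kernel edge with exactly one interior vertex.\<close>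

lemma path3: 
  assumes "k \<in> H" "base k = x" "lam k = z" "n < z" "{z, w} \<in> E" "w \<noteq> x" "w \<le> n"
  shows "base (sg s k) = w"
proof -
  have e: "{x, z} \<in> E" using lam_nbr[of E lam k] s assms by (simp add: s_def)
  have x: "x \<le> n" using base assms by auto
  have kp: "kpath n E [x, z, w]" using assms e x
    by (auto simp: kpath_def less_Suc_eq numeral_2_eq_2 nth_Cons split: nat.splits)
  obtain P where P: "leads s k P (sg s k)" using leads_sg[OF s assms(1)] by blast
  then have "P = [x, z, w]"
    using kpath_unique[of P "[x, z, w]"] kp assms by (simp add: leads_def s_def)
  then show ?thesis using P by (simp add: leads_def)
qed

text \<open>All degenerate cases lead to a double edge or to kernel edges between the wrong vertices, which
\<open>swappable\<close> excludes.\<close>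

lemma dist4: "y \<noteq> p" "a \<noteq> q" "p \<noteq> a" "q \<noteq> y" "p \<noteq> q" "{y, q} \<notin> E" "{a, p} \<notin> E"
proof -
  show "y \<noteq> p" "a \<noteq> q" using edgeD[OF old_edges(1)] edgeD[OF old_edges(2)] by auto
  show pa: "p \<noteq> a" using dr_h dr_h' y_a_n hg by auto
  show qy: "q \<noteq> y" using dr_g dr_g' y_a_n hg by auto
  show "{y, q} \<notin> E"
  proof
    assume e: "{y, q} \<in> E"
    show False
    proof (cases "q \<le> n")
      case True
      then have drg: "dr s g" using dr_g by simp
      obtain k where k: "k \<in> H" "base k = y" "lam k = q" using lam_surj[of E lam y q] s e y_a_n by (auto simp: s_def)
      have drk: "dr s k" using k True by (simp add: dr_def s_def)
      have "base (sg s k) = base (sg s g)" using direct_end(1)[OF s k(1) drk] dr_g'(1)[OF drg] k by (simp add: s_def)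
      then show False using sw drg drk k by (auto simp: swappable_def y_def)
    next
      case False
      then have "base (sg s g) = y"
        using path3[of g a q y] hg e y_a_n by (simp add: a_def q_def insert_commute)
      then show False using hg by simp
    qed
  qed
  show "{a, p} \<notin> E"
  proof
    assume e: "{a, p} \<in> E"
    show False
    proof (cases "p \<le> n")
      case True
      then have drh: "dr s h" using dr_h by simp
      obtain k where k: "k \<in> H" "base k = a" "lam k = p" using lam_surj[of E lam a p] s e y_a_n by (auto simp: s_def)
      have drk: "dr s k" using k True by (simp add: dr_def s_def)
      have "base (sg s k) = base (sg s h)" using direct_end(1)[OF s k(1) drk] dr_h'(1)[OF drh] k by (simp add: s_def)
      then show False using sw drh drk k by (auto simp: swappable_def a_def)
    next
      case False
      then have "base (sg s h) = a"
        using path3[of h y p a] hg e y_a_n by (simp add: y_def p_def insert_commute)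
      then show False using hg by simp
    qed
  qed
  then show "p \<noteq> q" using old_edges by auto
qed

lemma nbr_E': "nbr E' x = (if x = y then insert q (nbr E y - {p}) else if x = a then insert p (nbr E a - {q})
    else if x = p then insert a (nbr E p - {y}) else if x = q then insert y (nbr E q - {a}) else nbr E x)"
  using dist4(1-5) hg(3) unfolding nbr_def E'_eq by (auto simp: doubleton_eq_iff)

lemma finite_nbr: "finite (nbr E x)"
proof (rule finite_subset)
  show "nbr E x \<subseteq> {1..l}" using edgeD by (auto simp: nbr_def simp del: atLeastAtMost_iff)
qed simp

lemma nbr_mem: "q \<notin> nbr E y" "p \<notin> nbr E a" "a \<notin> nbr E p" "y \<notin> nbr E q"
  "p \<in> nbr E y" "q \<in> nbr E a" "y \<in> nbr E p" "a \<in> nbr E q"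
  using dist4(6,7) old_edges insert_commute[of p a "{}"] insert_commute[of q y "{}"]
    insert_commute[of p y "{}"] insert_commute[of q a "{}"]
  unfolding nbr_def mem_Collect_eq by simp_all

lemma card_nbr_E': "card (nbr E' x) = card (nbr E x)"
proof -
  have *: "card (insert b (A - {c})) = card A" if "finite A" "b \<notin> A" "c \<in> A" for A :: "nat set" and b c
  proof -
    have "card (insert b (A - {c})) = Suc (card (A - {c}))" using that by simp
    also have "\<dots> = card A" by (rule card_Suc_Diff1[OF that(1,3)])
    finally show ?thesis .
  qed
  show ?thesis unfolding nbr_E'
    using *[OF finite_nbr nbr_mem(1,5)] *[OF finite_nbr nbr_mem(2,6)]
      *[OF finite_nbr nbr_mem(3,7)] *[OF finite_nbr nbr_mem(4,8)] by simp
qed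

lemma edges_E':
  assumes "e \<in> E'"
  shows "e \<subseteq> {1..l} \<and> card e = 2"
proof -
  consider "e \<in> E" | "e = {y, q}" | "e = {a, p}" using assms unfolding E'_eq by blast
  then show ?thesis
  proof cases
    case 1 then show ?thesis by (rule edge)
  next
    case 2 then show ?thesis using edgeD[OF old_edges(1)] edgeD[OF old_edges(2)] dist4(4) by simp
  next
    case 3 then show ?thesis using edgeD[OF old_edges(1)] edgeD[OF old_edges(2)] dist4(3) by simp
  qed
qed

text \<open>A cycle component of the new graph contains no kernel vertex, hence none of the vertices involved in the
exchange. So it is a component of the old graph as well.\<close>

lemma no_cycle_E':
  assumes v: "v \<in> {1..l}"
  shows "\<not> is_cycle (component_of (graph_of E') v)"
proof
  assume cyc: "is_cycle (component_of (graph_of E') v)"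
  have gE: "good E" using s by (simp add: Om_def s_def)
  define S where "S = (adj (graph_of E'))\<^sup>* `` {v}"
  have comp: "component_of (graph_of E') v = \<lparr>verts = S, edges = {e \<in> E'. e \<subseteq> S}\<rparr>"
    by (simp add: component_of_def S_def Let_def graph_of_def)
  have vS: "v \<in> S" by (simp add: S_def)
  have closed: "w \<in> S" if "x \<in> S" "{x, w} \<in> E'" for x w
    using that unfolding S_def by (auto simp: adj_def graph_of_def intro: rtrancl_into_rtrancl)
  have deg2S: "card (nbr E x) \<le> 2" if x: "x \<in> S" for x
  proof -
    obtain vs where vs: "distinct vs" "3 \<le> length vs" "S = set vs"
      "{e \<in> E'. e \<subseteq> S} = {{vs ! i, vs ! (Suc i mod length vs)} |i. i < length vs}"
      using cyc unfolding comp is_cycle_def by auto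
    have "{e \<in> E'. x \<in> e} = {e \<in> {e \<in> E'. e \<subseteq> S}. x \<in> e}"
    proof -
      have "e \<subseteq> S" if e: "e \<in> E'" "x \<in> e" for e
      proof -
        obtain b c where bc: "e = {b, c}" using set_of_two edges_E'[OF e(1)] by blast
        then show ?thesis using e closed[of x b] closed[of x c] x by (auto simp: insert_commute)
      qed
      then show ?thesis by blast
    qed
    then have "card {e \<in> E'. x \<in> e} \<le> 2"
      using card_edges_at_cycle[OF vs(1,2), of x] x vs(3) unfolding vs(4)[symmetric] by simp
    then have "deg (graph_of E') x \<le> 2" by (simp add: deg_def graph_of_def)
    then show ?thesis
      using deg_eq_card_nbr[of E' "{1..l}" x] edges_E' card_nbr_E' by (simp add: graph_of_def)
  qed
  have no: "x \<notin> S" if "x \<in> {1..n}" for x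
    using deg2S[of x] good_card_nbr[OF gE, of x] d3[OF that] that n_l by auto
  have ya: "y \<notin> S" "a \<notin> S" using no y_a_n by auto
  have "{a, p} \<in> E'" "{y, q} \<in> E'" by (auto simp: E'_eq)
  then have pq: "p \<notin> S" "q \<notin> S" using closed[of p a] closed[of q y] ya by (auto simp: insert_commute)
  have same: "{x, w} \<in> E \<longleftrightarrow> {x, w} \<in> E'" if "x \<in> S" for x w
    using that ya pq unfolding E'_eq by (auto simp: doubleton_eq_iff)
  have "(adj (graph_of E))\<^sup>* `` {v} = S"
  proof
    show "(adj (graph_of E))\<^sup>* `` {v} \<subseteq> S"
    proof clarify
      fix w assume "(v, w) \<in> (adj (graph_of E))\<^sup>*"
      then show "w \<in> S"
      proof (induction rule: rtrancl_induct)
        case (step b c)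
        then show ?case using same[of b c] closed[of b c] by (simp add: adj_def graph_of_def)
      qed (rule vS)
    qed
    show "S \<subseteq> (adj (graph_of E))\<^sup>* `` {v}"
    proof
      fix w assume "w \<in> S"
      then have "(v, w) \<in> (adj (graph_of E'))\<^sup>*" by (simp add: S_def)
      then have "(v, w) \<in> (adj (graph_of E))\<^sup>* \<and> w \<in> S"
      proof (induction rule: rtrancl_induct)
        case (step b c)
        then have "{b, c} \<in> E'" "b \<in> S" by (auto simp: adj_def graph_of_def)
        then show ?case using step same[of b c] closed[of b c]
          by (auto simp: adj_def graph_of_def intro: rtrancl_into_rtrancl)
      qed (use vS in simp)
      then show "w \<in> (adj (graph_of E))\<^sup>* `` {v}" by simp
    qed
  qed
  moreover have "{e \<in> E. e \<subseteq> S} = {e \<in> E'. e \<subseteq> S}" using ya unfolding E'_eq by auto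
  ultimately have "component_of (graph_of E) v = component_of (graph_of E') v"
    unfolding comp by (simp add: component_of_def Let_def graph_of_def)
  then show False using good_no_cycle[OF gE v] cyc by simp
qed

lemma good_E': "good E'"
  unfolding good_def graphs_minus_def mem_Collect_eq
proof (intro conjI ballI)
  show "simple_graph (graph_of E')" using edges_E' by (simp add: simple_graph_def graph_of_def)
  show "verts (graph_of E') = {1..l}" by (simp add: graph_of_def)
  have gE: "good E" using s by (simp add: Om_def s_def)
  show "deg (graph_of E') v = d v" if v: "v \<in> {1..l}" for v
    using deg_eq_card_nbr[of E' "{1..l}" v] edges_E' card_nbr_E'[of v] good_card_nbr[OF gE v]
    unfolding graph_of_def by simp
  show "\<not> is_cycle C" if C: "C \<in> graph_components (graph_of E')" for C
  proof -
    obtain v where "v \<in> {1..l}" "C = component_of (graph_of E') v"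
      using C by (auto simp: graph_components_def graph_of_def)
    then show ?thesis using no_cycle_E' by blast
  qed
qed

lemma labels_E': "lam' \<in> labels E'"
  unfolding labels_def
proof (intro CollectI conjI ballI)
  show "lam' \<in> extensional H"
    unfolding extensional_def
  proof (intro CollectI allI impI)
    fix k assume k: "k \<notin> H"
    then have "k \<noteq> h" "k \<noteq> g" "k \<noteq> sg s h" "k \<noteq> sg s g" using hg(1,2) sg_H[OF s] by auto
    moreover have "lam k = undefined"
      by (rule extensional_arb[OF _ k]) (use s in \<open>simp add: s_def Om_def labels_def\<close>)
    ultimately show "lam' k = undefined" by (simp add: lam'_eq)
  qed
  fix v assume v: "v \<in> {1..n}"
  let ?F = "{k \<in> H. base k = v}"
  have bij: "bij_betw lam ?F (nbr E v)" using s v by (auto simp: s_def Om_def labels_def)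
  have one: "bij_betw lam' ?F (insert b (nbr E v - {lam x}))"
    if "x \<in> ?F" "b \<notin> nbr E v" "lam' x = b" "\<And>k. k \<in> ?F \<Longrightarrow> k \<noteq> x \<Longrightarrow> lam' k = lam k" for x b
  proof -
    have "bij_betw (lam(x := b)) ?F (insert b (nbr E v - {lam x}))" by (rule bij_betw_upd[OF bij that(1,2)])
    moreover have "bij_betw (lam(x := b)) ?F C \<longleftrightarrow> bij_betw lam' ?F C" for C
      by (rule bij_betw_cong) (use that(3,4) in auto)
    ultimately show ?thesis by simp
  qed
  have bs: "base h = y" "base g = a" by (auto simp: y_def a_def)
  have keep: "lam' k = lam k"
    if "k \<noteq> h" "k \<noteq> g" "\<not> (dr s h \<and> k = sg s h)" "\<not> (dr s g \<and> k = sg s g)" for k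
    by (simp only: lam'_eq that if_False)
  have at_p: "\<not> (dr s h \<and> k = sg s h)" if "base k \<noteq> p" for k using that dr_h'(1) by blast
  have at_q: "\<not> (dr s g \<and> k = sg s g)" if "base k \<noteq> q" for k using that dr_g'(1) by blast
  have at_y: "k \<noteq> h" if "base k \<noteq> y" for k using that bs by blast
  have at_a: "k \<noteq> g" if "base k \<noteq> a" for k using that bs by blast
  note ne = dist4(1-5) hg(3)
  consider "v = y" | "v = a" | "v = p" | "v = q" | "v \<notin> {y, a, p, q}" by blast
  then show "bij_betw lam' ?F (nbr E' v)"
  proof cases
    case 1
    have "bij_betw lam' ?F (insert q (nbr E v - {lam h}))"
    proof (rule one)
      show "lam' k = lam k" if "k \<in> ?F" "k \<noteq> h" for k
        by (rule keep[OF that(2) at_a at_p at_q]) (use that(1) 1 ne in auto)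
      show "h \<in> ?F" using hg(1) bs(1) 1 by simp
      show "q \<notin> nbr E v" using nbr_mem(1) 1 by simp
      show "lam' h = q" by (simp add: lam'_eq)
    qed
    then show ?thesis using 1 by (simp add: nbr_E' p_def)
  next
    case 2
    have "bij_betw lam' ?F (insert p (nbr E v - {lam g}))"
    proof (rule one)
      show "lam' k = lam k" if "k \<in> ?F" "k \<noteq> g" for k
        by (rule keep[OF at_y that(2) at_p at_q]) (use that(1) 2 ne in auto)
      show "g \<in> ?F" using hg(2) bs(2) 2 by simp
      show "p \<notin> nbr E v" using nbr_mem(2) 2 by simp
      show "lam' g = p" using hg(6) by (simp add: lam'_eq)
    qed
    then show ?thesis using 2 hg(3) by (simp add: nbr_E' q_def)
  next
    case 3
    then have drh: "dr s h" using v dr_h by auto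
    have b: "base (sg s h) = p" by (rule dr_h'(1)[OF drh])
    have "bij_betw lam' ?F (insert a (nbr E v - {lam (sg s h)}))"
    proof (rule one)
      show "lam' k = lam k" if "k \<in> ?F" "k \<noteq> sg s h" for k
        by (rule keep[OF at_y at_a _ at_q]) (use that 3 ne in auto)
      show "sg s h \<in> ?F" using sg_H[OF s hg(1)] b 3 by simp
      show "a \<notin> nbr E v" using nbr_mem(3) 3 by simp
      show "lam' (sg s h) = a" using at_y[of "sg s h"] at_a[of "sg s h"] b ne drh by (simp add: lam'_eq)
    qed
    then show ?thesis using 3 dr_h'(2)[OF drh] ne by (simp add: nbr_E')
  next
    case 4
    then have drg: "dr s g" using v dr_g by auto
    have b: "base (sg s g) = q" by (rule dr_g'(1)[OF drg])
    have "bij_betw lam' ?F (insert y (nbr E v - {lam (sg s g)}))"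
    proof (rule one)
      show "lam' k = lam k" if "k \<in> ?F" "k \<noteq> sg s g" for k
        by (rule keep[OF at_y at_a at_p]) (use that 4 ne in auto)
      show "sg s g \<in> ?F" using sg_H[OF s hg(2)] b 4 by simp
      show "y \<notin> nbr E v" using nbr_mem(4) 4 by simp
      have "\<not> (dr s h \<and> sg s g = sg s h)" by (rule at_p) (use b ne in simp)
      then show "lam' (sg s g) = y"
        using at_y[of "sg s g"] at_a[of "sg s g"] b ne drg by (simp add: lam'_eq)
    qed
    then show ?thesis using 4 dr_g'(2)[OF drg] ne by (simp add: nbr_E')
  next
    case 5
    have "lam' k = lam k" if "k \<in> ?F" for k
      by (rule keep[OF at_y at_a at_p at_q]) (use that 5 in auto)
    then have "bij_betw lam' ?F (nbr E v) \<longleftrightarrow> bij_betw lam ?F (nbr E v)"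
      by (rule bij_betw_cong)
    then show ?thesis using 5 bij by (simp add: nbr_E')
  qed
qed

lemma sw_Om: "sw h g s \<in> Om"
  using good_E' labels_E' by (simp add: Om_def E'_def lam'_def s_def split_beta)

lemma dr_sw_state:
  assumes "k \<in> H"
  shows "dr (sw h g s) k = dr s (Transposition.transpose h g k)"
proof -
  have "dr (sw h g s) k \<longleftrightarrow> lam' k \<le> n" by (simp add: dr_def lam'_def s_def)
  moreover have "dr s j \<longleftrightarrow> lam j \<le> n" for j by (simp add: dr_def s_def)
  ultimately show ?thesis
    using hg(6) y_a_n dr_h'(2) dr_g'(2) unfolding lam'_eq Transposition.transpose_def p_def q_def by auto
qed

text \<open>The first edge at a dart occurs only at the beginning or at the end of a kernel edge, because its base is
a kernel vertex.\<close>

lemma edge_on_path: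
  assumes P: "leads s k P k'" and j: "j \<in> H" and i: "Suc i < length P"
    and e: "{P ! i, P ! Suc i} = {base j, lam j}"
  shows "(i = 0 \<and> k = j) \<or> (Suc i = length P - 1 \<and> k' = j)"
proof -
  have kp: "kpath n E P" using P by (simp add: leads_def s_def)
  have int: "n < P ! x" if "0 < x" "x < length P - 1" for x using kp that by (simp add: kpath_def)
  have bj: "base j \<le> n" using base[of j] j by auto
  consider "P ! i = base j" "P ! Suc i = lam j" | "P ! i = lam j" "P ! Suc i = base j"
    using e by (auto simp: doubleton_eq_iff)
  then show ?thesis
  proof cases
    case 1
    have "i = 0" using int[of i] 1 bj i by fastforce
    then have "base k = base j" "lam k = lam j" using P 1 by (auto simp: leads_def s_def)
    then have "k = j" using lam_inj[of E lam k j] s P j by (simp add: s_def leads_def)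
    then show ?thesis using \<open>i = 0\<close> by simp
  next
    case 2
    have last: "Suc i = length P - 1" using int[of "Suc i"] 2 bj i by fastforce
    then have "i = length P - 2" by simp
    then have "base k' = base j" "lam k' = lam j" using P 2 last by (auto simp: leads_def s_def)
    then have "k' = j" using lam_inj[of E lam k' j] s P j by (simp add: s_def leads_def)
    then show ?thesis using last by simp
  qed
qed

lemma sg_sw_fixed:
  assumes k: "k \<in> H" "k \<notin> {h, g}" "sg s k \<notin> {h, g}"
  shows "sg (sw h g s) k = sg s k"
proof -
  obtain P where P: "leads s k P (sg s k)" using leads_sg[OF s k(1)] by blast
  have kp: "kpath n E P" using P by (simp add: leads_def s_def)
  have "{P ! i, P ! Suc i} \<in> E'" if i: "Suc i < length P" for i
  proof -
    have "{P ! i, P ! Suc i} \<noteq> {y, p}" "{P ! i, P ! Suc i} \<noteq> {a, q}"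
      using edge_on_path[OF P hg(1) i] edge_on_path[OF P hg(2) i] k
      by (auto simp: y_def p_def a_def q_def)
    moreover have "{P ! i, P ! Suc i} \<in> E" using kp i by (simp add: kpath_def)
    ultimately show ?thesis by (simp add: E'_eq)
  qed
  then have kp': "kpath n E' P" using kp by (simp add: kpath_def)
  have ne: "k \<noteq> sg s h" "k \<noteq> sg s g" using k sg_sg[OF s] hg by auto
  have "sg s k \<noteq> sg s h" "sg s k \<noteq> sg s g" using k sg_sg[OF s] hg by (metis insertCI)+
  then have "lam' k = lam k" "lam' (sg s k) = lam (sg s k)"
    using ne k unfolding lam'_eq by auto
  then have "leads (sw h g s) k P (sg s k)"
    using P kp' by (simp add: leads_def E'_def lam'_def s_def)
  then show ?thesis by (rule sg_eq[OF sw_Om])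
qed

text \<open>The path that started at \<open>h\<close> now starts at \<open>g\<close>: only its first vertex is replaced.\<close>

lemma sg_sw_first: "sg (sw h g s) g = sg s h"
proof -
  obtain P where P: "leads s h P (sg s h)" using leads_sg[OF s hg(1)] by blast
  have kp: "kpath n E P" using P by (simp add: leads_def s_def)
  have len: "2 \<le> length P" using kp by (simp add: kpath_def)
  have P01: "P ! 0 = y" "P ! 1 = p" "P ! (length P - 1) = base (sg s h)" "P ! (length P - 2) = lam (sg s h)"
    using P by (auto simp: leads_def s_def y_def p_def)
  have shH: "sg s h \<in> H" by (rule sg_H[OF s hg(1)])
  have ne: "sg s h \<noteq> h" "sg s h \<noteq> g" "sg s g \<noteq> h" using sg_neq[OF s hg(1)] hg by (auto simp: a_def y_def)
  have ne2: "sg s h \<noteq> sg s g" using sg_sg[OF s hg(1)] sg_sg[OF s hg(2)] hg(6) by metis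
  define P' where "P' = P[0 := a]"
  have nth: "P' ! 0 = a" "\<And>i. 0 < i \<Longrightarrow> P' ! i = P ! i" "length P' = length P"
  proof -
    have "P \<noteq> []" using len by auto
    then show "P' ! 0 = a" by (simp add: P'_def)
  qed (simp_all add: P'_def)
  have edges: "{P' ! i, P' ! Suc i} \<in> E'" if i: "Suc i < length P" for i
  proof (cases "i = 0")
    case True
    then show ?thesis using nth P01 by (simp add: E'_eq)
  next
    case False
    have "{P ! i, P ! Suc i} \<noteq> {y, p}" "{P ! i, P ! Suc i} \<noteq> {a, q}"
      using edge_on_path[OF P hg(1) i] edge_on_path[OF P hg(2) i] False ne hg
      by (auto simp: y_def p_def a_def q_def)
    moreover have "{P ! i, P ! Suc i} \<in> E" using kp i by (simp add: kpath_def)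
    ultimately show ?thesis using False nth by (simp add: E'_eq)
  qed
  have no_return: "P' ! i \<noteq> P' ! Suc (Suc i)" if i: "Suc (Suc i) < length P" for i
  proof (cases "i = 0")
    case True
    have "a \<noteq> P ! 2"
    proof
      assume a2: "a = P ! 2"
      then have "\<not> n < P ! 2" using y_a_n by simp
      then have "\<not> 2 < length P - 1" using kp by (auto simp: kpath_def)
      then have "2 = length P - 1" using i True by simp
      then show False using a2 P01(3) hg by simp
    qed
    then show ?thesis using True nth by (simp add: numeral_2_eq_2)
  next
    case False
    then show ?thesis using kp i nth by (simp add: kpath_def)
  qed
  have "kpath n E' P'"
    unfolding kpath_def nth(3)
  proof (intro conjI allI impI)
    show "P' ! (length P - 1) \<le> n" using nth(2)[of "length P - 1"] len kp by (simp add: kpath_def)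
    show "n < P' ! i" if "0 < i \<and> i < length P - 1" for i using nth(2)[of i] that kp by (simp add: kpath_def)
  qed (use nth y_a_n len edges no_return in auto)
  moreover have "P' ! (length P - 2) = lam' (sg s h)"
  proof (cases "length P = 2")
    case True
    then have "dr s h" using direct_path[OF s P] by simp
    then show ?thesis using True nth ne by (simp add: lam'_eq)
  next
    case False
    then have "\<not> dr s h" using direct_path[OF s P] by simp
    moreover have "P' ! (length P - 2) = P ! (length P - 2)" using nth(2) len False by simp
    ultimately show ?thesis using P01 ne ne2 by (simp add: lam'_eq)
  qed
  moreover have "P' ! 1 = lam' g" using nth(2)[of 1] P01 hg by (simp add: lam'_eq)
  moreover have "P' ! (length P - 1) = base (sg s h)" using nth(2)[of "length P - 1"] P01 len by simp
  ultimately have "leads (sw h g s) g P' (sg s h)"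
    using nth hg shH by (simp add: leads_def E'_def lam'_def s_def a_def)
  then show ?thesis by (rule sg_eq[OF sw_Om])
qed

end

lemma sg_sw_eq:
  assumes s: "s \<in> Om" and sw: "swappable s h g" and k: "k \<in> H"
  shows "sg (sw h g s) k = Transposition.transpose h g (sg s (Transposition.transpose h g k))"
proof -
  obtain E lam where s': "s = (E, lam)" by fastforce
  note s0 = s[unfolded s'] and w0 = sw[unfolded s']
  have H: "h \<in> H" "g \<in> H" and ne: "h \<noteq> g" "base (sg s h) \<noteq> base g" "base (sg s g) \<noteq> base h"
    using sw by (auto simp: swappable_def)
  have O: "sw h g s \<in> Om" using sw_Om[OF s0 w0] s' by simp
  have self: "sg s h \<noteq> h" "sg s g \<noteq> g" using sg_neq[OF s] H by auto
  have cross: "sg s h \<noteq> g" "sg s g \<noteq> h" using ne by auto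
  have first: "sg (sw h g s) g = sg s h" using sg_sw_first[OF s0 w0] s' by simp
  have second: "sg (sw h g s) h = sg s g"
    using sg_sw_first[OF s0 swappable_sym[OF w0]] sw_sym[OF s sw] s' by simp
  consider "k = h" | "k = g" | "k \<notin> {h, g}" "sg s k = h" | "k \<notin> {h, g}" "sg s k = g"
    | "k \<notin> {h, g}" "sg s k \<notin> {h, g}" by blast
  then show ?thesis
  proof cases
    case 1
    then show ?thesis using second self cross by (simp add: Transposition.transpose_def)
  next
    case 2
    then show ?thesis using first self cross ne by (simp add: Transposition.transpose_def)
  next
    case 3
    then have kk: "k = sg s h" using sg_sg[OF s k] by simp
    have "sg (sw h g s) k = g" using sg_sg[OF O H(2)] first kk by simp
    then show ?thesis using 3 by (simp add: Transposition.transpose_def)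
  next
    case 4
    then have kk: "k = sg s g" using sg_sg[OF s k] by simp
    have "sg (sw h g s) k = h" using sg_sg[OF O H(1)] second kk by simp
    then show ?thesis using 4 by (simp add: Transposition.transpose_def)
  next
    case 5
    then have "sg (sw h g s) k = sg s k" using sg_sw_fixed[OF s0 w0 k] s' by simp
    then show ?thesis using 5 by (simp add: Transposition.transpose_def)
  qed
qed

lemma sw_injective:
  assumes s: "s \<in> Om" "swappable s h g" and r: "r \<in> Om" "swappable r h g" and eq: "sw h g s = sw h g r"
  shows "s = r"
proof -
  obtain E lam where s': "s = (E, lam)" by fastforce
  obtain F mu where r': "r = (F, mu)" by fastforce
  note s0 = s[unfolded s'] and r0 = r[unfolded r']
  have H: "h \<in> H" "g \<in> H" and ne: "h \<noteq> g" using s(2) by (auto simp: swappable_def)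
  have val: "snd (sw h g x) h = snd x g" "snd (sw h g x) g = snd x h" for x
    using ne by (auto simp: sw_def)
  have lab: "lam h = mu h" "lam g = mu g" using val[of s] val[of r] eq s' r' by auto
  have sgdr: "sg s k = sg r k \<and> dr s k = dr r k" if k: "k \<in> H" for k
  proof -
    have tk: "Transposition.transpose h g k \<in> H" using k H by (simp add: Transposition.transpose_def)
    have "Transposition.transpose h g (sg s k) = Transposition.transpose h g (sg r k)"
      using sg_sw_eq[OF s tk] sg_sw_eq[OF r tk] eq by simp
    then have "sg s k = sg r k" by (metis Transposition.transpose_involutory)
    moreover have "dr s k = dr r k"
      using dr_sw_state[OF s0 tk] dr_sw_state[OF r0 tk] eq s' r' by simp
    ultimately show ?thesis by simp
  qed
  have rec: "E1 = fst (sw h g (E1, l1)) - {{base h, l1 g}, {base g, l1 h}} \<union> {{base h, l1 h}, {base g, l1 g}}"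
    if "(E1, l1) \<in> Om" "swappable (E1, l1) h g" for E1 l1
    using dist4(6,7)[OF that] old_edges[OF that] by (auto simp: sw_def)
  have "E = F" using rec[OF s0] rec[OF r0] eq lab s' r' by simp
  moreover have "lam k = mu k" for k
  proof -
    have eqk: "snd (sw h g s) k = snd (sw h g r) k" using eq by simp
    show ?thesis
    proof (cases "k \<in> {h, g} \<or> (dr s h \<and> k = sg s h) \<or> (dr s g \<and> k = sg s g)")
      case True
      then show ?thesis
        using lab direct_end(2)[OF s(1) H(1)] direct_end(2)[OF s(1) H(2)]
          direct_end(2)[OF r(1) H(1)] direct_end(2)[OF r(1) H(2)] sgdr[OF H(1)] sgdr[OF H(2)] s' r' by auto
    next
      case False
      have keep: "snd (sw h g x) k = snd x k"
        if "k \<noteq> h" "k \<noteq> g" "\<not> (dr x h \<and> k = sg x h)" "\<not> (dr x g \<and> k = sg x g)" for x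
        by (simp only: sw_def snd_conv that if_False)
      have "snd (sw h g s) k = snd s k" by (rule keep) (use False in auto)
      moreover have "snd (sw h g r) k = snd r k"
        by (rule keep) (use False sgdr[OF H(1)] sgdr[OF H(2)] in auto)
      ultimately show ?thesis using eqk s' r' by simp
    qed
  qed
  then have "lam = mu" by blast
  ultimately show ?thesis using s' r' by simp
qed

sublocale switch_system H "{1..n}" base Om sg dr sw
proof
  fix s h g assume s: "s \<in> Om" "swappable s h g"
  obtain E lam where s': "s = (E, lam)" by fastforce
  show "sw h g s \<in> Om" using sw_Om[OF s[unfolded s']] s' by simp
  show "sg (sw h g s) k = Transposition.transpose h g (sg s (Transposition.transpose h g k))" if "k \<in> H" for k
    by (rule sg_sw_eq[OF s that])
  show "dr (sw h g s) k = dr s (Transposition.transpose h g k)" if "k \<in> H" for k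
    using dr_sw_state[OF s[unfolded s'] that] s' by simp
  show "s = r" if "r \<in> Om" "swappable r h g" "sw h g s = sw h g r" for r
    by (rule sw_injective[OF s that])
qed

end

section \<open>The kernel and its distances\<close>

text \<open>This finds an interior vertex at which a path leaves or enters a given set of edges.\<close>

lemma change_point:
  fixes Q :: "nat \<Rightarrow> bool"
  assumes "i < N" "Q i" "j < N" "\<not> Q j"
  shows "\<exists>k. Suc k < N \<and> Q k \<noteq> Q (Suc k)"
proof (rule ccontr)
  assume "\<not> ?thesis"
  then have same: "Q k = Q (Suc k)" if "Suc k < N" for k using that by blast
  have "Q k = Q 0" if "k < N" for k
    using that by (induction k) (auto simp: same[symmetric])
  then show False using assms by blast
qed

lemma madj_sym: "(x, y) \<in> madj K \<Longrightarrow> (y, x) \<in> madj K"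
  by (auto simp: madj_def insert_commute)

lemma relpow_sym:
  assumes "\<And>x y. (x, y) \<in> R \<Longrightarrow> (y, x) \<in> R"
  shows "(x, y) \<in> R ^^ i \<Longrightarrow> (y, x) \<in> R ^^ i"
proof (induction i arbitrary: y)
  case (Suc i)
  then obtain z where z: "(x, z) \<in> R ^^ i" "(z, y) \<in> R" by auto
  show ?case by (rule relpow_Suc_I2[OF assms[OF z(2)] Suc.IH[OF z(1)]])
qed simp

context degrees
begin

lemma deg_graph_of: "good E \<Longrightarrow> v \<in> {1..l} \<Longrightarrow> deg (graph_of E) v = d v"
  by (auto simp: good_def graphs_minus_def)

text \<open>A longer path would contain two consecutive edges of which exactly one belongs to \<open>p\<close>. Their
common vertex has degree two, so it is an interior vertex of \<open>p\<close>, but then both of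
its edges belong to \<open>p\<close>.\<close>

lemma kpath_maximal:
  assumes g: "good E" and p: "kpath n E p"
  shows "maximal_deg2_path (graph_of E) p"
proof -
  interpret subdivided n l E by (rule good_subdivided[OF g])
  have len: "2 \<le> length p" using p by (simp add: kpath_def)
  have ends: "p ! 0 \<le> n" "p ! (length p - 1) \<le> n" using p by (auto simp: kpath_def)
  have int: "n < p ! i" if "0 < i" "i < length p - 1" for i using p that by (simp add: kpath_def)
  have e: "{p ! i, p ! Suc i} \<in> E" if "Suc i < length p" for i using p that by (simp add: kpath_def)
  have nb: "p ! i \<noteq> p ! Suc (Suc i)" if "Suc (Suc i) < length p" for i using p that by (simp add: kpath_def)
  have ne: "p \<noteq> []" using len by auto
  have hd: "hd p = p ! 0" "last p = p ! (length p - 1)" using ne by (simp_all add: hd_conv_nth last_conv_nth)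
  have inV: "p ! i \<in> {1..l}" if i: "i < length p" for i
  proof (cases "i = 0")
    case True then show ?thesis using edgeD[OF e[of 0]] len by simp
  next
    case False
    then obtain j where "i = Suc j" by (cases i) auto
    then show ?thesis using edgeD[OF e[of j]] i by simp
  qed
  have dist: "p ! i \<noteq> p ! j" if ij: "i < j" "j < length p" "0 < i \<or> j < length p - 1" for i j
  proof -
    consider "i = 0" "j < length p - 1" | "0 < i" "j = length p - 1" | "0 < i" "j < length p - 1"
      using ij by linarith
    then show ?thesis
    proof cases
      case 1 then show ?thesis using ends(1) int[of j] ij by auto
    next
      case 2 then show ?thesis using ends(2) int[of i] ij by auto
    next
      case 3 then show ?thesis using kpath_internal_inj[OF p] ij by simp
    qed
  qed
  have gp: "graph_path (graph_of E) p"
    unfolding graph_path_def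
  proof (intro conjI impI)
    show "set p \<subseteq> verts (graph_of E)" using inV by (auto simp: graph_of_def in_set_conv_nth simp del: atLeastAtMost_iff)
    show "path_edges p \<subseteq> edges (graph_of E)" using e by (auto simp: path_edges_def graph_of_def)
    have "butlast p ! i \<noteq> butlast p ! j" if "i < j" "j < length (butlast p)" for i j
      using that dist[of i j] by (simp add: nth_butlast)
    then show "distinct (butlast p)" unfolding distinct_conv_nth by (metis nat_neq_iff)
    have "tl p ! i \<noteq> tl p ! j" if "i < j" "j < length (tl p)" for i j
      using that dist[of "Suc i" "Suc j"] by (simp add: nth_tl)
    then show "distinct (tl p)" unfolding distinct_conv_nth by (metis nat_neq_iff)
    show "4 \<le> length p" if c: "hd p = last p"
    proof (rule ccontr)
      assume "\<not> ?thesis"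
      then consider "length p = 2" | "length p = 3" using len by linarith
      then show False
      proof cases
        case 1 then show False using c hd edgeD[OF e[of 0]] by simp
      next
        case 2 then show False using c hd nb[of 0] by (simp add: numeral_2_eq_2)
      qed
    qed
  qed (rule len)
  have d2p: "deg2_path (graph_of E) p"
    unfolding deg2_path_def
  proof (intro conjI gp ballI)
    fix v assume "v \<in> internal_verts p"
    then obtain i where i: "i < length (butlast (tl p))" "v = butlast (tl p) ! i"
      unfolding internal_verts_def by (auto simp: in_set_conv_nth)
    then have v: "v = p ! Suc i" "Suc i < length p - 1" by (auto simp: nth_butlast nth_tl)
    then have "n < v" "v \<in> {1..l}" using int[of "Suc i"] inV[of "Suc i"] by auto
    then show "deg (graph_of E) v = 2" using deg_graph_of[OF g] d2 by simp
  qed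
  have "\<not> (\<exists>q. deg2_path (graph_of E) q \<and> path_edges p \<subset> path_edges q)"
  proof
    assume "\<exists>q. deg2_path (graph_of E) q \<and> path_edges p \<subset> path_edges q"
    then obtain q where q: "deg2_path (graph_of E) q" "path_edges p \<subset> path_edges q" by blast
    define Q where "Q i \<longleftrightarrow> {q ! i, q ! Suc i} \<in> path_edges p" for i
    have "{p ! 0, p ! Suc 0} \<in> path_edges p" using len unfolding path_edges_def by auto
    then have "{p ! 0, p ! Suc 0} \<in> path_edges q" using q by blast
    then obtain i where i: "Suc i < length q" "Q i"
      using \<open>{p ! 0, p ! Suc 0} \<in> path_edges p\<close> unfolding Q_def path_edges_def[of q] by auto
    obtain f where "f \<in> path_edges q" "f \<notin> path_edges p" using q by blast
    then obtain j where j: "Suc j < length q" "\<not> Q j" unfolding Q_def path_edges_def[of q] by auto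
    obtain k where k: "Suc k < length q - 1" "Q k \<noteq> Q (Suc k)"
    proof -
      have "i < length q - 1" "j < length q - 1" using i j by linarith+
      then show ?thesis using change_point[of i "length q - 1" Q j] i(2) j(2) that by blast
    qed
    define z where "z = q ! Suc k"
    have qE: "{q ! x, q ! Suc x} \<in> E" if "Suc x < length q" for x
      using q(1) that unfolding deg2_path_def graph_path_def path_edges_def graph_of_def by auto
    have e1: "{z, q ! k} \<in> E" using qE[of k] k by (simp add: z_def insert_commute)
    have e2: "{z, q ! Suc (Suc k)} \<in> E" using qE[of "Suc k"] k by (simp add: z_def)
    have zin: "z \<in> internal_verts q"
    proof -
      have "z = butlast (tl q) ! k" "k < length (butlast (tl q))" using k by (auto simp: z_def nth_butlast nth_tl)
      then show ?thesis unfolding internal_verts_def by simp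
    qed
    then have "deg (graph_of E) z = 2" using q(1) by (simp add: deg2_path_def)
    moreover have zl: "z \<in> {1..l}" using edgeD[OF e1] by simp
    ultimately have zn: "n < z" using deg_graph_of[OF g zl] d3[of z] by fastforce
    have "\<exists>x. Suc x < length p \<and> (z = p ! x \<or> z = p ! Suc x)"
    proof (cases "Q k")
      case True
      then obtain x where "Suc x < length p" "{q ! k, z} = {p ! x, p ! Suc x}" by (auto simp: Q_def path_edges_def z_def)
      then show ?thesis by (auto simp: doubleton_eq_iff)
    next
      case False
      then have "Q (Suc k)" using k by simp
      then obtain x where "Suc x < length p" "{z, q ! Suc (Suc k)} = {p ! x, p ! Suc x}" by (auto simp: Q_def path_edges_def z_def)
      then show ?thesis by (auto simp: doubleton_eq_iff)
    qed
    then obtain x where x: "x < length p" "z = p ! x" using Suc_lessD by blast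
    have "x \<noteq> 0" using x(2) zn ends(1) by (metis not_le)
    moreover have "x \<noteq> length p - 1" using x(2) zn ends(2) by (metis not_le)
    ultimately have "x \<noteq> 0" "Suc x < length p" using x(1) by linarith+
    then obtain x' where x': "x = Suc x'" "Suc x < length p" using x by (cases x) auto
    have a: "{z, p ! x'} \<in> E" "{z, p ! Suc x} \<in> E" "p ! x' \<noteq> p ! Suc x"
      using e[of x'] e[of x] nb[of x'] x x' by (auto simp: insert_commute)
    have pe: "{z, p ! x'} \<in> path_edges p" "{z, p ! Suc x} \<in> path_edges p"
      using x x' unfolding path_edges_def by (auto simp: insert_commute)
    have all: "{z, w} \<in> path_edges p" if "{z, w} \<in> E" for w
      using other_nbr[OF zn a that] pe by auto
    have "Q k" using all[OF e1] by (simp add: Q_def z_def insert_commute)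
    moreover have "Q (Suc k)" using all[OF e2] by (simp only: Q_def z_def)
    ultimately have "Q k" "Q (Suc k)" by auto
    then show False using k by simp
  qed
  then show ?thesis using d2p by (simp add: maximal_deg2_path_def)
qed

lemma kernel_adjacent:
  assumes s: "s \<in> Om" and h: "h \<in> H"
  shows "(base h, base (sg s h)) \<in> madj (graph_kernel (graph_of (fst s)))"
proof -
  have g: "good (fst s)" using s by (auto simp: Om_def)
  obtain p where p: "leads s h p (sg s h)" using leads_sg[OF s h] by blast
  then have kp: "kpath n (fst s) p" by (simp add: leads_def)
  have "p \<noteq> []" using kp by (auto simp: kpath_def)
  then have hd: "hd p = base h" "last p = base (sg s h)" using p by (simp_all add: hd_conv_nth last_conv_nth leads_def)
  have "({hd p, last p}, path_edges p) \<in> medges (graph_kernel (graph_of (fst s)))"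
    using kpath_maximal[OF g kp] by (auto simp: graph_kernel_def)
  moreover have "mends (graph_kernel (graph_of (fst s))) ({hd p, last p}, path_edges p) = {base h, base (sg s h)}"
    by (simp add: graph_kernel_def hd)
  ultimately show ?thesis unfolding madj_def by blast
qed

lemma reach_walk:
  assumes s: "s \<in> Om"
  shows "v \<in> reach s {} u j \<Longrightarrow> \<exists>i \<le> j. (u, v) \<in> madj (graph_kernel (graph_of (fst s))) ^^ i"
proof (induction j arbitrary: v)
  case 0
  then show ?case by (intro exI[of _ 0]) (simp add: reach.simps)
next
  case (Suc j)
  then consider "v \<in> reach s {} u j" | h where "h \<in> H" "base h \<in> reach s {} u j" "v = base (sg s h)"
    by (auto simp: reach.simps)
  then show ?case
  proof cases
    case 1
    then show ?thesis using Suc.IH le_SucI by blast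
  next
    case 2
    then obtain i where "i \<le> j" "(u, base h) \<in> madj (graph_kernel (graph_of (fst s))) ^^ i" using Suc.IH by blast
    then show ?thesis using kernel_adjacent[OF s 2(1)] 2(3) by (intro exI[of _ "Suc i"]) auto
  qed
qed

text \<open>Two balls of volume greater than \<open>m\<close> cannot be disjoint since there are only \<open>2 m\<close> darts.\<close>

lemma diam_le:
  assumes s: "s \<in> Om" and big: "\<And>u. u \<in> {1..n} \<Longrightarrow> m < vol (reach s {} u R)"
  shows "diam_plus (graph_kernel (graph_of (fst s))) \<le> enat (2 * R)"
proof -
  let ?K = "graph_kernel (graph_of (fst s))"
  have g: "good (fst s)" using s by (auto simp: Om_def)
  have mv: "v \<in> {1..n}" if "v \<in> mverts ?K" for v
  proof -
    have v: "v \<in> {1..l}" "3 \<le> deg (graph_of (fst s)) v" using that by (auto simp: graph_kernel_def graph_of_def)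
    then show ?thesis using deg_graph_of[OF g v(1)] d2[of v] by fastforce
  qed
  have "mdist ?K u v \<le> enat (2 * R)" if uv: "u \<in> mverts ?K" "v \<in> mverts ?K" for u v
  proof -
    have "\<exists>w. w \<in> reach s {} u R \<and> w \<in> reach s {} v R"
    proof (rule ccontr)
      assume no: "\<not> ?thesis"
      let ?A = "\<lambda>u. {h \<in> H. base h \<in> reach s {} u R}"
      have "card (?A u \<union> ?A v) = card (?A u) + card (?A v)"
        by (rule card_Un_disjoint) (use no in auto)
      moreover have "card (?A u \<union> ?A v) \<le> card H" by (rule card_mono) auto
      ultimately show False using big[OF mv[OF uv(1)]] big[OF mv[OF uv(2)]] by (simp add: vol_def)
    qed
    then obtain w where w: "w \<in> reach s {} u R" "w \<in> reach s {} v R" by blast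
    obtain i where i: "i \<le> R" "(u, w) \<in> madj ?K ^^ i" using reach_walk[OF s w(1)] by blast
    obtain j where j: "j \<le> R" "(v, w) \<in> madj ?K ^^ j" using reach_walk[OF s w(2)] by blast
    have "(w, v) \<in> madj ?K ^^ j" by (rule relpow_sym[OF madj_sym j(2)])
    then have "(u, v) \<in> madj ?K ^^ (i + j)" using i(2) by (auto simp: relpow_add)
    then have "mdist ?K u v \<le> enat (i + j)" unfolding mdist_def by (intro INF_lower) simp
    also have "\<dots> \<le> enat (2 * R)" using i(1) j(1) by simp
    finally show ?thesis .
  qed
  then show ?thesis unfolding diam_plus_def by (intro SUP_least) auto
qed

section \<open>Counting labellings\<close>

lemma finite_labels: "good E \<Longrightarrow> finite (labels E)"
proof -
  assume g: "good E"
  have "(\<lambda>lam. (E, lam)) ` labels E \<subseteq> Om" using g by (auto simp: Om_def)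
  then have "finite ((\<lambda>lam. (E, lam)) ` labels E)" using finite_Om finite_subset by blast
  then show ?thesis by (rule finite_imageD) (auto simp: inj_on_def)
qed

text \<open>Composing with bijections between the neighbourhoods turns labellings of one graph into labellings
of the other one.\<close>

lemma card_labels_le:
  assumes E: "good E" and F: "good F"
  shows "card (labels E) \<le> card (labels F)"
proof -
  have "\<exists>f. bij_betw f (nbr E v) (nbr F v)" if "v \<in> {1..n}" for v
  proof (rule finite_same_card_bij)
    have v: "v \<in> {1..l}" using that n_l by auto
    have c: "card (nbr E v) = d v" "card (nbr F v) = d v" using good_card_nbr E F v by auto
    then show "card (nbr E v) = card (nbr F v)" by simp
    show "finite (nbr E v)" "finite (nbr F v)" using c d3[OF that] by (auto intro: card_ge_0_finite)
  qed
  then obtain f where f: "\<And>v. v \<in> {1..n} \<Longrightarrow> bij_betw (f v) (nbr E v) (nbr F v)" by metis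
  define T where "T lam = restrict (\<lambda>h. f (base h) (lam h)) H" for lam
  show ?thesis
  proof (rule card_inj_on_le[of T])
    show "inj_on T (labels E)"
    proof (rule inj_onI)
      fix a b assume a: "a \<in> labels E" and b: "b \<in> labels E" and eq: "T a = T b"
      show "a = b"
      proof (rule extensionalityI[of a H b])
        show "a \<in> extensional H" "b \<in> extensional H" using a b by (auto simp: labels_def)
        fix h assume h: "h \<in> H"
        have v: "base h \<in> {1..n}" using base[of h] h by simp
        have "a h \<in> nbr E (base h)" "b h \<in> nbr E (base h)"
          using lam_nbr[of E a h] lam_nbr[of E b h] a b E h by (auto simp: Om_def nbr_def)
        moreover have "f (base h) (a h) = f (base h) (b h)" using fun_cong[OF eq, of h] h by (simp add: T_def)
        ultimately show "a h = b h" using f[OF v] by (auto simp: bij_betw_def inj_on_def)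
      qed
    qed
    show "T ` labels E \<subseteq> labels F"
    proof clarify
      fix a assume a: "a \<in> labels E"
      show "T a \<in> labels F" unfolding labels_def
      proof (intro CollectI conjI ballI)
        show "T a \<in> extensional H" by (simp add: T_def)
        fix v assume v: "v \<in> {1..n}"
        have "bij_betw (f v \<circ> a) {h \<in> H. base h = v} (nbr F v)"
          by (rule bij_betw_trans[OF _ f[OF v]]) (use a v in \<open>simp add: labels_def\<close>)
        moreover have "bij_betw (f v \<circ> a) {h \<in> H. base h = v} (nbr F v) \<longleftrightarrow> bij_betw (T a) {h \<in> H. base h = v} (nbr F v)"
          by (rule bij_betw_cong) (auto simp: T_def)
        ultimately show "bij_betw (T a) {h \<in> H. base h = v} (nbr F v)" by simp
      qed
    qed
  qed (rule finite_labels[OF F])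
qed

lemma labels_nonempty:
  assumes E: "good E"
  shows "labels E \<noteq> {}"
proof -
  have "\<exists>f. bij_betw f {h \<in> H. base h = v} (nbr E v)" if "v \<in> {1..n}" for v
  proof (rule finite_same_card_bij)
    have v: "v \<in> {1..l}" using that n_l by auto
    have c: "card (nbr E v) = d v" using good_card_nbr E v by auto
    then show "card {h \<in> H. base h = v} = card (nbr E v)" using fiber[OF that] by simp
    show "finite (nbr E v)" using c d3[OF that] by (auto intro: card_ge_0_finite)
  qed simp
  then obtain f where f: "\<And>v. v \<in> {1..n} \<Longrightarrow> bij_betw (f v) {h \<in> H. base h = v} (nbr E v)" by metis
  have "restrict (\<lambda>h. f (base h) h) H \<in> labels E" unfolding labels_def
  proof (intro CollectI conjI ballI)
    fix v assume v: "v \<in> {1..n}"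
    have "bij_betw (f v) {h \<in> H. base h = v} (nbr E v) \<longleftrightarrow>
        bij_betw (restrict (\<lambda>h. f (base h) h) H) {h \<in> H. base h = v} (nbr E v)"
      by (rule bij_betw_cong) auto
    then show "bij_betw (restrict (\<lambda>h. f (base h) h) H) {h \<in> H. base h = v} (nbr E v)" using f[OF v] by simp
  qed simp
  then show ?thesis by blast
qed

lemma n_le_m: "3 * n \<le> 2 * m"
proof -
  have "vol {1..n} \<le> card H" unfolding vol_def by (rule card_mono) auto
  then show ?thesis using vol_ge[of "{1..n}"] by simp
qed

end

lemma base_exists:
  fixes d :: "nat \<Rightarrow> nat"
  assumes "2 * m = (\<Sum>v = 1..n. d v)"
  shows "\<exists>base. (\<forall>h < 2 * m. base h \<in> {1..n}) \<and> (\<forall>v \<in> {1..n}. card {h \<in> {..<2 * m}. base h = v} = d v)"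
proof -
  let ?M = "SIGMA v : {1..n}. {..<d v}"
  have "card ?M = 2 * m" using assms by simp
  then obtain f where f: "bij_betw f {0..<2 * m} ?M" using ex_bij_betw_nat_finite[of ?M] by auto
  have "card {h \<in> {..<2 * m}. fst (f h) = v} = d v" if v: "v \<in> {1..n}" for v
  proof -
    have "f ` {h \<in> {..<2 * m}. fst (f h) = v} = {v} \<times> {..<d v}"
    proof
      show "f ` {h \<in> {..<2 * m}. fst (f h) = v} \<subseteq> {v} \<times> {..<d v}"
      proof
        fix x assume "x \<in> f ` {h \<in> {..<2 * m}. fst (f h) = v}"
        then obtain h where h: "h < 2 * m" "fst (f h) = v" "x = f h" by auto
        have "f h \<in> ?M" by (rule bij_betw_apply[OF f]) (use h in simp)
        then show "x \<in> {v} \<times> {..<d v}" using h by auto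
      qed
      show "{v} \<times> {..<d v} \<subseteq> f ` {h \<in> {..<2 * m}. fst (f h) = v}"
      proof
        fix x assume x: "x \<in> {v} \<times> {..<d v}"
        then have "x \<in> f ` {0..<2 * m}" using f v by (auto simp: bij_betw_def)
        then obtain h where h: "h < 2 * m" "x = f h" by auto
        then have "fst (f h) = v" using x by auto
        then show "x \<in> f ` {h \<in> {..<2 * m}. fst (f h) = v}" using h by blast
      qed
    qed
    moreover have "inj_on f {h \<in> {..<2 * m}. fst (f h) = v}"
      by (rule inj_on_subset[of f "{0..<2 * m}"]) (use f in \<open>auto simp: bij_betw_def\<close>)
    then have "card (f ` {h \<in> {..<2 * m}. fst (f h) = v}) = card {h \<in> {..<2 * m}. fst (f h) = v}"
      by (rule card_image)
    ultimately show ?thesis by (simp add: card_cartesian_product)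
  qed
  moreover have "fst (f h) \<in> {1..n}" if "h < 2 * m" for h
  proof -
    have "f h \<in> ?M" using f that by (intro bij_betw_apply[OF f]) simp
    then show ?thesis by auto
  qed
  ultimately show ?thesis by (intro exI[of _ "\<lambda>h. fst (f h)"]) blast
qed

context degrees
begin

section \<open>The diameter of the kernel\<close>

text \<open>All graphs have the same number of labellings, so that probabilities may be computed with labelled
graphs. The union bound is over the at most \<open>m\<close> kernel vertices.\<close>

lemma diameter_bound:
  assumes su: "suitable m R t V1" and R: "2 * real R < 31 * ln (real m)" and ne: "graphs_minus l d \<noteq> {}"
  shows "measure_pmf.prob (pmf_of_set (graphs_minus l d))
      {C. ereal (31 * ln (real m)) \<le> ereal_of_enat (diam_plus (graph_kernel C))}
    \<le> (461 * ((461 * 460) ^ 4 * 4 ^ 6) + 2) / real m"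
proof -
  let ?G = "graphs_minus l d"
  let ?long = "\<lambda>C. ereal (31 * ln (real m)) \<le> ereal_of_enat (diam_plus (graph_kernel C))"
  let ?c = "461 * ((461 * 460) ^ 4 * 4 ^ 6) + 2 :: real"
  define Es where "Es = {E. good E}"
  define Bad where "Bad = {E. good E \<and> ?long (graph_of E)}"
  have inj: "inj_on graph_of A" for A by (auto simp: inj_on_def graph_of_def)
  have G: "?G = graph_of ` Es"
  proof
    show "?G \<subseteq> graph_of ` Es"
    proof
      fix C assume C: "C \<in> ?G"
      then have "C = graph_of (edges C)" by (auto simp: graphs_minus_def graph_of_def)
      then show "C \<in> graph_of ` Es" using C by (auto simp: Es_def good_def intro!: image_eqI[of C _ "edges C"])
    qed
  qed (auto simp: Es_def good_def)
  have finEs: "finite Es" using finite_imageD[OF _ inj] finite_graphs_minus G by metis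
  have finBad: "finite Bad" by (rule finite_subset[OF _ finEs]) (auto simp: Bad_def Es_def)
  have cG: "card ?G = card Es" unfolding G by (rule card_image[OF inj])
  have "?G \<inter> {C. ?long C} = graph_of ` Bad" unfolding G by (auto simp: Bad_def Es_def)
  then have cB: "card (?G \<inter> {C. ?long C}) = card Bad" using card_image[OF inj] by simp
  obtain E0 where E0: "good E0" using ne G by (auto simp: Es_def)
  define K where "K = card (labels E0)"
  have K: "card (labels E) = K" if "good E" for E
    using card_labels_le[OF that E0] card_labels_le[OF E0 that] by (simp add: K_def)
  have K0: "0 < K" using labels_nonempty[OF E0] finite_labels[OF E0] by (simp add: K_def card_gt_0_iff)
  have Om_eq: "Om = Sigma Es labels" by (auto simp: Om_def Es_def)
  have cOm: "card Om = card Es * K"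
    unfolding Om_eq using finEs finite_labels K by (simp add: Es_def)
  have cBad: "card (Sigma Bad labels) = card Bad * K"
    using finBad finite_labels K by (simp add: Bad_def)
  have m0: "0 < m" using su by (simp add: suitable_def)
  have sub: "Sigma Bad labels \<subseteq> (\<Union>u \<in> {1..n}. {s \<in> Om. vol (reach s {} u R) \<le> m})"
  proof
    fix s assume s: "s \<in> Sigma Bad labels"
    then have sO: "s \<in> Om" by (auto simp: Om_def Bad_def)
    have long: "?long (graph_of (fst s))" using s by (auto simp: Bad_def)
    have "\<exists>u \<in> {1..n}. vol (reach s {} u R) \<le> m"
    proof (rule ccontr)
      assume a: "\<not> ?thesis"
      have "diam_plus (graph_kernel (graph_of (fst s))) \<le> enat (2 * R)"
      proof (rule diam_le[OF sO])
        show "m < vol (reach s {} u R)" if "u \<in> {1..n}" for u using a that not_le by blast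
      qed
      then have e: "ereal_of_enat (diam_plus (graph_kernel (graph_of (fst s)))) \<le> ereal_of_enat (enat (2 * R))"
        by (simp only: ereal_of_enat_le_iff)
      have "ereal (31 * ln (real m)) \<le> ereal (2 * real R)" using order_trans[OF long e] by simp
      then show False using R by simp
    qed
    then show "s \<in> (\<Union>u \<in> {1..n}. {s \<in> Om. vol (reach s {} u R) \<le> m})" using sO by blast
  qed
  have "card (Sigma Bad labels) \<le> card (\<Union>u \<in> {1..n}. {s \<in> Om. vol (reach s {} u R) \<le> m})"
    by (rule card_mono[OF _ sub]) (auto intro: finite_subset[OF _ finite_Om])
  from of_nat_mono[OF this, where 'a = real]
  have "real (card Bad * K) \<le> real (card (\<Union>u \<in> {1..n}. {s \<in> Om. vol (reach s {} u R) \<le> m}))"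
    by (simp only: cBad)
  also have "\<dots> \<le> real (card {1..n}) * (real (card Om) * ?c / (real m)\<^sup>2)"
    by (rule card_UN_bound) (simp, rule slow_exploration_rare[OF _ su], simp_all)
  also have "\<dots> = real n * (real (card Es) * real K * ?c / (real m)\<^sup>2)" by (simp add: cOm)
  also have "\<dots> \<le> real m * (real (card Es) * real K * ?c / (real m)\<^sup>2)"
    using n_le_m by (intro mult_right_mono) auto
  also have "\<dots> = real (card Es) * ?c / real m * real K"
    using m0 by (simp add: power2_eq_square)
  finally have "real (card Bad) * real K \<le> real (card Es) * ?c / real m * real K" by simp
  then have "real (card Bad) \<le> real (card Es) * ?c / real m" by (rule mult_right_le_imp_le) (use K0 in simp)
  moreover have "0 < card Es" using ne G finEs by (auto simp: card_gt_0_iff)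
  ultimately have "real (card Bad) / real (card Es) \<le> ?c / real m"
    using divide_right_mono[of "real (card Bad)" "real (card Es) * ?c / real m" "real (card Es)"] by simp
  then show ?thesis
    using measure_pmf_of_set[OF ne finite_graphs_minus] cG cB by simp
qed

end

theorem theorem1p10:
  "\<exists>c::real. 0 < c \<and>
     (\<forall>(n::nat) (l::nat) (m::nat) (d::nat \<Rightarrow> nat).
        0 < n \<longrightarrow> n \<le> l \<longrightarrow> degree_sequence l d \<longrightarrow>
        (\<forall>v \<in> {1..n}. 3 \<le> d v) \<longrightarrow> (\<forall>v \<in> {n<..l}. d v = 2) \<longrightarrow>
        graphs_minus l d \<noteq> {} \<longrightarrow> 2 * m = (\<Sum>v = 1..n. d v) \<longrightarrow>
        measure_pmf.prob (pmf_of_set (graphs_minus l d))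
          {C. ereal (31 * ln (real m)) \<le> ereal_of_enat (diam_plus (graph_kernel C))}
        \<le> c / real m)"
proof -
  obtain m0 where m0: "0 < m0"
    "\<And>m. m0 \<le> m \<Longrightarrow> \<exists>R t V1. suitable m R t V1 \<and> 2 * real R < 31 * ln (real m)"
    using suitable_exists by auto
  define c where "c = (461 * ((461 * 460) ^ 4 * 4 ^ 6) + 2) + real m0"
  show ?thesis
  proof (intro exI[of _ c] conjI allI impI)
    show "0 < c" by (simp add: c_def)
    fix n l m :: nat and d :: "nat \<Rightarrow> nat"
    assume n: "0 < n" "n \<le> l" and d3: "\<forall>v \<in> {1..n}. 3 \<le> d v" and d2: "\<forall>v \<in> {n<..l}. d v = 2"
      and ne: "graphs_minus l d \<noteq> {}" and m: "2 * m = (\<Sum>v = 1..n. d v)"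
    have "(\<Sum>v = 1..n. 3) \<le> (\<Sum>v = 1..n. d v)" by (rule sum_mono) (use d3 in auto)
    then have mpos: "0 < m" using n m by simp
    show "measure_pmf.prob (pmf_of_set (graphs_minus l d))
        {C. ereal (31 * ln (real m)) \<le> ereal_of_enat (diam_plus (graph_kernel C))} \<le> c / real m"
      (is "?p \<le> _")
    proof (cases "m0 \<le> m")
      case True
      obtain base where "\<forall>h < 2 * m. base h \<in> {1..n}"
        "\<forall>v \<in> {1..n}. card {h \<in> {..<2 * m}. base h = v} = d v" using base_exists[OF m] by blast
      then interpret degrees n l m d base
        using n d3 d2 by unfold_locales auto
      obtain R t V1 where "suitable m R t V1" "2 * real R < 31 * ln (real m)" using m0(2)[OF True] by blast
      from diameter_bound[OF this ne] show ?thesis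
        by (rule order_trans) (simp add: c_def divide_right_mono)
    next
      case False
      have "?p \<le> 1" by simp
      also have "1 \<le> real m0 / real m" using False mpos by simp
      also have "\<dots> \<le> c / real m" by (rule divide_right_mono) (simp_all add: c_def)
      finally show ?thesis .
    qed
  qed
qed

end
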